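(* Let $S$ be a positive dimensional projective algebraic (complex) manifold, $m=\dim S$, and let $B\subset\mathbb C^m$ be the open Euclidean unit ball. Let $\Lambda\to S$ be a holomorphic line bundle that admits a positively curved metric, and let $0<\sigma<\sigma'<1$. There are a semipositively curved smooth metric $h$ on $\Lambda$, a holomorphic embedding $\varepsilon:B\to S$, and a holomorphic section $l$ of $\Lambda|\varepsilon(B)$ such that $h\circ l=1$ on $\varepsilon(\sigma B)$, and $h$ is positively curved on $S\setminus\varepsilon(\sigma'B)$.
   Context: A (hermitian) metric on a holomorphic vector bundle $E\to S$ is a function $h:E\to\mathbb R$ on the total space whose restriction to each fiber has the form $v\mapsto\hat h(v,v)$ with $\hat h$ a positive definite hermitian form (so for a line bundle, $h(v)$ is the square of the length of $v$); it is smooth if $h$ is $C^\infty$. The metric $h$ is seminegatively curved if $h$ is plurisubharmonic on the total space $E$; it is negatively curved if $h$ is smooth and strongly plurisubharmonic ($i\partial\bar\partial h>0$) on $E$ away from the zero section. The metric $h$ is (semi)positively curved if the dual metric $h^*$ on the dual bundle $E^*$ is (semi)negatively curved. For $\sigma>0$, $\sigma B=\{s\in\mathbb C^m:\|s\|<\sigma\}$, with $\|\ \|$ the Euclidean norm. *)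

theory Defs
  imports "HOL-Analysis.Analysis"
begin

section \<open>Functions on open subsets of complex coordinate space\<close>

definition complex_linear :: "(complex^'k \<Rightarrow> complex^'l) \<Rightarrow> bool" where
  "complex_linear L \<longleftrightarrow> (\<forall>v w. L (v + w) = L v + L w) \<and> (\<forall>c v. L (c *s v) = c *s L v)"

definition vec_holomorphic_on :: "(complex^'k \<Rightarrow> complex^'l) \<Rightarrow> (complex^'k) set \<Rightarrow> bool" where
  "vec_holomorphic_on f D \<longleftrightarrow>
     open D \<and> (\<forall>z\<in>D. \<exists>L. (f has_derivative L) (at z) \<and> complex_linear L)"

text \<open>Real differentiability classes on an open set: a \<open>C\<^sup>n\<^sup>+\<^sup>1\<close> function is one that is differentiable
  and all of whose directional derivatives are \<open>C\<^sup>n\<close>.\<close>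

primrec Ck_on :: "nat \<Rightarrow> ('v::euclidean_space) set \<Rightarrow> ('v \<Rightarrow> 'w::real_normed_vector) \<Rightarrow> bool" where
  "Ck_on 0 D f \<longleftrightarrow> continuous_on D f"
| "Ck_on (Suc n) D f \<longleftrightarrow>
     (\<forall>x\<in>D. f differentiable (at x)) \<and> (\<forall>v. Ck_on n D (\<lambda>x. frechet_derivative f (at x) v))"

definition smooth_on :: "('v::euclidean_space) set \<Rightarrow> ('v \<Rightarrow> 'w::real_normed_vector) \<Rightarrow> bool" where
  "smooth_on D f \<longleftrightarrow> (\<forall>n. Ck_on n D f)"

text \<open>The Wirtinger derivatives \<open>\<partial>f/\<partial>z\<^sub>j\<close> and \<open>\<partial>f/\<partial>zbar\<^sub>j\<close>.\<close>

definition wirtinger :: "'k::finite \<Rightarrow> (complex^'k \<Rightarrow> complex) \<Rightarrow> complex^'k \<Rightarrow> complex" where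
  "wirtinger j f p =
     (frechet_derivative f (at p) (axis j 1) - \<i> * frechet_derivative f (at p) (axis j \<i>)) / 2"

definition wirtinger_bar :: "'k::finite \<Rightarrow> (complex^'k \<Rightarrow> complex) \<Rightarrow> complex^'k \<Rightarrow> complex" where
  "wirtinger_bar j f p =
     (frechet_derivative f (at p) (axis j 1) + \<i> * frechet_derivative f (at p) (axis j \<i>)) / 2"

definition levi_form :: "(complex^'k::finite \<Rightarrow> real) \<Rightarrow> complex^'k \<Rightarrow> complex^'k \<Rightarrow> complex" where
  "levi_form u p v =
     (\<Sum>j\<in>UNIV. \<Sum>k\<in>UNIV.
        wirtinger j (wirtinger_bar k (\<lambda>z. of_real (u z))) p * v $ j * cnj (v $ k))"

text \<open>The sub-mean value property on all closed discs, possibly degenerate, of complex lines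
  contained in \<open>D\<close>. A real-valued plurisubharmonic function is integrable on the boundary of such
  a disc, because its upper integral there is bounded below by its value at the centre.\<close>

definition disc_submean_on :: "(complex^'k) set \<Rightarrow> (complex^'k \<Rightarrow> real) \<Rightarrow> bool" where
  "disc_submean_on D u \<longleftrightarrow>
     (\<forall>a b. (\<forall>c. cmod c \<le> 1 \<longrightarrow> a + c *s b \<in> D) \<longrightarrow>
        set_integrable lborel {0..2*pi} (\<lambda>t. u (a + cis t *s b)) \<and>
        u a \<le> (LINT t:{0..2*pi}|lborel. u (a + cis t *s b)) / (2 * pi))"


section \<open>Complex manifolds\<close>

text \<open>A complex manifold is given by a holomorphic atlas of charts \<open>(U, \<phi>)\<close>, where only the
  values of \<open>\<phi>\<close> on \<open>U\<close> matter; the points and the topology are read off from the atlas.\<close>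

type_synonym ('a, 'k) atlas = "('a set \<times> ('a \<Rightarrow> complex^'k)) set"

definition points :: "('a, 'k) atlas \<Rightarrow> 'a set" where
  "points A = (\<Union>(U, \<phi>)\<in>A. U)"

definition holomorphic_atlas :: "('a, 'k::finite) atlas \<Rightarrow> bool" where
  "holomorphic_atlas A \<longleftrightarrow>
     (\<forall>(U, \<phi>)\<in>A. inj_on \<phi> U \<and> open (\<phi> ` U)) \<and>
     (\<forall>(U, \<phi>)\<in>A. \<forall>(V, \<psi>)\<in>A. vec_holomorphic_on (\<psi> \<circ> inv_into U \<phi>) (\<phi> ` (U \<inter> V)))"

definition manifold_topology :: "('a, 'k::finite) atlas \<Rightarrow> 'a topology" where
  "manifold_topology A = topology (\<lambda>W. W \<subseteq> points A \<and> (\<forall>(U, \<phi>)\<in>A. open (\<phi> ` (U \<inter> W))))"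

lemma openin_manifold_topology:
  assumes "holomorphic_atlas A"
  shows "openin (manifold_topology A) W \<longleftrightarrow>
           W \<subseteq> points A \<and> (\<forall>(U, \<phi>)\<in>A. open (\<phi> ` (U \<inter> W)))"
proof -
  have inj: "inj_on \<phi> U" if "(U, \<phi>) \<in> A" for U \<phi>
    using assms that unfolding holomorphic_atlas_def by blast
  have "istopology (\<lambda>W. W \<subseteq> points A \<and> (\<forall>(U, \<phi>)\<in>A. open (\<phi> ` (U \<inter> W))))"
    unfolding istopology_def
  proof (intro conjI allI impI)
    fix S T assume S: "S \<subseteq> points A \<and> (\<forall>(U, \<phi>)\<in>A. open (\<phi> ` (U \<inter> S)))"
      and T: "T \<subseteq> points A \<and> (\<forall>(U, \<phi>)\<in>A. open (\<phi> ` (U \<inter> T)))"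
    show "S \<inter> T \<subseteq> points A" using S by blast
    show "\<forall>(U, \<phi>)\<in>A. open (\<phi> ` (U \<inter> (S \<inter> T)))"
    proof clarify
      fix U \<phi> assume U: "(U, \<phi>) \<in> A"
      have "\<phi> ` (U \<inter> (S \<inter> T)) = \<phi> ` (U \<inter> S) \<inter> \<phi> ` (U \<inter> T)"
        using inj[OF U] by (auto simp: inj_on_def)
      then show "open (\<phi> ` (U \<inter> (S \<inter> T)))" using S T U by auto
    qed
  next
    fix K :: "'a set set"
    assume K: "\<forall>W\<in>K. W \<subseteq> points A \<and> (\<forall>(U, \<phi>)\<in>A. open (\<phi> ` (U \<inter> W)))"
    show "\<Union>K \<subseteq> points A" using K by blast
    show "\<forall>(U, \<phi>)\<in>A. open (\<phi> ` (U \<inter> \<Union>K))"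
    proof clarify
      fix U \<phi> assume U: "(U, \<phi>) \<in> A"
      have "\<phi> ` (U \<inter> \<Union>K) = (\<Union>W\<in>K. \<phi> ` (U \<inter> W))" by blast
      moreover have "open (\<phi> ` (U \<inter> W))" if "W \<in> K" for W
        using K U that by fastforce
      ultimately show "open (\<phi> ` (U \<inter> \<Union>K))" by auto
    qed
  qed
  then show ?thesis unfolding manifold_topology_def by (simp add: topology_inverse')
qed

definition complex_manifold :: "('a, 'k::finite) atlas \<Rightarrow> bool" where
  "complex_manifold A \<longleftrightarrow>
     holomorphic_atlas A \<and> Hausdorff_space (manifold_topology A) \<and>
     second_countable (manifold_topology A)"

definition restrict_atlas :: "('a, 'k) atlas \<Rightarrow> 'a set \<Rightarrow> ('a, 'k) atlas" where
  "restrict_atlas A W = (\<lambda>(U, \<phi>). (U \<inter> W, \<phi>)) ` A"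

definition holomorphic_map ::
  "('a, 'k::finite) atlas \<Rightarrow> ('b, 'l::finite) atlas \<Rightarrow> ('a \<Rightarrow> 'b) \<Rightarrow> bool" where
  "holomorphic_map A B f \<longleftrightarrow>
     continuous_map (manifold_topology A) (manifold_topology B) f \<and>
     (\<forall>(U, \<phi>)\<in>A. \<forall>(V, \<psi>)\<in>B.
        vec_holomorphic_on (\<psi> \<circ> f \<circ> inv_into U \<phi>) (\<phi> ` (U \<inter> f -` V)))"

definition holomorphic_embedding ::
  "('a, 'k::finite) atlas \<Rightarrow> ('b, 'l::finite) atlas \<Rightarrow> ('a \<Rightarrow> 'b) \<Rightarrow> bool" where
  "holomorphic_embedding A B f \<longleftrightarrow>
     holomorphic_map A B f \<and>
     (\<forall>(U, \<phi>)\<in>A. \<forall>(V, \<psi>)\<in>B. \<forall>p\<in>U \<inter> f -` V.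
        inj (frechet_derivative (\<psi> \<circ> f \<circ> inv_into U \<phi>) (at (\<phi> p)))) \<and>
     embedding_map (manifold_topology A) (manifold_topology B) f"

definition unit_ball_atlas :: "(complex^'m, 'm::finite) atlas" where
  "unit_ball_atlas = {(ball 0 1, id)}"

definition smooth_function :: "('a, 'k::finite) atlas \<Rightarrow> ('a \<Rightarrow> real) \<Rightarrow> bool" where
  "smooth_function A u \<longleftrightarrow> (\<forall>(U, \<phi>)\<in>A. smooth_on (\<phi> ` U) (u \<circ> inv_into U \<phi>))"

text \<open>Plurisubharmonicity of finite functions: upper semicontinuity and the sub-mean value
  property. No smoothness is assumed.\<close>

definition plurisubharmonic :: "('a, 'k::finite) atlas \<Rightarrow> ('a \<Rightarrow> real) \<Rightarrow> bool" where
  "plurisubharmonic A u \<longleftrightarrow>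
     (\<forall>r. openin (manifold_topology A) {p \<in> points A. u p < r}) \<and>
     (\<forall>(U, \<phi>)\<in>A. disc_submean_on (\<phi> ` U) (u \<circ> inv_into U \<phi>))"

text \<open>\<open>i\<partial>\<partial>bar u > 0\<close> at every point of \<open>Y\<close>; to be used for smooth \<open>u\<close>, whose Levi form is real.\<close>

definition strongly_psh_at :: "('a, 'k::finite) atlas \<Rightarrow> 'a set \<Rightarrow> ('a \<Rightarrow> real) \<Rightarrow> bool" where
  "strongly_psh_at A Y u \<longleftrightarrow>
     (\<forall>(U, \<phi>)\<in>A. \<forall>p\<in>U \<inter> Y. \<forall>v. v \<noteq> 0 \<longrightarrow> Re (levi_form (u \<circ> inv_into U \<phi>) (\<phi> p) v) > 0)"


section \<open>Projective algebraic manifolds\<close>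

text \<open>The index type \<open>'n option\<close> has one element more than \<open>'n\<close>: the points of
  \<open>projective_space :: (complex^('n option)) set set\<close> are the complex lines through the origin in
  \<open>\<complex>\<^sup>N\<^sup>+\<^sup>1\<close>, where \<open>N = CARD('n)\<close>. The standard chart with index \<open>i\<close> sends
  the line spanned by \<open>z\<close>, where \<open>z $ i \<noteq> 0\<close>, to the \<open>N\<close> numbers \<open>z $ i' / z $ i\<close>, where \<open>i' \<noteq> i\<close>
  and the \<open>i'\<close> are listed by \<open>omit_index i\<close>.\<close>

definition complex_line :: "complex^'k \<Rightarrow> (complex^'k) set" where
  "complex_line z = range (\<lambda>c. c *s z)"

definition projective_space :: "(complex^'k) set set" where
  "projective_space = complex_line ` (- {0})"

definition omit_index :: "'n option \<Rightarrow> 'n \<Rightarrow> 'n option" where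
  "omit_index i j = (if i = Some j then None else Some j)"

lemma bij_betw_omit_index: "bij_betw (omit_index i) UNIV (- {i})"
proof (cases i)
  case None
  have "x \<in> range Some" if "x \<noteq> None" for x :: "'a option" using that by (cases x) auto
  then show ?thesis
    unfolding None by (auto simp: bij_betw_def inj_on_def omit_index_def image_iff)
next
  case (Some a)
  have "\<exists>j. x = (if j = a then None else Some j)" if "x \<noteq> Some a" for x
    using that by (cases x) auto
  then show ?thesis
    unfolding Some by (auto simp: bij_betw_def inj_on_def omit_index_def image_iff split: if_splits)
qed

definition projective_atlas :: "((complex^('n option)) set, 'n::finite) atlas" where
  "projective_atlas =
     range (\<lambda>i. ({l \<in> projective_space. \<exists>z\<in>l. z $ i \<noteq> 0},
                 \<lambda>l. \<chi> j. (THE z. z \<in> l \<and> z $ i = 1) $ omit_index i j))"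

definition homogeneous_polynomial :: "nat \<Rightarrow> (complex^'k::finite \<Rightarrow> complex) \<Rightarrow> bool" where
  "homogeneous_polynomial d P \<longleftrightarrow>
     (\<exists>(I :: ('k \<Rightarrow> nat) set) c. finite I \<and> (\<forall>\<alpha>\<in>I. (\<Sum>i\<in>UNIV. \<alpha> i) = d) \<and>
        P = (\<lambda>z. \<Sum>\<alpha>\<in>I. c \<alpha> * (\<Prod>i\<in>UNIV. (z $ i) ^ \<alpha> i)))"

definition projective_algebraic_set :: "(complex^'k::finite) set set \<Rightarrow> bool" where
  "projective_algebraic_set X \<longleftrightarrow>
     (\<exists>F. (\<forall>P\<in>F. \<exists>d. homogeneous_polynomial d P) \<and>
        X = {l \<in> projective_space. \<forall>P\<in>F. \<forall>z\<in>l. P z = 0})"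

text \<open>A manifold together with an embedding that makes it a projective algebraic manifold. The
  dimension \<open>N\<close> of the projective space is encoded in the type of \<open>\<iota>\<close>.\<close>

definition projective_algebraic_manifold ::
  "('a, 'm::finite) atlas \<Rightarrow> ('a \<Rightarrow> (complex^('n::finite option)) set) \<Rightarrow> bool" where
  "projective_algebraic_manifold S \<iota> \<longleftrightarrow>
     complex_manifold S \<and> holomorphic_embedding S projective_atlas \<iota> \<and>
     projective_algebraic_set (\<iota> ` points S)"


section \<open>Holomorphic vector bundles\<close>

text \<open>A vector bundle of rank \<open>CARD('r)\<close>. Its fibres are complex vector spaces under the (partial)
  operations \<open>fadd\<close> and \<open>fscale\<close>; \<open>trivs\<close> consists of local trivializations \<open>(U, \<tau>)\<close>, \<open>\<tau>\<close>
  being the fibre component of an isomorphism of the part of the bundle over \<open>U\<close> with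
  \<open>U \<times> \<complex>\<^sup>r\<close>.\<close>

record ('a, 'e, 'r) vbundle =
  total :: "'e set"
  proj :: "'e \<Rightarrow> 'a"
  fadd :: "'e \<Rightarrow> 'e \<Rightarrow> 'e"
  fscale :: "complex \<Rightarrow> 'e \<Rightarrow> 'e"
  trivs :: "('a set \<times> ('e \<Rightarrow> complex^'r)) set"

definition fibre :: "('a, 'e, 'r::finite) vbundle \<Rightarrow> 'a \<Rightarrow> 'e set" where
  "fibre E x = {v \<in> total E. proj E v = x}"

text \<open>The vector space axioms for the fibres need not be listed, because they are transported from
  \<open>\<complex>\<^sup>r\<close> by the trivializations. The last condition says that the transition matrices
  are holomorphic, as it concerns the sections that are constant in the first trivialization.\<close>

definition holomorphic_vector_bundle ::
  "('a, 'm::finite) atlas \<Rightarrow> ('a, 'e, 'r::finite) vbundle \<Rightarrow> bool" where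
  "holomorphic_vector_bundle S E \<longleftrightarrow>
     proj E ` total E \<subseteq> points S \<and>
     (\<forall>x\<in>points S. \<forall>v\<in>fibre E x. (\<forall>w\<in>fibre E x. fadd E v w \<in> fibre E x) \<and>
        (\<forall>c. fscale E c v \<in> fibre E x)) \<and>
     points S = (\<Union>(U, \<tau>)\<in>trivs E. U) \<and>
     (\<forall>(U, \<tau>)\<in>trivs E. openin (manifold_topology S) U \<and>
        (\<forall>x\<in>U. bij_betw \<tau> (fibre E x) UNIV \<and>
           (\<forall>v\<in>fibre E x. (\<forall>w\<in>fibre E x. \<tau> (fadd E v w) = \<tau> v + \<tau> w) \<and>
              (\<forall>c. \<tau> (fscale E c v) = c *s \<tau> v)))) \<and>
     (\<forall>(U, \<tau>)\<in>trivs E. \<forall>(V, \<tau>')\<in>trivs E. \<forall>(W, \<phi>)\<in>S. \<forall>b.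
        vec_holomorphic_on (\<lambda>z. \<tau>' (inv_into (fibre E (inv_into W \<phi> z)) \<tau> b))
          (\<phi> ` (W \<inter> U \<inter> V)))"

abbreviation holomorphic_line_bundle ::
  "('a, 'm::finite) atlas \<Rightarrow> ('a, 'e, 1) vbundle \<Rightarrow> bool" where
  "holomorphic_line_bundle \<equiv> holomorphic_vector_bundle"

text \<open>The total space as a complex manifold of dimension \<open>CARD('m) + CARD('r)\<close>.\<close>

definition total_atlas ::
  "('a, 'm::finite) atlas \<Rightarrow> ('a, 'e, 'r::finite) vbundle \<Rightarrow> ('e, 'm + 'r) atlas" where
  "total_atlas S E =
     (\<lambda>((W, \<phi>), (U, \<tau>)). ({v \<in> total E. proj E v \<in> W \<inter> U},
        \<lambda>v. \<chi> i. case i of Inl j \<Rightarrow> \<phi> (proj E v) $ j | Inr k \<Rightarrow> \<tau> v $ k)) ` (S \<times> trivs E)"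

definition holomorphic_section_on ::
  "('a, 'm::finite) atlas \<Rightarrow> ('a, 'e, 'r::finite) vbundle \<Rightarrow> 'a set \<Rightarrow> ('a \<Rightarrow> 'e) \<Rightarrow> bool" where
  "holomorphic_section_on S E W l \<longleftrightarrow>
     holomorphic_map (restrict_atlas S W) (total_atlas S E) l \<and> (\<forall>x\<in>W. l x \<in> fibre E x)"

text \<open>A linear form on a fibre is represented by its \<open>extensional\<close> version, so that it is determined
  by its values on the fibre. The trivialization dual to \<open>\<tau>\<close> takes components in the basis
  dual to the frame defined by \<open>\<tau>\<close>.\<close>

definition dual_fibre :: "('a, 'e, 'r::finite) vbundle \<Rightarrow> 'a \<Rightarrow> ('e \<Rightarrow> complex) set" where
  "dual_fibre E x =
     {f \<in> extensional (fibre E x). \<forall>v\<in>fibre E x.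
        (\<forall>w\<in>fibre E x. f (fadd E v w) = f v + f w) \<and> (\<forall>c. f (fscale E c v) = c * f v)}"

definition dual_bundle ::
  "('a, 'e, 'r::finite) vbundle \<Rightarrow> ('a, 'a \<times> ('e \<Rightarrow> complex), 'r) vbundle" where
  "dual_bundle E = \<lparr>
     total = (SIGMA x : proj E ` total E. dual_fibre E x),
     proj = fst,
     fadd = (\<lambda>(x, f) (y, g). (x, \<lambda>v\<in>fibre E x. f v + g v)),
     fscale = (\<lambda>c (x, f). (x, \<lambda>v\<in>fibre E x. c * f v)),
     trivs = (\<lambda>(U, \<tau>). (U, \<lambda>(x, f). \<chi> j. f (inv_into (fibre E x) \<tau> (axis j 1)))) ` trivs E\<rparr>"


section \<open>Hermitian metrics and curvature\<close>

definition positive_hermitian_form ::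
  "('a, 'e, 'r::finite) vbundle \<Rightarrow> 'a \<Rightarrow> ('e \<Rightarrow> 'e \<Rightarrow> complex) \<Rightarrow> bool" where
  "positive_hermitian_form E x H \<longleftrightarrow>
     (\<forall>u\<in>fibre E x. \<forall>v\<in>fibre E x.
        (\<forall>w\<in>fibre E x. H (fadd E u v) w = H u w + H v w) \<and>
        (\<forall>c. H (fscale E c u) v = c * H u v) \<and> H v u = cnj (H u v)) \<and>
     (\<forall>v\<in>fibre E x. v \<noteq> fscale E 0 v \<longrightarrow> Re (H v v) > 0)"

definition hermitian_metric ::
  "('a, 'm::finite) atlas \<Rightarrow> ('a, 'e, 'r::finite) vbundle \<Rightarrow> ('e \<Rightarrow> real) \<Rightarrow> bool" where
  "hermitian_metric S E h \<longleftrightarrow>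
     (\<forall>x\<in>points S. \<exists>H. positive_hermitian_form E x H \<and> (\<forall>v\<in>fibre E x. of_real (h v) = H v v))"

definition smooth_metric ::
  "('a, 'm::finite) atlas \<Rightarrow> ('a, 'e, 'r::finite) vbundle \<Rightarrow> ('e \<Rightarrow> real) \<Rightarrow> bool" where
  "smooth_metric S E h \<longleftrightarrow> smooth_function (total_atlas S E) h"

text \<open>As \<open>h v\<close> is the square of the length of \<open>v\<close>, so is \<open>dual_metric E h (x, f)\<close> the square of the
  operator norm of \<open>f\<close>.\<close>

definition dual_metric ::
  "('a, 'e, 'r::finite) vbundle \<Rightarrow> ('e \<Rightarrow> real) \<Rightarrow> 'a \<times> ('e \<Rightarrow> complex) \<Rightarrow> real" where
  "dual_metric E h = (\<lambda>(x, f). SUP v\<in>{v \<in> fibre E x. h v \<le> 1}. (cmod (f v))\<^sup>2)"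

definition seminegatively_curved ::
  "('a, 'm::finite) atlas \<Rightarrow> ('a, 'e, 'r::finite) vbundle \<Rightarrow> ('e \<Rightarrow> real) \<Rightarrow> bool" where
  "seminegatively_curved S E h \<longleftrightarrow> plurisubharmonic (total_atlas S E) h"

text \<open>Negative curvature over a subset \<open>Y\<close> of the base, not necessarily open: the metric is smooth
  everywhere, and its Levi form is positive definite at the nonzero vectors over \<open>Y\<close>.\<close>

definition negatively_curved_over ::
  "('a, 'm::finite) atlas \<Rightarrow> ('a, 'e, 'r::finite) vbundle \<Rightarrow> ('e \<Rightarrow> real) \<Rightarrow> 'a set \<Rightarrow> bool" where
  "negatively_curved_over S E h Y \<longleftrightarrow>
     smooth_metric S E h \<and>
     strongly_psh_at (total_atlas S E) {v \<in> total E. proj E v \<in> Y \<and> v \<noteq> fscale E 0 v} h"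

definition semipositively_curved ::
  "('a, 'm::finite) atlas \<Rightarrow> ('a, 'e, 'r::finite) vbundle \<Rightarrow> ('e \<Rightarrow> real) \<Rightarrow> bool" where
  "semipositively_curved S E h \<longleftrightarrow> seminegatively_curved S (dual_bundle E) (dual_metric E h)"

definition positively_curved_over ::
  "('a, 'm::finite) atlas \<Rightarrow> ('a, 'e, 'r::finite) vbundle \<Rightarrow> ('e \<Rightarrow> real) \<Rightarrow> 'a set \<Rightarrow> bool" where
  "positively_curved_over S E h Y \<longleftrightarrow>
     negatively_curved_over S (dual_bundle E) (dual_metric E h) Y"

abbreviation positively_curved ::
  "('a, 'm::finite) atlas \<Rightarrow> ('a, 'e, 'r::finite) vbundle \<Rightarrow> ('e \<Rightarrow> real) \<Rightarrow> bool" where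
  "positively_curved S E h \<equiv> positively_curved_over S E h (points S)"

end

theory Submission
  imports Defs "HOL-Complex_Analysis.Cauchy_Integral_Formula"
begin

text \<open>The construction is local. Let \<open>p\<close> be the strictly plurisubharmonic potential of the given metric in a
  frame near a point \<open>z0\<close>. Subtract from it the real part of a holomorphic polynomial \<open>G\<close>, so that the remainder
  \<open>\<psi>\<close> has a strict minimum at \<open>z0\<close> with value \<open>0\<close>. Replace \<open>\<psi>\<close> by a regularised maximum of \<open>\<psi>\<close> and of
  \<open>c + \<kappa> \<theta>(|z - z0|\<^sup>2 / r\<^sup>2 - \<sigma>\<^sup>2)\<close>, where \<open>\<theta>\<close> is a smooth convex function that vanishes exactly on the negative
  half-line and \<open>c\<close>, \<open>\<kappa>\<close> and \<open>r\<close> are small. The maximum is constant for \<open>|z - z0| \<le> \<sigma> r\<close>, it is strictly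
  plurisubharmonic for \<open>|z - z0| > \<sigma> r\<close>, and it equals \<open>\<psi>\<close> away from \<open>z0\<close>, so the new metric extends by the
  old one. The section \<open>l\<close> is \<open>e\<^sup>G\<^sup>/\<^sup>2\<close> times the frame, up to a constant. Scaling a coordinate ball of radius \<open>r\<close>
  gives \<open>\<epsilon>\<close>.

  All curvature conditions are expressed by the Laplacian along complex lines, which is four times the
  real part of the Levi form for every smooth function.\<close>

section \<open>Smooth functions\<close>

text \<open>The regularised maximum is \<psi> + \<delta> \<theta>((f1 - \<psi>) / \<delta>), where
  \<open>f1\<close> is the second potential. Because 0 \<le> \<theta>' \<le> 1 and \<theta>'' \<ge>
  0, its Levi form is at least the convex combination of those of \<psi> and \<open>f1\<close> with
  weights 1 - \<theta>' and \<theta>'. This gives nonnegativity everywhere, and strictness wherever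
  \<open>f1\<close> is strictly plurisubharmonic, since \<psi> always is. Two features of the
  definitions shape the rest. Curvature is stated upstairs: it concerns a supremum on the total
  space of the dual bundle, and semipositivity is a sub-mean inequality on discs. In a
  trivialization the dual metric is |b|^2 e^p, and completing the square in its Laplacian separates
  a fibre term from the Laplacian of \<open>p\<close>; so positivity descends to \<open>p\<close>
  along horizontal lifts and is lifted back for the new potential. Moreover, holomorphic maps are
  only assumed complex differentiable once; Cauchy's integral formula supplies the higher
  derivatives. Potentials in different frames differ by log |c|^2 with c holomorphic, so one
  reference chart decides the curvature near \<open>z0\<close>.\<close>

lemma frechet_derivative_cong_open:
  assumes "open D" "x \<in> D" "\<And>y. y \<in> D \<Longrightarrow> f y = g y"
  shows "frechet_derivative f (at x) = frechet_derivative g (at x)"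
proof -
  have "(f has_derivative F) (at x) \<longleftrightarrow> (g has_derivative F) (at x)" for F
    using has_derivative_transform_within_open[of f F x UNIV D g]
      has_derivative_transform_within_open[of g F x UNIV D f] assms by auto
  \<comment> \<open>\<open>frechet_derivative\<close> is a choice operator; both functions have the
    same derivatives at \<open>x\<close>, so the choices agree even where there is none.\<close>
  then show ?thesis by (simp add: frechet_derivative_def)
qed

lemma frechet_derivative_eqI: "(f has_derivative F) (at x) \<Longrightarrow> frechet_derivative f (at x) v = F v"
  by (metis frechet_derivative_at)

lemma has_derivative_frechet:
  "f differentiable (at x) \<Longrightarrow> (f has_derivative (\<lambda>v. frechet_derivative f (at x) v)) (at x)"
  by (simp add: frechet_derivative_works)

lemma differentiable_cong_open:
  assumes "open D" "x \<in> D" "\<And>y. y \<in> D \<Longrightarrow> f y = g y" "f differentiable (at x)"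
  shows "g differentiable (at x)"
  using assms(4) has_derivative_transform_within_open[of f _ x UNIV D g] assms(1-3)
  unfolding differentiable_def by blast

declare Ck_on.simps(2)[simp del]

lemma Ck_on_Suc_differentiable: "Ck_on (Suc n) D f \<Longrightarrow> x \<in> D \<Longrightarrow> f differentiable (at x)"
  by (simp add: Ck_on.simps(2))

lemma Ck_on_Suc_derivative: "Ck_on (Suc n) D f \<Longrightarrow> Ck_on n D (\<lambda>x. frechet_derivative f (at x) v)"
  by (drule iffD1[OF Ck_on.simps(2)]) (erule conjE, erule spec)

lemma Ck_on_Suc_intro:
  assumes "\<And>x. x \<in> D \<Longrightarrow> f differentiable (at x)"
    "\<And>v. Ck_on n D (\<lambda>x. frechet_derivative f (at x) v)"
  shows "Ck_on (Suc n) D f"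
  by (rule iffD2[OF Ck_on.simps(2)], intro conjI ballI allI assms)

lemma Ck_on_cong:
  assumes "open D" "\<And>y. y \<in> D \<Longrightarrow> f y = g y" "Ck_on n D f"
  shows "Ck_on n D g"
  using assms(2,3)
proof (induction n arbitrary: f g)
  case 0 then show ?case using continuous_on_cong[of D D f g] by auto
next
  case (Suc n)
  show ?case
  proof (rule Ck_on_Suc_intro)
    fix x assume "x \<in> D"
    then show "g differentiable (at x)"
      by (intro differentiable_cong_open[OF assms(1) _ Suc.prems(1) Ck_on_Suc_differentiable[OF Suc.prems(2)]])
  next
    fix v
    show "Ck_on n D (\<lambda>x. frechet_derivative g (at x) v)"
    proof (rule Suc.IH[OF _ Ck_on_Suc_derivative[OF Suc.prems(2)]])
      show "frechet_derivative f (at y) v = frechet_derivative g (at y) v" if "y \<in> D" for y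
        using frechet_derivative_cong_open[OF assms(1) that Suc.prems(1)] by simp
    qed
  qed
qed

lemma Ck_on_Suc_imp: "Ck_on (Suc n) D f \<Longrightarrow> Ck_on n D f"
proof (induction n arbitrary: f)
  case 0
  then show ?case unfolding Ck_on.simps(1)
    by (metis Ck_on_Suc_differentiable continuous_at_imp_continuous_on differentiable_imp_continuous_within)
next
  case (Suc n)
  show ?case
    by (rule Ck_on_Suc_intro[OF Ck_on_Suc_differentiable[OF Suc.prems]]) (assumption, rule Suc.IH[OF Ck_on_Suc_derivative[OF Suc.prems]])
qed

lemma Ck_on_subset: "Ck_on n D f \<Longrightarrow> D' \<subseteq> D \<Longrightarrow> Ck_on n D' f"
proof (induction n arbitrary: f)
  case 0 then show ?case unfolding Ck_on.simps(1) by (rule continuous_on_subset)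
next
  case (Suc n)
  show ?case
    by (rule Ck_on_Suc_intro[OF Ck_on_Suc_differentiable[OF Suc.prems(1)]])
      (use Suc.prems(2) in blast, rule Suc.IH[OF Ck_on_Suc_derivative[OF Suc.prems(1)] Suc.prems(2)])
qed

text \<open>This is the gluing principle for the modified metric, which has different formulas near
  \<open>z0\<close> and away from it.\<close>

lemma Ck_on_local:
  assumes "\<And>x. x \<in> D \<Longrightarrow> \<exists>V. open V \<and> x \<in> V \<and> Ck_on n V f"
  shows "Ck_on n D f"
  using assms
proof (induction n arbitrary: f)
  case 0
  show ?case
    unfolding Ck_on.simps
  proof (rule continuous_at_imp_continuous_on, rule ballI)
    fix x assume "x \<in> D"
    then obtain V where "open V" "x \<in> V" "continuous_on V f" using 0[of x] unfolding Ck_on.simps(1) by blast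
    then show "isCont f x" using continuous_on_eq_continuous_at by blast
  qed
next
  case (Suc n)
  show ?case
  proof (rule Ck_on_Suc_intro)
    fix v show "Ck_on n D (\<lambda>x. frechet_derivative f (at x) v)"
    proof (rule Suc.IH)
      fix x assume "x \<in> D"
      then obtain V where "open V" "x \<in> V" and V: "Ck_on (Suc n) V f" using Suc.prems by blast
      then show "\<exists>V. open V \<and> x \<in> V \<and> Ck_on n V (\<lambda>x. frechet_derivative f (at x) v)"
        using Ck_on_Suc_derivative[OF V] by blast
    qed
  next
    fix x assume "x \<in> D"
    then obtain V where "open V" "x \<in> V" and V: "Ck_on (Suc n) V f" using Suc.prems by blast
    then show "f differentiable (at x)" using Ck_on_Suc_differentiable[OF V] by blast
  qed
qed

lemma Ck_on_const: "Ck_on n D (\<lambda>x. c)"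
  by (induction n arbitrary: c) (auto intro: Ck_on_Suc_intro)

lemma Ck_on_SucI:
  assumes "open D" "\<And>x. x \<in> D \<Longrightarrow> (f has_derivative F x) (at x)" "\<And>v. Ck_on n D (\<lambda>x. F x v)"
  shows "Ck_on (Suc n) D f"
proof (rule Ck_on_Suc_intro)
  show "f differentiable (at x)" if "x \<in> D" for x using assms(2)[OF that] by (rule differentiableI)
  show "Ck_on n D (\<lambda>x. frechet_derivative f (at x) v)" for v
    by (rule Ck_on_cong[OF assms(1) _ assms(3)]) (simp add: frechet_derivative_eqI[OF assms(2)])
qed

lemma Ck_on_Suc_has_derivative:
  "Ck_on (Suc n) D f \<Longrightarrow> x \<in> D \<Longrightarrow> (f has_derivative (\<lambda>v. frechet_derivative f (at x) v)) (at x)"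
  by (rule has_derivative_frechet[OF Ck_on_Suc_differentiable])

lemma Ck_on_bounded_linear:
  assumes "bounded_linear L" shows "Ck_on n D L"
proof (cases n)
  case 0 then show ?thesis
    using assms by (auto intro: linear_continuous_on)
next
  case (Suc m)
  have "Ck_on (Suc m) UNIV L"
    by (rule Ck_on_SucI[OF open_UNIV bounded_linear_imp_has_derivative[OF assms] Ck_on_const])
  then show ?thesis unfolding Suc by (rule Ck_on_subset) simp
qed

lemma Ck_on_add:
  assumes "open D" "Ck_on n D f" "Ck_on n D g" shows "Ck_on n D (\<lambda>x. f x + g x)"
  using assms(2,3)
proof (induction n arbitrary: f g)
  case 0 then show ?case by (auto intro: continuous_intros)
next
  case (Suc n)
  show ?case
    by (rule Ck_on_SucI[OF assms(1) has_derivative_add[OF Ck_on_Suc_has_derivative[OF Suc.prems(1)]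
            Ck_on_Suc_has_derivative[OF Suc.prems(2)]]])
      (assumption, assumption, rule Suc.IH[OF Ck_on_Suc_derivative[OF Suc.prems(1)] Ck_on_Suc_derivative[OF Suc.prems(2)]])
qed

lemma Ck_on_sum:
  assumes "open D" "\<And>i. i \<in> I \<Longrightarrow> Ck_on n D (f i)" shows "Ck_on n D (\<lambda>x. \<Sum>i\<in>I. f i x)"
  using assms(2) by (induction I rule: infinite_finite_induct) (auto intro: Ck_on_const Ck_on_add assms(1))

lemma Ck_on_bilinear:
  assumes "open D" "bounded_bilinear B" "Ck_on n D f" "Ck_on n D g"
  shows "Ck_on n D (\<lambda>x. B (f x) (g x))"
  using assms(3,4)
proof (induction n arbitrary: f g)
  case 0 then show ?case using bounded_bilinear.continuous_on[OF assms(2)] by auto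
next
  case (Suc n)
  note f = Suc.prems(1) and g = Suc.prems(2)
  show ?case
  proof (rule Ck_on_SucI[OF assms(1) bounded_bilinear.FDERIV[OF assms(2)
          Ck_on_Suc_has_derivative[OF f] Ck_on_Suc_has_derivative[OF g]]])
    show "Ck_on n D (\<lambda>x. B (f x) (frechet_derivative g (at x) v) + B (frechet_derivative f (at x) v) (g x))" for v
      by (rule Ck_on_add[OF assms(1) Suc.IH[OF Ck_on_Suc_imp[OF f] Ck_on_Suc_derivative[OF g]]
            Suc.IH[OF Ck_on_Suc_derivative[OF f] Ck_on_Suc_imp[OF g]]])
  qed
qed

text \<open>In the chain rule both the point and the direction of the derivative of \<open>f\<close>
  move. Expanding the direction in the standard basis leaves finitely many fixed partial derivatives
  of \<open>f\<close> composed with \<open>g\<close>, to which the induction hypothesis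
  applies.\<close>

lemma Ck_on_compose:
  fixes f :: "'v::euclidean_space \<Rightarrow> 'w::real_normed_vector" and g :: "'u::euclidean_space \<Rightarrow> 'v"
  assumes "open D" "open D'" "g ` D \<subseteq> D'" "Ck_on n D' f" "Ck_on n D g"
  shows "Ck_on n D (\<lambda>x. f (g x))"
  using assms(4,5)
proof (induction n arbitrary: f)
  case 0 then show ?case using assms(3) by (auto intro: continuous_on_compose2)
next
  case (Suc n)
  note f = Suc.prems(1) and g = Suc.prems(2)
  have d: "((\<lambda>x. f (g x)) has_derivative
      (\<lambda>v. \<Sum>b\<in>Basis. (frechet_derivative g (at x) v \<bullet> b) *\<^sub>R frechet_derivative f (at (g x)) b)) (at x)"
    if "x \<in> D" for x
  proof -
    have gx: "g x \<in> D'" using assms(3) that by blast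
    have "linear (frechet_derivative f (at (g x)))"
      by (rule linear_frechet_derivative[OF Ck_on_Suc_differentiable[OF f gx]])
    then have lin: "frechet_derivative f (at (g x)) w = (\<Sum>b\<in>Basis. (w \<bullet> b) *\<^sub>R frechet_derivative f (at (g x)) b)" for w
      using linear_sum[of "frechet_derivative f (at (g x))" "\<lambda>b. (w \<bullet> b) *\<^sub>R b" Basis]
      by (simp add: euclidean_representation linear_cmul)
    have "((\<lambda>x. f (g x)) has_derivative
        (\<lambda>v. frechet_derivative f (at (g x)) (frechet_derivative g (at x) v))) (at x)"
      by (rule has_derivative_compose[OF Ck_on_Suc_has_derivative[OF g that] Ck_on_Suc_has_derivative[OF f gx]])
    then show ?thesis by (subst (asm) lin)
  qed
  show ?case
  proof (rule Ck_on_SucI[OF assms(1) d])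
    show "Ck_on n D (\<lambda>x. \<Sum>b\<in>Basis. (frechet_derivative g (at x) v \<bullet> b) *\<^sub>R frechet_derivative f (at (g x)) b)" for v
      by (intro Ck_on_sum[OF assms(1)] Ck_on_bilinear[OF assms(1) bounded_bilinear_scaleR]
         Ck_on_bilinear[OF assms(1) bounded_bilinear_inner Ck_on_Suc_derivative[OF g] Ck_on_const]
         Suc.IH[OF Ck_on_Suc_derivative[OF f] Ck_on_Suc_imp[OF g]])
  qed
qed

lemma Ck_on_real_SucI:
  fixes f :: "real \<Rightarrow> real"
  assumes "open D" "\<And>x. x \<in> D \<Longrightarrow> (f has_real_derivative f' x) (at x)" "Ck_on n D f'"
  shows "Ck_on (Suc n) D f"
  by (rule Ck_on_SucI[where F = "\<lambda>x v. f' x * v"])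
    (use assms in \<open>auto simp: has_field_derivative_def intro!: Ck_on_bilinear[OF _ bounded_bilinear_mult] Ck_on_const\<close>)

lemma smooth_on_cong: "open D \<Longrightarrow> (\<And>y. y \<in> D \<Longrightarrow> f y = g y) \<Longrightarrow> smooth_on D f \<Longrightarrow> smooth_on D g"
  unfolding smooth_on_def using Ck_on_cong by blast

lemma smooth_on_subset: "smooth_on D f \<Longrightarrow> D' \<subseteq> D \<Longrightarrow> smooth_on D' f"
  unfolding smooth_on_def using Ck_on_subset by blast

lemma smooth_on_local:
  "(\<And>x. x \<in> D \<Longrightarrow> \<exists>V. open V \<and> x \<in> V \<and> smooth_on V f) \<Longrightarrow> smooth_on D f"
  unfolding smooth_on_def using Ck_on_local by metis

lemma smooth_on_bounded_linear: "bounded_linear L \<Longrightarrow> smooth_on D L"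
  unfolding smooth_on_def using Ck_on_bounded_linear by blast

lemma smooth_on_const: "smooth_on D (\<lambda>x. c)"
  unfolding smooth_on_def using Ck_on_const by blast

lemma smooth_on_add: "open D \<Longrightarrow> smooth_on D f \<Longrightarrow> smooth_on D g \<Longrightarrow> smooth_on D (\<lambda>x. f x + g x)"
  unfolding smooth_on_def using Ck_on_add by blast

lemma smooth_on_sum:
  "open D \<Longrightarrow> (\<And>i. i \<in> I \<Longrightarrow> smooth_on D (f i)) \<Longrightarrow> smooth_on D (\<lambda>x. \<Sum>i\<in>I. f i x)"
  unfolding smooth_on_def using Ck_on_sum[of D I _ f] by blast

lemma smooth_on_bilinear:
  "open D \<Longrightarrow> bounded_bilinear B \<Longrightarrow> smooth_on D f \<Longrightarrow> smooth_on D g \<Longrightarrow> smooth_on D (\<lambda>x. B (f x) (g x))"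
  unfolding smooth_on_def using Ck_on_bilinear by blast

lemma smooth_on_mult:
  fixes f g :: "'v::euclidean_space \<Rightarrow> 'a::real_normed_algebra"
  shows "open D \<Longrightarrow> smooth_on D f \<Longrightarrow> smooth_on D g \<Longrightarrow> smooth_on D (\<lambda>x. f x * g x)"
  by (rule smooth_on_bilinear[OF _ bounded_bilinear_mult])

lemma smooth_on_uminus: "open D \<Longrightarrow> smooth_on D f \<Longrightarrow> smooth_on D (\<lambda>x. - f x)"
  using smooth_on_bilinear[OF _ bounded_bilinear_scaleR smooth_on_const, of D f "- 1"] by simp

lemma smooth_on_diff: "open D \<Longrightarrow> smooth_on D f \<Longrightarrow> smooth_on D g \<Longrightarrow> smooth_on D (\<lambda>x. f x - g x)"
  using smooth_on_add[OF _ _ smooth_on_uminus, of D f g] by simp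

lemma smooth_on_compose:
  fixes f :: "'v::euclidean_space \<Rightarrow> 'w::real_normed_vector" and g :: "'u::euclidean_space \<Rightarrow> 'v"
  shows "open D \<Longrightarrow> open D' \<Longrightarrow> g ` D \<subseteq> D' \<Longrightarrow> smooth_on D' f \<Longrightarrow> smooth_on D g
    \<Longrightarrow> smooth_on D (\<lambda>x. f (g x))"
  unfolding smooth_on_def using Ck_on_compose by blast

lemma smooth_on_frechet: "smooth_on D f \<Longrightarrow> smooth_on D (\<lambda>x. frechet_derivative f (at x) v)"
  unfolding smooth_on_def using Ck_on_Suc_derivative by blast

lemma smooth_on_has_derivative:
  "smooth_on D f \<Longrightarrow> x \<in> D \<Longrightarrow> (f has_derivative (\<lambda>v. frechet_derivative f (at x) v)) (at x)"
  unfolding smooth_on_def using Ck_on_Suc_has_derivative by blast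

lemma smooth_on_DERIV:
  fixes f :: "real \<Rightarrow> real"
  assumes "smooth_on D f" "x \<in> D"
  shows "(f has_real_derivative frechet_derivative f (at x) 1) (at x)"
proof -
  note d = smooth_on_has_derivative[OF assms]
  have "frechet_derivative f (at x) v = frechet_derivative f (at x) 1 * v" for v
    using linear_cmul[OF has_derivative_linear[OF d], of v 1] by simp
  then show ?thesis
    using d unfolding has_field_derivative_def by (metis (no_types, lifting) ext)
qed

lemma smooth_on_imp_continuous_on: "smooth_on D f \<Longrightarrow> continuous_on D f"
  unfolding smooth_on_def using Ck_on.simps(1) by blast

lemma smooth_on_vec:
  fixes f :: "'u::euclidean_space \<Rightarrow> 'w::euclidean_space^'n"
  assumes "open D" "\<And>i. smooth_on D (\<lambda>x. f x $ i)" shows "smooth_on D f"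
proof -
  have bl: "bounded_linear (\<lambda>c. axis i c :: 'w^'n)" for i
    by (intro linear_conv_bounded_linear[THEN iffD1] linearI) (auto simp: axis_def vec_eq_iff)
  have "smooth_on D (\<lambda>x. \<Sum>i\<in>UNIV. axis i (f x $ i))"
    by (intro smooth_on_sum assms(1) smooth_on_compose[OF assms(1) open_UNIV _ smooth_on_bounded_linear[OF bl] assms(2)]) auto
  moreover have "(\<Sum>i\<in>UNIV. axis i (f x $ i)) = f x" for x
    by (simp add: vec_eq_iff axis_def)
  ultimately show ?thesis by simp
qed

section \<open>Elementary smooth functions and a smooth convex ramp\<close>

lemma smooth_on_exp: "smooth_on D (exp :: real \<Rightarrow> real)"
proof -
  have "Ck_on n UNIV (exp :: real \<Rightarrow> real)" for n
  proof (induction n)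
    case (Suc n) show ?case by (rule Ck_on_real_SucI[OF _ _ Suc]) (auto intro: DERIV_exp)
  qed (auto intro: continuous_intros)
  then show ?thesis using Ck_on_subset unfolding smooth_on_def by blast
qed

lemma smooth_on_inverse: "smooth_on (- {0}) (inverse :: real \<Rightarrow> real)"
proof -
  have "Ck_on n (- {0}) (inverse :: real \<Rightarrow> real)" for n
  proof (induction n)
    case (Suc n)
    have "Ck_on n (- {0}) (\<lambda>x::real. (-1) * (inverse x * inverse x))"
      by (intro Ck_on_bilinear[OF _ bounded_bilinear_mult] Suc Ck_on_const) auto
    then show ?case
      by (rule Ck_on_real_SucI[rotated 2]) (auto intro!: derivative_eq_intros simp: power2_eq_square)
  qed (auto intro!: continuous_intros)
  then show ?thesis unfolding smooth_on_def by blast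
qed

lemma smooth_on_ln: "smooth_on {0<..} (ln :: real \<Rightarrow> real)"
proof -
  have "Ck_on n {0<..} (ln :: real \<Rightarrow> real)" for n
  proof (cases n)
    case (Suc m)
    have "Ck_on m {0<..} (inverse :: real \<Rightarrow> real)"
      using smooth_on_inverse unfolding smooth_on_def by (auto intro: Ck_on_subset)
    then show ?thesis unfolding Suc
      by (rule Ck_on_real_SucI[rotated 2]) (auto intro!: derivative_eq_intros simp: field_simps)
  qed (auto intro!: continuous_intros)
  then show ?thesis unfolding smooth_on_def by blast
qed

text \<open>The family \<open>t \<mapsto> t\<^sup>-\<^sup>k e\<^sup>-\<^sup>1\<^sup>/\<^sup>t\<close>, cut off at \<open>0\<close>, is closed under taking derivatives up to linear combinations.\<close>

definition flat :: "nat \<Rightarrow> real \<Rightarrow> real" where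
  "flat k t = (if t > 0 then inverse t ^ k * exp (- inverse t) else 0)"

text \<open>With x = 1/t the limit from the right is that of x^k / e^x at infinity.\<close>

lemma flat_tendsto: "(flat k \<longlongrightarrow> 0) (at 0)"
proof -
  have "((\<lambda>x. x ^ k / exp x) \<longlongrightarrow> 0) (at_top :: real filter)" by (rule tendsto_power_div_exp_0)
  then have "((\<lambda>t. inverse t ^ k / exp (inverse t)) \<longlongrightarrow> 0) (at_right (0::real))"
    by (rule filterlim_compose[OF _ filterlim_inverse_at_top_right])
  then have "(flat k \<longlongrightarrow> 0) (at_right 0)"
    by (rule Lim_transform_eventually)
      (auto simp: flat_def exp_minus field_simps eventually_at_right_less
        intro!: eventually_mono[OF eventually_at_right_less[of 0]])
  moreover have "(flat k \<longlongrightarrow> 0) (at_left 0)"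
    by (rule Lim_transform_eventually[OF tendsto_const])
      (auto simp: flat_def intro!: eventually_mono[OF eventually_at_left_real[of "-1" 0]])
  ultimately show ?thesis by (simp add: filterlim_split_at)
qed

lemma flat_0: "flat k 0 = 0" by (simp add: flat_def)

lemma flat_shift: "flat k t = t * flat (Suc k) t"
  by (simp add: flat_def)

lemma flat_DERIV:
  "(flat k has_real_derivative (flat (Suc (Suc k)) t - real k * flat (Suc k) t)) (at t)"
proof (cases t "0::real" rule: linorder_cases)
  case greater
  have "((\<lambda>t. inverse t ^ k * exp (- inverse t)) has_real_derivative
     (inverse t ^ k * (exp (- inverse t) * (inverse t * inverse t)) +
      real k * (- (inverse t * inverse t)) * inverse t ^ (k - Suc 0) * exp (- inverse t))) (at t)"
    using greater by (auto intro!: derivative_eq_intros simp: algebra_simps)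
  moreover have "inverse t ^ k * (exp (- inverse t) * (inverse t * inverse t)) +
      real k * (- (inverse t * inverse t)) * inverse t ^ (k - Suc 0) * exp (- inverse t)
    = flat (Suc (Suc k)) t - real k * flat (Suc k) t"
    using greater by (cases k) (auto simp: flat_def algebra_simps)
  ultimately have "((\<lambda>t. inverse t ^ k * exp (- inverse t)) has_real_derivative
      (flat (Suc (Suc k)) t - real k * flat (Suc k) t)) (at t)" by simp
  then show ?thesis
    by (rule has_field_derivative_transform_within_open[of _ _ _ "{0<..}"])
      (use greater in \<open>auto simp: flat_def\<close>)
next
  case less
  have "((\<lambda>t. 0) has_real_derivative 0) (at t)" by simp
  then have "(flat k has_real_derivative 0) (at t)"
    by (rule has_field_derivative_transform_within_open[of _ _ _ "{..<0}"])
      (use less in \<open>auto simp: flat_def\<close>)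
  then show ?thesis using less by (simp add: flat_def)
next
  case equal
  \<comment> \<open>The difference quotient of \<open>flat k\<close> at 0 is
    \<open>flat (Suc k)\<close>, which tends to 0.\<close>
  have "((\<lambda>y. (flat k y - flat k 0) / (y - 0)) \<longlongrightarrow> 0) (at 0)"
  proof (rule Lim_transform_eventually[OF flat_tendsto[of "Suc k"]])
    show "\<forall>\<^sub>F x in at 0. flat (Suc k) x = (flat k x - flat k 0) / (x - 0)"
      by (auto simp: eventually_at_filter flat_shift[of k] flat_0)
  qed
  then show ?thesis by (simp add: equal has_field_derivative_iff flat_0)
qed

lemma smooth_on_flat: "smooth_on D (flat k)"
proof -
  have "Ck_on n UNIV (flat k)" for n
  proof (induction n arbitrary: k)
    case 0
    show ?case
      unfolding Ck_on.simps using flat_DERIV[of k] by (blast intro: continuous_at_imp_continuous_on DERIV_isCont)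
  next
    case (Suc n)
    have "Ck_on n UNIV (\<lambda>t. flat (Suc (Suc k)) t + (- real k) * flat (Suc k) t)"
      by (intro Ck_on_add Ck_on_bilinear[OF _ bounded_bilinear_mult] Suc Ck_on_const) auto
    then show ?case
      by (rule Ck_on_real_SucI[rotated 2]) (use flat_DERIV[of k] in auto)
  qed
  then show ?thesis using Ck_on_subset unfolding smooth_on_def by blast
qed

definition smooth_step :: "real \<Rightarrow> real" where
  "smooth_step t = flat 0 t / (flat 0 t + flat 0 (1 - t))"

lemma flat0_pos: "t > 0 \<Longrightarrow> flat 0 t > 0" and flat0_nonneg: "flat 0 t \<ge> 0"
  and flat0_zero: "t \<le> 0 \<Longrightarrow> flat 0 t = 0"
  by (auto simp: flat_def)

text \<open>The numbers t and 1 - t are never both nonpositive.\<close>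

lemma step_denom_pos: "flat 0 t + flat 0 (1 - t) > 0"
  using flat0_pos[of t] flat0_pos[of "1 - t"] flat0_nonneg[of t] flat0_nonneg[of "1 - t"]
  by (cases "t > 0") (auto intro: add_pos_nonneg add_nonneg_pos)

lemma smooth_on_step: "smooth_on UNIV smooth_step"
proof -
  have f: "smooth_on UNIV (\<lambda>t. flat 0 (1 - t))"
    by (rule smooth_on_compose[OF _ _ _ smooth_on_flat[of UNIV]])
      (auto intro: smooth_on_diff[OF open_UNIV smooth_on_const smooth_on_bounded_linear[OF bounded_linear_ident]])
  have "smooth_on UNIV (\<lambda>t. inverse (flat 0 t + flat 0 (1 - t)))"
    by (rule smooth_on_compose[OF _ _ _ smooth_on_inverse])
      (use step_denom_pos in \<open>auto intro!: smooth_on_add smooth_on_flat f simp: less_imp_neq[OF step_denom_pos, symmetric]\<close>)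
  then have "smooth_on UNIV (\<lambda>t. flat 0 t * inverse (flat 0 t + flat 0 (1 - t)))"
    by (intro smooth_on_mult smooth_on_flat) auto
  then show ?thesis by (simp add: smooth_step_def[abs_def] divide_inverse)
qed

lemma smooth_step_mono: "mono smooth_step"
proof (rule monoI)
  fix s t :: real assume "s \<le> t"
  have m: "flat 0 a \<le> flat 0 b" if "a \<le> b" for a b
    using that by (auto simp: flat_def le_imp_inverse_le)
  \<comment> \<open>This is the desired inequality of fractions after cross-multiplying and
    cancelling the common product.\<close>
  have "flat 0 s * flat 0 (1 - t) \<le> flat 0 t * flat 0 (1 - s)"
    using m[of s t] m[of "1 - t" "1 - s"] \<open>s \<le> t\<close> by (intro mult_mono flat0_nonneg) auto
  then show "smooth_step s \<le> smooth_step t"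
    unfolding smooth_step_def using step_denom_pos[of s] step_denom_pos[of t]
    by (simp add: divide_simps algebra_simps)
qed

lemma smooth_step_props:
  "0 \<le> smooth_step t" "smooth_step t \<le> 1" "t \<le> 0 \<Longrightarrow> smooth_step t = 0"
  "t > 0 \<Longrightarrow> smooth_step t > 0" "t \<ge> 1 \<Longrightarrow> smooth_step t = 1"
  using step_denom_pos[of t] flat0_nonneg[of t] flat0_nonneg[of "1 - t"] flat0_pos[of t] flat0_zero[of t]
    flat0_zero[of "1 - t"]
  unfolding smooth_step_def by (auto simp: divide_simps)

text \<open>The ramp is a primitive of \<open>smooth_step\<close>, so its slope lies in [0,1] and
  increases. Each property has its task: slope and convexity produce convex combinations of Levi
  forms, \<theta> = 0 for t \<le> 0 leaves a potential untouched, \<theta> = t - c for t \<ge> 1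
  replaces it by the other one up to a constant, and \<theta> t \<le> t bounds the growth.\<close>

lemma exists_smooth_convex_ramp:
  obtains \<theta> \<theta>' \<theta>'' :: "real \<Rightarrow> real" and c :: real
  where "smooth_on UNIV \<theta>"
    "\<And>t. (\<theta> has_real_derivative \<theta>' t) (at t)" "\<And>t. (\<theta>' has_real_derivative \<theta>'' t) (at t)"
    "\<And>t. 0 \<le> \<theta>' t" "\<And>t. \<theta>' t \<le> 1" "\<And>t. 0 \<le> \<theta>'' t" "\<And>t. 0 < t \<Longrightarrow> 0 < \<theta>' t"
    "\<And>t. t \<le> 0 \<Longrightarrow> \<theta> t = 0" "\<And>t. 1 \<le> t \<Longrightarrow> \<theta> t = t - c" "\<And>t. 0 \<le> t \<Longrightarrow> \<theta> t \<le> t"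
proof -
  have cont: "continuous_on UNIV smooth_step"
    using smooth_on_step by (rule smooth_on_imp_continuous_on)
  define F where "F = (\<lambda>t. if t \<ge> 0 then integral {0..t} smooth_step else 0)"
  have F_vec: "(F has_vector_derivative smooth_step t) (at t)" for t
  proof (cases "t < 0")
    case True
    have "((\<lambda>t. 0) has_vector_derivative 0) (at t)" by simp
    then have "(F has_vector_derivative 0) (at t)"
      by (rule has_vector_derivative_transform_within_open[of _ _ _ "{..<0}"]) (use True in \<open>auto simp: F_def\<close>)
    then show ?thesis using smooth_step_props(3)[of t] True by simp
  next
    case False
    \<comment> \<open>Starting the integral at -1 makes 0 an interior point of the interval, and
      costs nothing because the step vanishes on [-1,0].\<close>
    have eq: "integral {-1..x} smooth_step = F x" if "x > -1" for x
    proof (cases "x \<ge> 0")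
      case True
      have "integral {-1..0} smooth_step + integral {0..x} smooth_step = integral {-1..x} smooth_step"
        using True by (intro Henstock_Kurzweil_Integration.integral_combine
            integrable_continuous_real continuous_on_subset[OF cont]) auto
      moreover have "integral {-1..0} smooth_step = integral {-1..0::real} (\<lambda>_. 0)"
        by (rule Henstock_Kurzweil_Integration.integral_cong) (auto intro: smooth_step_props)
      ultimately show ?thesis using True by (simp add: F_def)
    next
      case False
      have "integral {-1..x} smooth_step = integral {-1..x} (\<lambda>_. 0)"
        by (rule Henstock_Kurzweil_Integration.integral_cong) (use False in \<open>auto intro: smooth_step_props\<close>)
      then show ?thesis using False by (simp add: F_def)
    qed
    have "((\<lambda>x. integral {-1..x} smooth_step) has_vector_derivative smooth_step t) (at t within {-1..t+1})"
      using False by (intro integral_has_vector_derivative continuous_on_subset[OF cont]) auto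
    moreover have "at t within {-1..t+1} = at t"
      using False by (intro at_within_Icc_at) auto
    ultimately have "((\<lambda>x. integral {-1..x} smooth_step) has_vector_derivative smooth_step t) (at t)" by simp
    then show ?thesis
      by (rule has_vector_derivative_transform_within_open[of _ _ _ "{-1<..}"]) (use False eq in auto)
  qed
  note F = F_vec[folded has_real_derivative_iff_has_vector_derivative]
  define \<theta> where "\<theta> = (\<lambda>t. F t - F 0)"
  have d1: "(\<theta> has_real_derivative smooth_step t) (at t)" for t
    unfolding \<theta>_def by (auto intro!: derivative_eq_intros F)
  define \<theta>'' where "\<theta>'' = (\<lambda>t. frechet_derivative smooth_step (at t) 1)"
  have d2: "(smooth_step has_real_derivative \<theta>'' t) (at t)" for t
    unfolding \<theta>''_def by (rule smooth_on_DERIV[OF smooth_on_step]) simp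
  have "Ck_on n UNIV \<theta>" for n
  proof -
    have "Ck_on (Suc n) UNIV \<theta>"
      by (rule Ck_on_real_SucI[OF _ d1]) (use smooth_on_step in \<open>auto simp: smooth_on_def\<close>)
    then show ?thesis by (rule Ck_on_Suc_imp)
  qed
  then have sm: "smooth_on UNIV \<theta>" by (simp add: smooth_on_def)
  have nn: "0 \<le> \<theta>'' t" for t
  proof (rule ccontr)
    assume "\<not> 0 \<le> \<theta>'' t"
    then obtain d where "d > 0" "\<And>h. h > 0 \<Longrightarrow> h < d \<Longrightarrow> smooth_step (t + h) < smooth_step t"
      using DERIV_neg_dec_right[OF d2] by (metis not_le)
    then show False using monoD[OF smooth_step_mono, of t "t + d / 2"] by (smt (verit) field_sum_of_halves)
  qed
  have z: "\<theta> t = 0" if "t \<le> 0" for t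
  proof -
    have "\<theta> t = \<theta> 0"
    proof (cases "t < 0")
      case True
      have "\<theta> 0 = \<theta> t"
      proof (rule DERIV_isconst_end[OF True])
        show "(\<theta> has_real_derivative 0) (at x)" if "t < x" "x < 0" for x
          using d1[of x] smooth_step_props(3)[of x] that by simp
        show "continuous_on {t..0} \<theta>"
          by (rule continuous_on_subset[OF smooth_on_imp_continuous_on[OF sm]]) simp
      qed
      then show ?thesis by simp
    qed (use that in auto)
    then show ?thesis by (simp add: \<theta>_def)
  qed
  have o: "\<theta> t = t - (1 - \<theta> 1)" if "1 \<le> t" for t
  proof (cases "t = 1")
    case False
    have "(\<lambda>t. \<theta> t - t) t = (\<lambda>t. \<theta> t - t) 1"
    proof (rule DERIV_isconst_end[where f = "\<lambda>t. \<theta> t - t"])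
      show "1 < t" using that False by simp
      show "((\<lambda>t. \<theta> t - t) has_real_derivative 0) (at x)" if "1 < x" "x < t" for x
        using that smooth_step_props(5)[of x] by (auto intro!: derivative_eq_intros d1)
      show "continuous_on {1..t} (\<lambda>t. \<theta> t - t)"
        by (intro continuous_on_diff continuous_on_id continuous_on_subset[OF smooth_on_imp_continuous_on[OF sm]] subset_UNIV)
    qed
    then show ?thesis by simp
  qed simp
  have le: "\<theta> t \<le> t" if "0 \<le> t" for t
  proof -
    have "(\<lambda>t. t - \<theta> t) 0 \<le> (\<lambda>t. t - \<theta> t) t"
      by (rule DERIV_nonneg_imp_nondecreasing[OF that, where f = "\<lambda>t. t - \<theta> t"])
        (auto intro!: exI derivative_eq_intros d1 simp: smooth_step_props)
    then show ?thesis using z[of 0] by simp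
  qed
  show ?thesis
    by (rule that[OF sm d1 d2 smooth_step_props(1) smooth_step_props(2) nn smooth_step_props(4) z o le])
qed

section \<open>Directional derivatives and holomorphic functions\<close>

text \<open>With the direction as first argument, iterated derivatives become compositions of
  operators, \<open>dd v (dd w f)\<close>.\<close>

definition dd :: "'v \<Rightarrow> ('v::euclidean_space \<Rightarrow> 'w::real_normed_vector) \<Rightarrow> 'v \<Rightarrow> 'w" where
  "dd v f x = frechet_derivative f (at x) v"

lemma dd_eqI: "(f has_derivative F) (at x) \<Longrightarrow> dd v f x = F v"
  unfolding dd_def by (rule frechet_derivative_eqI)

lemma dd_cong:
  assumes "open D" "x \<in> D" "\<And>y. y \<in> D \<Longrightarrow> f y = g y" shows "dd v f x = dd v g x"
  unfolding dd_def using frechet_derivative_cong_open[OF assms] by simp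

lemma smooth_on_dd: "smooth_on D f \<Longrightarrow> smooth_on D (dd v f)"
  unfolding dd_def[abs_def] by (rule smooth_on_frechet)

lemma dd_has_derivative: "smooth_on D f \<Longrightarrow> x \<in> D \<Longrightarrow> (f has_derivative (\<lambda>v. dd v f x)) (at x)"
  unfolding dd_def by (rule smooth_on_has_derivative)

lemma differentiable_dd: "f differentiable (at x) \<Longrightarrow> (f has_derivative (\<lambda>v. dd v f x)) (at x)"
  unfolding dd_def by (rule has_derivative_frechet)

lemma dd_linear: "smooth_on D f \<Longrightarrow> x \<in> D \<Longrightarrow> linear (\<lambda>v. dd v f x)"
  by (rule has_derivative_linear[OF dd_has_derivative])

lemma dd_add: "smooth_on D f \<Longrightarrow> x \<in> D \<Longrightarrow> dd (v + w) f x = dd v f x + dd w f x"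
  by (rule linear_add[OF dd_linear])

lemma dd_scaleR: "smooth_on D f \<Longrightarrow> x \<in> D \<Longrightarrow> dd (c *\<^sub>R v) f x = c *\<^sub>R dd v f x"
  using linear_cmul[OF dd_linear] by blast

lemma dd_minus: "smooth_on D f \<Longrightarrow> x \<in> D \<Longrightarrow> dd (- v) f x = - dd v f x"
  using linear_neg[OF dd_linear] by blast

lemma dd_zero: "smooth_on D f \<Longrightarrow> x \<in> D \<Longrightarrow> dd 0 f x = 0"
  using linear_0[OF dd_linear] by blast

lemma dd_sum: "smooth_on D f \<Longrightarrow> x \<in> D \<Longrightarrow> dd (\<Sum>i\<in>I. w i) f x = (\<Sum>i\<in>I. dd (w i) f x)"
  using linear_sum[OF dd_linear, of D f x w I] by simp

lemma dd_basis:
  assumes "smooth_on D f" "x \<in> D"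
  shows "dd w f x = (\<Sum>b\<in>Basis. (w \<bullet> b) *\<^sub>R dd b f x)"
  using dd_sum[OF assms, of "\<lambda>b. (w \<bullet> b) *\<^sub>R b" Basis]
  by (simp add: euclidean_representation dd_scaleR[OF assms])

text \<open>Linearity in the inner direction: expanding it in a basis reduces a varying direction to
  finitely many fixed smooth functions.\<close>

lemma dd_dd_basis:
  assumes "open D" "smooth_on D f" "x \<in> D"
  shows "dd w (dd u f) x = (\<Sum>b\<in>Basis. (u \<bullet> b) *\<^sub>R dd w (dd b f) x)"
proof -
  have "((\<lambda>y. \<Sum>b\<in>Basis. (u \<bullet> b) *\<^sub>R dd b f y) has_derivative
      (\<lambda>h. \<Sum>b\<in>Basis. (u \<bullet> b) *\<^sub>R dd h (dd b f) x)) (at x)"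
    by (intro has_derivative_sum has_derivative_scaleR_right dd_has_derivative[OF smooth_on_dd[OF assms(2)] assms(3)])
  then have "(dd u f has_derivative
      (\<lambda>h. \<Sum>b\<in>Basis. (u \<bullet> b) *\<^sub>R dd h (dd b f) x)) (at x)"
    by (rule has_derivative_transform_within_open[OF _ assms(1,3)]) (rule dd_basis[OF assms(2), symmetric])
  then show ?thesis by (rule dd_eqI)
qed

text \<open>A Leibniz rule in which direction and base point both move; after expansion in a basis
  it is the rule for sums of products. It yields the second order chain rule and the angular
  derivatives on a circle.\<close>

lemma has_derivative_dd:
  assumes D: "open D" "smooth_on D f" "X x \<in> D"
    and W: "(W has_derivative W') (at x)" and X: "(X has_derivative X') (at x)"
  shows "((\<lambda>x. dd (W x) f (X x)) has_derivative
           (\<lambda>h. dd (W' h) f (X x) + dd (X' h) (dd (W x) f) (X x))) (at x)"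
proof -
  have cX: "isCont X x" using X by (rule has_derivative_continuous)
  then obtain V where V: "open V" "x \<in> V" "\<And>y. y \<in> V \<Longrightarrow> X y \<in> D"
    using D(1,3) cX[unfolded continuous_at_open, rule_format, of D] by auto
  have d: "((\<lambda>x. \<Sum>b\<in>Basis. (W x \<bullet> b) *\<^sub>R dd b f (X x)) has_derivative
      (\<lambda>h. \<Sum>b\<in>Basis. (W x \<bullet> b) *\<^sub>R dd (X' h) (dd b f) (X x) + (W' h \<bullet> b) *\<^sub>R dd b f (X x))) (at x)"
    by (intro has_derivative_sum has_derivative_scaleR has_derivative_inner_left W
        has_derivative_compose[OF X dd_has_derivative[OF smooth_on_dd[OF D(2)] D(3)]])
  note eq = dd_dd_basis[OF D]
  have "((\<lambda>x. dd (W x) f (X x)) has_derivative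
      (\<lambda>h. \<Sum>b\<in>Basis. (W x \<bullet> b) *\<^sub>R dd (X' h) (dd b f) (X x) + (W' h \<bullet> b) *\<^sub>R dd b f (X x))) (at x)"
    by (rule has_derivative_transform_within_open[OF d V(1,2)]) (rule dd_basis[OF D(2) V(3), symmetric])
  moreover have "(\<Sum>b\<in>Basis. (W x \<bullet> b) *\<^sub>R dd (X' h) (dd b f) (X x) + (W' h \<bullet> b) *\<^sub>R dd b f (X x))
      = dd (W' h) f (X x) + dd (X' h) (dd (W x) f) (X x)" for h
    by (subst dd_basis[OF D(2,3), of "W' h"], subst eq[of _ "W x"]) (simp add: sum.distrib add.commute)
  ultimately show ?thesis by simp
qed

lemma dd_compose:
  assumes "open D'" "smooth_on D' f" "g x \<in> D'" "smooth_on D g" "x \<in> D"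
  shows "dd v (\<lambda>x. f (g x)) x = dd (dd v g x) f (g x)"
  by (rule dd_eqI[OF has_derivative_compose[OF dd_has_derivative[OF assms(4,5)] dd_has_derivative[OF assms(2,3)]]])

text \<open>The first term carries the second derivative of the inner map; it is the one that
  cancels in the Laplacian when that map is holomorphic.\<close>

lemma dd_dd_compose:
  assumes "open D'" "smooth_on D' f" "g ` D \<subseteq> D'" "open D" "smooth_on D g" "x \<in> D"
  shows "dd v (dd v (\<lambda>x. f (g x))) x =
    dd (dd v (dd v g) x) f (g x) + dd (dd v g x) (dd (dd v g x) f) (g x)"
proof -
  have gx: "g x \<in> D'" using assms by blast
  have "dd v (dd v (\<lambda>x. f (g x))) x = dd v (\<lambda>x. dd (dd v g x) f (g x)) x"
    by (rule dd_cong[OF assms(4,6)], rule dd_compose[OF assms(1,2) _ assms(5)]) (use assms(3) in auto)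
  also have "\<dots> = dd (dd v (dd v g) x) f (g x) + dd (dd v g x) (dd (dd v g x) f) (g x)"
    by (rule dd_eqI[OF has_derivative_dd[OF assms(1,2) gx dd_has_derivative[OF smooth_on_dd[OF assms(5)] assms(6)]
            dd_has_derivative[OF assms(5,6)]]])
  finally show ?thesis .
qed

lemma continuous_on_dd:
  assumes "smooth_on D f" "continuous_on A W" "continuous_on A X" "X ` A \<subseteq> D"
  shows "continuous_on A (\<lambda>s. dd (W s) f (X s))"
proof -
  have "continuous_on A (\<lambda>s. \<Sum>b\<in>Basis. (W s \<bullet> b) *\<^sub>R dd b f (X s))"
    by (intro continuous_intros assms(2) continuous_on_compose2[OF smooth_on_imp_continuous_on[OF smooth_on_dd[OF assms(1)]] assms(3,4)])
  then show ?thesis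
    by (rule continuous_on_eq) (use assms(4) in \<open>auto intro!: dd_basis[OF assms(1), symmetric]\<close>)
qed

lemma continuous_on_dd_dd:
  assumes "open D" "smooth_on D f" "continuous_on A V" "continuous_on A W" "continuous_on A X" "X ` A \<subseteq> D"
  shows "continuous_on A (\<lambda>s. dd (V s) (dd (W s) f) (X s))"
proof -
  have "continuous_on A (\<lambda>s. \<Sum>b\<in>Basis. (W s \<bullet> b) *\<^sub>R dd (V s) (dd b f) (X s))"
    by (intro continuous_intros assms(4) continuous_on_dd[OF smooth_on_dd[OF assms(2)] assms(3,5,6)])
  then show ?thesis
    by (rule continuous_on_eq) (use assms(6) in \<open>auto intro!: dd_dd_basis[OF assms(1,2), symmetric]\<close>)
qed

lemma linear_dd_dd:
  assumes "open D" "smooth_on D f" "x \<in> D" shows "linear (\<lambda>u. dd w (dd u f) x)"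
proof (rule linearI)
  show "dd w (dd (u + u') f) x = dd w (dd u f) x + dd w (dd u' f) x" for u u'
    unfolding dd_dd_basis[OF assms, of w "u + u'"] dd_dd_basis[OF assms, of w u] dd_dd_basis[OF assms, of w u']
    by (simp add: inner_left_distrib scaleR_left_distrib sum.distrib)
  show "dd w (dd (c *\<^sub>R u) f) x = c *\<^sub>R dd w (dd u f) x" for c u
    unfolding dd_dd_basis[OF assms, of w "c *\<^sub>R u"] dd_dd_basis[OF assms, of w u]
    by (simp add: scaleR_sum_right)
qed

section \<open>Smoothness of complex differentiable functions, by Cauchy's formula\<close>

lemma norm_cmult_vec: "norm (c *s v) = cmod c * norm (v :: complex^'k)"
  by (simp add: norm_vec_def norm_mult L2_set_right_distrib)

lemma bounded_linear_cmult_vec: "bounded_linear (\<lambda>c. c *s (v :: complex^'k))"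
  by (intro linear_conv_bounded_linear[THEN iffD1] linearI) (auto simp: vec_eq_iff algebra_simps)

lemma continuous_on_cmult_vec [continuous_intros]:
  "continuous_on A f \<Longrightarrow> continuous_on A (\<lambda>x. f x *s (v :: complex^'k))"
  using bounded_linear.continuous_on[OF bounded_linear_cmult_vec] by blast

text \<open>Only complex differentiability at each point is recorded here; on open sets, smoothness
  is the theorem \<open>holo_fun_smooth\<close>.\<close>

definition holo_fun :: "(complex^'k \<Rightarrow> complex) \<Rightarrow> (complex^'k) set \<Rightarrow> bool" where
  "holo_fun F D \<longleftrightarrow> (\<forall>z\<in>D. F differentiable (at z) \<and> (\<forall>c v. dd (c *s v) F z = c * dd v F z))"

lemma holo_fun_subset: "holo_fun F D \<Longrightarrow> D' \<subseteq> D \<Longrightarrow> holo_fun F D'"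
  unfolding holo_fun_def by blast

lemma holo_fun_has_derivative: "holo_fun F D \<Longrightarrow> z \<in> D \<Longrightarrow> (F has_derivative (\<lambda>v. dd v F z)) (at z)"
  unfolding holo_fun_def by (blast intro: differentiable_dd)

lemma holo_funI:
  assumes "\<And>z. z \<in> D \<Longrightarrow> (F has_derivative L z) (at z)" "\<And>z c v. z \<in> D \<Longrightarrow> L z (c *s v) = c * L z v"
  shows "holo_fun F D"
  unfolding holo_fun_def using assms by (auto intro: differentiableI simp: dd_eqI[OF assms(1)])

lemma holo_fun_continuous_on: "holo_fun F D \<Longrightarrow> continuous_on D F"
  unfolding holo_fun_def by (meson continuous_at_imp_continuous_on differentiable_imp_continuous_within)

lemma holo_fun_line:
  assumes "holo_fun F D" "z + c *s v \<in> D"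
  shows "((\<lambda>c. F (z + c *s v)) has_field_derivative dd v F (z + c *s v)) (at c)"
proof -
  have "((\<lambda>c. z + c *s v) has_derivative (\<lambda>h. h *s v)) (at c)"
    using has_derivative_add[OF has_derivative_const bounded_linear_imp_has_derivative[OF bounded_linear_cmult_vec]] by simp
  from has_derivative_compose[OF this holo_fun_has_derivative[OF assms]]
  have "((\<lambda>c. F (z + c *s v)) has_derivative (\<lambda>h. dd (h *s v) F (z + c *s v))) (at c)" .
  moreover have "dd (h *s v) F (z + c *s v) = dd v F (z + c *s v) * h" for h
    using assms unfolding holo_fun_def by (simp add: mult.commute)
  ultimately show ?thesis unfolding has_field_derivative_def by simp
qed

text \<open>The circle of radius \<open>r\<close> about 0, run through once for t in [0,1] so as to
  match \<open>circlepath\<close>.\<close>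

definition circ :: "real \<Rightarrow> real \<Rightarrow> complex" where
  "circ r t = of_real r * exp (2 * of_real pi * \<i> * of_real t)"

lemma circ_nz: "r > 0 \<Longrightarrow> circ r t \<noteq> 0" by (simp add: circ_def)
lemma norm_circ: "r > 0 \<Longrightarrow> cmod (circ r t) = r"
  unfolding circ_def norm_mult by simp
lemma continuous_on_circ [continuous_intros]: "continuous_on A f \<Longrightarrow> continuous_on A (\<lambda>x. circ r (f x))"
  unfolding circ_def by (intro continuous_intros)

text \<open>One-variable Cauchy formula for the derivative at 0 of c \<mapsto> F (z + c v). It
  expresses a derivative of \<open>F\<close> by values of \<open>F\<close> alone, which is the
  source of all gains of regularity below.\<close>

lemma holo_fun_Cauchy:
  assumes F: "open D" "holo_fun F D" and "r > 0" and sub: "\<And>c. cmod c \<le> r \<Longrightarrow> z + c *s v \<in> D"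
  shows "dd v F z = integral (cbox 0 1) (\<lambda>t. F (z + circ r t *s v) / circ r t)"
proof -
  define f where "f = (\<lambda>c. F (z + c *s v))"
  have cont: "continuous_on (cball 0 r) f" unfolding f_def
    by (intro continuous_on_compose2[OF holo_fun_continuous_on[OF F(2)]] continuous_intros) (use sub in auto)
  have hol: "f holomorphic_on ball 0 r"
  proof (intro holomorphic_on_open[THEN iffD2] ballI open_ball)
    fix c :: complex assume "c \<in> ball 0 r"
    then have "z + c *s v \<in> D" by (intro sub) simp
    then show "\<exists>f'. (f has_field_derivative f') (at c)"
      unfolding f_def using holo_fun_line[OF F(2)] by blast
  qed
  have "(f has_field_derivative (1 / (2 * of_real pi * \<i>) * contour_integral (circlepath 0 r) (\<lambda>u. f u / (u - 0)\<^sup>2))) (at 0)"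
    by (rule Cauchy_derivative_integral_circlepath(2)[OF cont hol]) (use \<open>r > 0\<close> in simp)
  moreover have "(f has_field_derivative dd v F z) (at 0)"
    using holo_fun_line[OF F(2), of z 0 v] sub[of 0] \<open>r > 0\<close> unfolding f_def by simp
  ultimately have "dd v F z = 1 / (2 * of_real pi * \<i>) * contour_integral (circlepath 0 r) (\<lambda>u. f u / (u - 0)\<^sup>2)"
    by (rule DERIV_unique[symmetric])
  also have "contour_integral (circlepath 0 r) (\<lambda>u. f u / (u - 0)\<^sup>2) =
      integral {0..1} (\<lambda>t. (2 * of_real pi * \<i>) * (f (circ r t) / circ r t))"
    unfolding contour_integral_integral
  proof (rule Henstock_Kurzweil_Integration.integral_cong)
    fix t :: real
    have c: "circlepath 0 r t = circ r t" by (simp add: circlepath circ_def)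
    have d: "vector_derivative (circlepath 0 r) (at t) = 2 * of_real pi * \<i> * circ r t"
      by (simp add: vector_derivative_circlepath circ_def)
    show "f (circlepath 0 r t) / (circlepath 0 r t - 0)\<^sup>2 * vector_derivative (circlepath 0 r) (at t) =
        (2 * of_real pi * \<i>) * (f (circ r t) / circ r t)"
      unfolding c d using circ_nz[OF \<open>r > 0\<close>, of t] by (simp add: power2_eq_square)
  qed
  also have "\<dots> = (2 * of_real pi * \<i>) * integral {0..1} (\<lambda>t. f (circ r t) / circ r t)"
    by (rule Henstock_Kurzweil_Integration.integral_mult_right)
  finally show ?thesis by (simp add: f_def)
qed

text \<open>A single radius for all centres near \<open>z0\<close> gives integrals over a fixed
  circle, depending on a parameter.\<close>

lemma uniform_disc:
  assumes "open D" "z0 \<in> (D :: (complex^'k) set)"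
  shows "\<exists>e>0. \<exists>r>0. \<forall>z\<in>ball z0 e. \<forall>c. cmod c \<le> r \<longrightarrow> z + c *s v \<in> D"
proof -
  obtain e where e: "e > 0" "ball z0 e \<subseteq> D" using assms openE by blast
  \<comment> \<open>The summand 1 keeps the denominator positive when \<open>v\<close> is 0.\<close>
  define r where "r = e / 2 / (norm v + 1)"
  have "norm v + 1 \<noteq> 0" using norm_ge_zero[of v] by linarith
  then have cancel: "x / (norm v + 1) * (norm v + 1) = x" for x :: real by simp
  have r: "r > 0" unfolding r_def using e(1) by (intro divide_pos_pos add_nonneg_pos) auto
  have "r * norm v \<le> r * (norm v + 1)" using r by simp
  also have "\<dots> = e / 2" unfolding r_def by (rule cancel)
  finally have rv: "r * norm v \<le> e / 2" .
  show ?thesis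
  proof (rule exI[of _ "e / 2"], rule conjI[rotated], rule exI[of _ r], intro conjI ballI allI impI)
    fix z c assume z: "z \<in> ball z0 (e / 2)" and c: "cmod c \<le> r"
    have "norm (c *s v) \<le> e / 2" unfolding norm_cmult_vec
      using mult_right_mono[OF c norm_ge_zero[of v]] rv by linarith
    then have "dist z0 (z + c *s v) < e"
      using z dist_triangle[of z0 "z + c *s v" z] by (simp add: dist_norm)
    then show "z + c *s v \<in> D" using e(2) by auto
  qed (use e r in simp_all)
qed

lemma continuous_on_open_local:
  fixes f :: "'a::real_normed_vector \<Rightarrow> 'b::real_normed_vector"
  assumes "\<And>x. x \<in> D \<Longrightarrow> \<exists>V. open V \<and> x \<in> V \<and> continuous_on V f"
  shows "continuous_on D f"
proof (rule continuous_at_imp_continuous_on, rule ballI)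
  fix x assume "x \<in> D"
  then obtain V where "open V" "x \<in> V" "continuous_on V f" using assms by blast
  then show "isCont f x" using continuous_on_eq_continuous_at by blast
qed

lemma holo_fun_dd_continuous:
  assumes F: "open D" "holo_fun F D" shows "continuous_on D (dd v F)"
proof (rule continuous_on_open_local)
  fix z0 assume "z0 \<in> D"
  then obtain e r where er: "e > 0" "r > 0" "\<And>z c. z \<in> ball z0 e \<Longrightarrow> cmod c \<le> r \<Longrightarrow> z + c *s v \<in> D"
    using uniform_disc[OF F(1) \<open>z0 \<in> D\<close>, of v] by metis
  have "continuous_on (ball z0 e \<times> cbox 0 1) (\<lambda>(z, t). F (z + circ r t *s v) / circ r t)"
    unfolding split_beta
    by (intro continuous_intros continuous_on_compose2[OF holo_fun_continuous_on[OF F(2)]])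
      (use er norm_circ[OF er(2)] circ_nz[OF er(2)] in auto)
  then have "continuous_on (ball z0 e) (\<lambda>z. integral (cbox 0 1) (\<lambda>t. F (z + circ r t *s v) / circ r t))"
    by (rule integral_continuous_on_param)
  then have "continuous_on (ball z0 e) (dd v F)"
    by (rule continuous_on_eq) (rule holo_fun_Cauchy[OF F er(2,3), symmetric])
  then show "\<exists>V. open V \<and> z0 \<in> V \<and> continuous_on V (dd v F)"
    using er(1) by (intro exI[of _ "ball z0 e"]) auto
qed

text \<open>Differentiation under the integral sign in Cauchy's formula: the derivative of
  \<open>dd v F\<close> is an average of the complex linear differentials of \<open>F\<close> over a
  circle, so it is complex linear too. The continuity of \<open>dd w F\<close> needed for this is
  the preceding lemma.\<close>

lemma holo_fun_dd:
  assumes F: "open D" "holo_fun F D" shows "holo_fun (dd v F) D"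
proof -
  have "\<exists>L. (dd v F has_derivative L) (at z0) \<and> (\<forall>c w. L (c *s w) = c * L w)" if z0: "z0 \<in> D" for z0
  proof -
    obtain e r where er: "e > 0" "r > 0" "\<And>z c. z \<in> ball z0 e \<Longrightarrow> cmod c \<le> r \<Longrightarrow> z + c *s v \<in> D"
      using uniform_disc[OF F(1) z0, of v] by metis
    define U where "U = ball z0 e"
    have inD: "z + circ r t *s v \<in> D" if "z \<in> U" for z t
      using er(3)[of z "circ r t"] norm_circ[OF er(2)] that unfolding U_def by simp
    \<comment> \<open>The Leibniz rule takes the derivative as an element of the space of bounded
      linear maps, continuous jointly in \<open>z\<close> and \<open>t\<close>; the continuity is
      checked on basis vectors.\<close>
    define L where "L = (\<lambda>z t. Blinfun (\<lambda>w. dd w F (z + circ r t *s v) / circ r t))"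
    have bl: "bounded_linear (\<lambda>w. dd w F (z + circ r t *s v) / circ r t)" if "z \<in> U" for z t
      using bounded_linear_compose[OF bounded_linear_divide has_derivative_bounded_linear[OF holo_fun_has_derivative[OF F(2) inD[OF that]]]] .
    have L: "blinfun_apply (L z t) w = dd w F (z + circ r t *s v) / circ r t" if "z \<in> U" for z t w
      unfolding L_def using bounded_linear_Blinfun_apply[OF bl[OF that]] by simp
    have cc: "continuous_on (U \<times> cbox 0 1) (\<lambda>x. f (fst x + circ r (snd x) *s v) / circ r (snd x))"
      if "continuous_on D f" for f
      by (intro continuous_intros continuous_on_compose2[OF that])
        (use inD circ_nz[OF er(2)] in auto)
    have der: "((\<lambda>z. F (z + circ r t *s v) / circ r t) has_derivative blinfun_apply (L z t)) (at z within U)"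
      if "z \<in> U" for z t
    proof -
      have "((\<lambda>z. z + circ r t *s v) has_derivative (\<lambda>h. h)) (at z)"
        by (auto intro!: derivative_eq_intros)
      from has_derivative_compose[OF this holo_fun_has_derivative[OF F(2) inD[OF that]]]
      have "((\<lambda>z. F (z + circ r t *s v)) has_derivative (\<lambda>w. dd w F (z + circ r t *s v))) (at z)" .
      from bounded_linear.has_derivative[OF bounded_linear_divide this]
      have "((\<lambda>z. F (z + circ r t *s v) / circ r t) has_derivative (\<lambda>w. dd w F (z + circ r t *s v) / circ r t)) (at z)" .
      moreover have "blinfun_apply (L z t) = (\<lambda>w. dd w F (z + circ r t *s v) / circ r t)"
        using L[OF that] by auto
      ultimately show ?thesis by (simp add: has_derivative_at_withinI)
    qed
    have cL: "continuous_on (U \<times> cbox 0 1) (\<lambda>(z, t). L z t)"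
    proof (rule continuous_on_blinfun_componentwise)
      fix i :: "complex^'a" assume "i \<in> Basis"
      show "continuous_on (U \<times> cbox 0 1) (\<lambda>x. blinfun_apply (case x of (z, t) \<Rightarrow> L z t) i)"
        by (rule continuous_on_eq[OF cc[OF holo_fun_dd_continuous[OF F, of i]]]) (auto simp: L)
    qed
    have int: "(\<lambda>t. F (z + circ r t *s v) / circ r t) integrable_on cbox 0 1" if "z \<in> U" for z
      by (intro integrable_continuous continuous_intros continuous_on_compose2[OF holo_fun_continuous_on[OF F(2)]])
        (use inD[OF that] circ_nz[OF er(2)] in auto)
    have z0: "z0 \<in> U" using er(1) by (simp add: U_def)
    have "((\<lambda>z. integral (cbox 0 1) (\<lambda>t. F (z + circ r t *s v) / circ r t)) has_derivative
        blinfun_apply (integral (cbox 0 1) (L z0))) (at z0 within U)"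
      by (rule leibniz_rule[OF der int cL z0]) (auto simp: U_def)
    then have d: "((\<lambda>z. integral (cbox 0 1) (\<lambda>t. F (z + circ r t *s v) / circ r t)) has_derivative
        blinfun_apply (integral (cbox 0 1) (L z0))) (at z0)"
      using at_within_open[OF z0] by (simp add: U_def)
    have "(dd v F has_derivative blinfun_apply (integral (cbox 0 1) (L z0))) (at z0)"
      by (rule has_derivative_transform_within_open[OF d _ z0])
        (unfold U_def, rule open_ball, rule holo_fun_Cauchy[OF F er(2,3), symmetric])
    moreover have "blinfun_apply (integral (cbox 0 1) (L z0)) (c *s w) =
        c * blinfun_apply (integral (cbox 0 1) (L z0)) w" for c w
    proof -
      have cL0: "continuous_on (cbox 0 1) (L z0)"
        using continuous_on_compose2[OF cL continuous_on_Pair[OF continuous_on_const continuous_on_id], of z0 "cbox 0 1"] z0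
        by auto
      then have i: "L z0 integrable_on cbox 0 1" by (rule integrable_continuous)
      have eq: "L z0 t (c *s w) = c * L z0 t w" for t
        unfolding L[OF z0] using F(2) inD[OF z0, of t] unfolding holo_fun_def by simp
      show ?thesis
        unfolding blinfun_apply_integral[OF i] eq
        by (rule Henstock_Kurzweil_Integration.integral_mult_right)
    qed
    ultimately show ?thesis by blast
  qed
  then obtain L where "\<And>z. z \<in> D \<Longrightarrow> (dd v F has_derivative L z) (at z) \<and> (\<forall>c w. L z (c *s w) = c * L z w)"
    by metis
  then show ?thesis by (intro holo_funI[of D _ L]) auto
qed

text \<open>The induction closes because directional derivatives stay in the class.\<close>

lemma holo_fun_smooth:
  assumes "open D" "holo_fun F D" shows "smooth_on D F"
proof -
  have "Ck_on n D F" for n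
    using assms(2)
  proof (induction n arbitrary: F)
    case 0 then show ?case by (simp add: holo_fun_continuous_on)
  next
    case (Suc n)
    show ?case
      by (rule Ck_on_SucI[OF assms(1) holo_fun_has_derivative[OF Suc.prems]])
        (assumption, rule Suc.IH[OF holo_fun_dd[OF assms(1) Suc.prems]])
  qed
  then show ?thesis by (simp add: smooth_on_def)
qed

section \<open>The Laplacian along complex lines\<close>

lemma dd_comp_linear:
  assumes "bounded_linear L" "smooth_on D f" "x \<in> D"
  shows "dd v (\<lambda>x. L (f x)) x = L (dd v f x)"
  by (rule dd_eqI[OF bounded_linear.has_derivative[OF assms(1) dd_has_derivative[OF assms(2,3)]]])

lemma dd_dd_comp_linear:
  assumes "bounded_linear L" "smooth_on D f" "x \<in> D" "open D"
  shows "dd v (dd v (\<lambda>x. L (f x))) x = L (dd v (dd v f) x)"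
proof -
  have "dd v (dd v (\<lambda>x. L (f x))) x = dd v (\<lambda>x. L (dd v f x)) x"
    by (rule dd_cong[OF assms(4,3) dd_comp_linear[OF assms(1,2)]])
  then show ?thesis using dd_comp_linear[OF assms(1) smooth_on_dd[OF assms(2)] assms(3)] by simp
qed

text \<open>The Laplacian at c = 0 of c \<mapsto> f (p + c v). Vector values are allowed so that it
  also applies to coordinate changes.\<close>

definition lap :: "(complex^'k \<Rightarrow> 'w::real_normed_vector) \<Rightarrow> complex^'k \<Rightarrow> complex^'k \<Rightarrow> 'w" where
  "lap f p v = dd v (dd v f) p + dd (\<i> *s v) (dd (\<i> *s v) f) p"

text \<open>Differentiating along \<i> v multiplies by \<i>; applied to \<open>F\<close> and then to
  \<open>dd v F\<close>, which is holomorphic as well, this gives the factor -1.\<close>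

lemma lap_holo_fun:
  assumes "open D" "holo_fun F D" "z \<in> D" shows "lap F z v = 0"
proof -
  have "dd (\<i> *s v) (dd (\<i> *s v) F) z = dd (\<i> *s v) (\<lambda>y. \<i> * dd v F y) z"
    by (rule dd_cong[OF assms(1,3)]) (use assms(2) in \<open>simp add: holo_fun_def\<close>)
  also have "\<dots> = \<i> * dd (\<i> *s v) (dd v F) z"
    by (rule dd_comp_linear[OF bounded_linear_mult_right smooth_on_dd[OF holo_fun_smooth[OF assms(1,2)]] assms(3)])
  also have "\<dots> = \<i> * (\<i> * dd v (dd v F) z)"
    using holo_fun_dd[OF assms(1,2)] assms(3) unfolding holo_fun_def by simp
  also have "\<dots> = - dd v (dd v F) z" by (simp add: mult.assoc[symmetric])
  finally show ?thesis by (simp add: lap_def)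
qed

lemma lap_comp_linear:
  assumes "bounded_linear L" "smooth_on D f" "x \<in> D" "open D"
  shows "lap (\<lambda>x. L (f x)) x v = L (lap f x v)"
  unfolding lap_def dd_dd_comp_linear[OF assms] by (simp add: linear_simps(1)[OF assms(1)])

lemma lap_Re_holo_fun:
  assumes "open D" "holo_fun F D" "z \<in> D" shows "lap (\<lambda>z. Re (F z)) z v = 0"
  using lap_comp_linear[OF bounded_linear_Re holo_fun_smooth[OF assms(1,2)] assms(3,1)] lap_holo_fun[OF assms] by simp

lemma lap_cong:
  assumes "open D" "x \<in> D" "\<And>y. y \<in> D \<Longrightarrow> f y = g y" shows "lap f x v = lap g x v"
proof -
  have "dd w (dd w f) x = dd w (dd w g) x" for w
    by (rule dd_cong[OF assms(1,2) dd_cong[OF assms(1) _ assms(3)]])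
  then show ?thesis by (simp add: lap_def)
qed

lemma dd_dd_add:
  assumes "open D" "smooth_on D f" "smooth_on D g" "x \<in> D"
  shows "dd v (dd v (\<lambda>x. f x + g x)) x = dd v (dd v f) x + dd v (dd v g) x"
proof -
  have "dd v (dd v (\<lambda>x. f x + g x)) x = dd v (\<lambda>x. dd v f x + dd v g x) x"
    by (rule dd_cong[OF assms(1,4)],
        rule dd_eqI[OF has_derivative_add[OF dd_has_derivative[OF assms(2)] dd_has_derivative[OF assms(3)]]])
  also have "\<dots> = dd v (dd v f) x + dd v (dd v g) x"
    by (rule dd_eqI[OF has_derivative_add[OF dd_has_derivative[OF smooth_on_dd[OF assms(2)] assms(4)]
          dd_has_derivative[OF smooth_on_dd[OF assms(3)] assms(4)]]])
  finally show ?thesis .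
qed

lemma lap_add:
  assumes "open D" "smooth_on D f" "smooth_on D g" "x \<in> D"
  shows "lap (\<lambda>x. f x + g x) x v = lap f x v + lap g x v"
  unfolding lap_def dd_dd_add[OF assms] by simp

lemma lap_cmult:
  fixes f :: "complex^'k \<Rightarrow> real"
  assumes "open D" "smooth_on D f" "x \<in> D" shows "lap (\<lambda>x. c * f x) x v = c * lap f x v"
  by (rule lap_comp_linear[OF bounded_linear_mult_right assms(2,3,1)])

lemma lap_diff:
  assumes "open D" "smooth_on D f" "smooth_on D g" "x \<in> D"
  shows "lap (\<lambda>x. f x - g x) x v = lap f x v - lap g x v"
proof -
  have "lap (\<lambda>x. f x + - g x) x v = lap f x v + lap (\<lambda>x. - g x) x v"
    by (rule lap_add[OF assms(1,2) smooth_on_uminus[OF assms(1,3)] assms(4)])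
  then show ?thesis
    using lap_comp_linear[OF bounded_linear_minus[OF bounded_linear_ident] assms(3,4,1)] by simp
qed

lemma has_derivative_vec_nth': "(f has_derivative F) G \<Longrightarrow> ((\<lambda>x. f x $ i) has_derivative (\<lambda>h. F h $ i)) G"
  by (rule bounded_linear.has_derivative[OF bounded_linear_vec_nth])

lemma vec_holomorphic_on_components:
  assumes "vec_holomorphic_on f D" shows "open D" "holo_fun (\<lambda>z. f z $ i) D"
proof -
  show "open D" using assms by (simp add: vec_holomorphic_on_def)
  have "\<exists>L. ((\<lambda>z. f z $ i) has_derivative L) (at z) \<and> (\<forall>c v. L (c *s v) = c * L v)" if "z \<in> D" for z
  proof -
    have "\<exists>L. (f has_derivative L) (at z) \<and> complex_linear L"
      using assms that by (simp add: vec_holomorphic_on_def)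
    then obtain L where L: "(f has_derivative L) (at z)" "complex_linear L" by auto
    then show ?thesis
      by (intro exI[of _ "\<lambda>h. L h $ i"]) (auto simp: complex_linear_def intro: has_derivative_vec_nth')
  qed
  then obtain L where "\<And>z. z \<in> D \<Longrightarrow> ((\<lambda>z. f z $ i) has_derivative L z) (at z) \<and> (\<forall>c v. L z (c *s v) = c * L z v)"
    by metis
  then show "holo_fun (\<lambda>z. f z $ i) D" by (intro holo_funI[of D _ L]) auto
qed

lemma vec_holomorphic_on_smooth:
  assumes "vec_holomorphic_on f D" shows "smooth_on D f"
  by (rule smooth_on_vec[OF vec_holomorphic_on_components(1)[OF assms]
        holo_fun_smooth[OF vec_holomorphic_on_components[OF assms]]])

lemma vec_holomorphic_onI:
  assumes "open D" "\<And>i. holo_fun (\<lambda>z. f z $ i) D" shows "vec_holomorphic_on f D"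
  unfolding vec_holomorphic_on_def
proof (intro conjI assms(1) ballI)
  fix z assume z: "z \<in> D"
  have sm: "smooth_on D f" by (rule smooth_on_vec[OF assms(1) holo_fun_smooth[OF assms]])
  have comp: "dd v f z $ i = dd v (\<lambda>z. f z $ i) z" for v i
    using dd_comp_linear[OF bounded_linear_vec_nth sm z] by simp
  have "complex_linear (\<lambda>v. dd v f z)"
    unfolding complex_linear_def
    using assms(2) z by (auto simp: dd_add[OF sm z] vec_eq_iff comp holo_fun_def)
  then show "\<exists>L. (f has_derivative L) (at z) \<and> complex_linear L"
    using dd_has_derivative[OF sm z] by blast
qed

lemma dd_vec_holomorphic_cmult:
  assumes "vec_holomorphic_on f D" "z \<in> D" shows "dd (c *s v) f z = c *s dd v f z"
proof -
  note sm = vec_holomorphic_on_smooth[OF assms(1)]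
  have comp: "dd v f z $ i = dd v (\<lambda>z. f z $ i) z" for v i
    using dd_comp_linear[OF bounded_linear_vec_nth sm assms(2)] by simp
  show ?thesis
    using vec_holomorphic_on_components(2)[OF assms(1)] assms(2) by (simp add: vec_eq_iff comp holo_fun_def)
qed

lemma lap_vec_holomorphic:
  assumes "vec_holomorphic_on f D" "z \<in> D" shows "lap f z v = 0"
proof -
  have "lap f z v $ i = 0" for i
    using lap_comp_linear[OF bounded_linear_vec_nth vec_holomorphic_on_smooth[OF assms(1)] assms(2)
        vec_holomorphic_on_components(1)[OF assms(1)], of i v]
      lap_holo_fun[OF vec_holomorphic_on_components[OF assms(1)] assms(2), of i v] by simp
  then show ?thesis by (simp add: vec_eq_iff)
qed

text \<open>Invariance of the Levi form under holomorphic maps: the term with the second derivatives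
  of \<open>T\<close> involves only \<open>lap T\<close>, which vanishes.\<close>

lemma lap_compose_holomorphic:
  assumes f: "open D'" "smooth_on D' f" and T: "T ` D \<subseteq> D'" "vec_holomorphic_on T D" and "z \<in> D"
  shows "lap (\<lambda>z. f (T z)) z v = lap f (T z) (dd v T z)"
proof -
  note sm = vec_holomorphic_on_smooth[OF T(2)] and op = vec_holomorphic_on_components(1)[OF T(2)]
  have Tz: "T z \<in> D'" using T(1) \<open>z \<in> D\<close> by blast
  note iv = dd_vec_holomorphic_cmult[OF T(2) \<open>z \<in> D\<close>]
  have "lap (\<lambda>z. f (T z)) z v = dd (lap T z v) f (T z) + lap f (T z) (dd v T z)"
    unfolding lap_def dd_dd_compose[OF f T(1) op sm \<open>z \<in> D\<close>] dd_add[OF f(2) Tz] iv by simp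
  then show ?thesis by (simp add: lap_vec_holomorphic[OF T(2) \<open>z \<in> D\<close>] dd_zero[OF f(2) Tz])
qed

section \<open>The Levi form and the sub-mean value property\<close>

text \<open>With the real Hessian \<open>H\<close> and the real coordinates of \<open>v\<close> and
  \<i> v, both sides become double sums over the complex coordinates.\<close>

lemma levi_form_lap:
  assumes "open D" "smooth_on D u" "p \<in> D"
  shows "Re (levi_form u p v) = lap u p v / 4"
proof -
  define e e' :: "'a \<Rightarrow> complex^'a" where "e = (\<lambda>j. axis j 1)" and "e' = (\<lambda>j. axis j \<i>)"
  define H where "H = (\<lambda>a b. dd a (dd b u) p)"
  have wb: "wirtinger_bar k (\<lambda>z. of_real (u z)) y = (of_real (dd (e k) u y) + \<i> * of_real (dd (e' k) u y)) / 2"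
    if "y \<in> D" for k y
    using dd_comp_linear[OF bounded_linear_of_real[where 'a = complex] assms(2) that]
    unfolding wirtinger_bar_def dd_def[symmetric] e_def e'_def by simp
  have dwb: "dd a (wirtinger_bar k (\<lambda>z. of_real (u z))) p = (of_real (H a (e k)) + \<i> * of_real (H a (e' k))) / 2" for a k
  proof -
    have "dd a (wirtinger_bar k (\<lambda>z. of_real (u z))) p =
        dd a (\<lambda>y. (of_real (dd (e k) u y) + \<i> * of_real (dd (e' k) u y)) / 2) p"
      by (rule dd_cong[OF assms(1,3) wb])
    also have "\<dots> = (of_real (H a (e k)) + \<i> * of_real (H a (e' k))) / 2"
      unfolding H_def
      by (rule dd_eqI, rule bounded_linear.has_derivative[OF bounded_linear_divide has_derivative_add[OF
            bounded_linear.has_derivative[OF bounded_linear_of_real dd_has_derivative[OF smooth_on_dd[OF assms(2)] assms(3)]]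
            bounded_linear.has_derivative[OF bounded_linear_mult_right bounded_linear.has_derivative[OF bounded_linear_of_real
              dd_has_derivative[OF smooth_on_dd[OF assms(2)] assms(3)]]]]])
    finally show ?thesis .
  qed
  have H1: "linear (\<lambda>a. H a b)" and H2: "linear (\<lambda>b. H a b)" for a b
    unfolding H_def using dd_linear[OF smooth_on_dd[OF assms(2)] assms(3)] linear_dd_dd[OF assms] by auto
  note lin = linear_add[OF H1] linear_add[OF H2] linear_diff[OF H1] linear_diff[OF H2]
    linear_cmul[OF H1] linear_cmul[OF H2]
  have v: "v = (\<Sum>j\<in>UNIV. Re (v $ j) *\<^sub>R e j + Im (v $ j) *\<^sub>R e' j)"
    by (simp add: vec_eq_iff e_def e'_def axis_def if_distrib[of "\<lambda>x. _ *\<^sub>R x"] sum.distrib complex_eq_iff cong: if_cong)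
  have iv: "\<i> *s v = (\<Sum>j\<in>UNIV. Re (v $ j) *\<^sub>R e' j - Im (v $ j) *\<^sub>R e j)"
    by (simp add: vec_eq_iff e_def e'_def axis_def if_distrib[of "\<lambda>x. _ *\<^sub>R x"] sum_subtractf complex_eq_iff cong: if_cong)
  have H_sum: "H (\<Sum>j\<in>UNIV. a j) (\<Sum>k\<in>UNIV. b k) = (\<Sum>j\<in>UNIV. \<Sum>k\<in>UNIV. H (a j) (b k))"
    for a b :: "'a \<Rightarrow> complex^'a"
    using linear_sum[OF H1, of a UNIV "\<Sum>k\<in>UNIV. b k"] linear_sum[OF H2, of _ b UNIV] by simp
  have "lap u p v = H v v + H (\<i> *s v) (\<i> *s v)" by (simp add: lap_def H_def)
  also have "H v v = (\<Sum>j\<in>UNIV. \<Sum>k\<in>UNIV. H (Re (v $ j) *\<^sub>R e j + Im (v $ j) *\<^sub>R e' j) (Re (v $ k) *\<^sub>R e k + Im (v $ k) *\<^sub>R e' k))"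
    by (subst (1 2) v) (rule H_sum)
  also have "H (\<i> *s v) (\<i> *s v) = (\<Sum>j\<in>UNIV. \<Sum>k\<in>UNIV. H (Re (v $ j) *\<^sub>R e' j - Im (v $ j) *\<^sub>R e j) (Re (v $ k) *\<^sub>R e' k - Im (v $ k) *\<^sub>R e k))"
    unfolding iv by (rule H_sum)
  finally have L: "lap u p v = (\<Sum>j\<in>UNIV. \<Sum>k\<in>UNIV.
       H (Re (v $ j) *\<^sub>R e j + Im (v $ j) *\<^sub>R e' j) (Re (v $ k) *\<^sub>R e k + Im (v $ k) *\<^sub>R e' k) +
       H (Re (v $ j) *\<^sub>R e' j - Im (v $ j) *\<^sub>R e j) (Re (v $ k) *\<^sub>R e' k - Im (v $ k) *\<^sub>R e k))"
    by (simp add: sum.distrib)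
  \<comment> \<open>The two double sums agree term by term, once real parts are taken.\<close>
  have "Re (wirtinger j (wirtinger_bar k (\<lambda>z. of_real (u z))) p * v $ j * cnj (v $ k)) =
      (H (Re (v $ j) *\<^sub>R e j + Im (v $ j) *\<^sub>R e' j) (Re (v $ k) *\<^sub>R e k + Im (v $ k) *\<^sub>R e' k) +
       H (Re (v $ j) *\<^sub>R e' j - Im (v $ j) *\<^sub>R e j) (Re (v $ k) *\<^sub>R e' k - Im (v $ k) *\<^sub>R e k)) / 4" for j k
  proof -
    have "wirtinger j (wirtinger_bar k (\<lambda>z. of_real (u z))) p =
       (of_real (H (e j) (e k) + H (e' j) (e' k)) + \<i> * of_real (H (e j) (e' k) - H (e' j) (e k))) / 4"
      unfolding wirtinger_def dd_def[symmetric] dwb[of "axis j _"] unfolding e_def[symmetric] e'_def[symmetric]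
      by (simp add: e_def e'_def field_simps complex_eq_iff)
    then show ?thesis by (simp only:) (simp add: lin algebra_simps)
  qed
  then show ?thesis unfolding levi_form_def L Re_sum sum_divide_distrib by (simp only:)
qed

section \<open>Closure properties of holomorphic functions and maps\<close>

lemma holo_fun_compose:
  assumes "holo_fun F D" "vec_holomorphic_on T D'" "T ` D' \<subseteq> D"
  shows "holo_fun (\<lambda>z. F (T z)) D'"
proof (rule holo_funI)
  fix z assume z: "z \<in> D'"
  then have Tz: "T z \<in> D" using assms(3) by blast
  show "((\<lambda>z. F (T z)) has_derivative (\<lambda>v. dd (dd v T z) F (T z))) (at z)"
    by (rule has_derivative_compose[OF dd_has_derivative[OF vec_holomorphic_on_smooth[OF assms(2)] z]
          holo_fun_has_derivative[OF assms(1) Tz]])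
  show "dd (dd (c *s v) T z) F (T z) = c * dd (dd v T z) F (T z)" for c v
    unfolding dd_vec_holomorphic_cmult[OF assms(2) z] using assms(1) Tz by (simp add: holo_fun_def)
qed

lemma holo_fun_mult:
  assumes "holo_fun F D" "holo_fun G D" shows "holo_fun (\<lambda>z. F z * G z) D"
proof (rule holo_funI)
  fix z assume z: "z \<in> D"
  show "((\<lambda>z. F z * G z) has_derivative (\<lambda>v. F z * dd v G z + dd v F z * G z)) (at z)"
    by (rule has_derivative_mult[OF holo_fun_has_derivative[OF assms(1) z] holo_fun_has_derivative[OF assms(2) z]])
  show "F z * dd (c *s v) G z + dd (c *s v) F z * G z = c * (F z * dd v G z + dd v F z * G z)" for c v
    using assms z by (simp add: holo_fun_def algebra_simps)
qed

lemma holo_fun_cong: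
  assumes "open D" "\<And>z. z \<in> D \<Longrightarrow> F z = G z" "holo_fun F D" shows "holo_fun G D"
proof (rule holo_funI)
  fix z assume z: "z \<in> D"
  show "(G has_derivative (\<lambda>v. dd v F z)) (at z)"
    by (rule has_derivative_transform_within_open[OF holo_fun_has_derivative[OF assms(3) z] assms(1) z assms(2)])
  show "dd (c *s v) F z = c * dd v F z" for c v using assms(3) z by (simp add: holo_fun_def)
qed

lemma holo_fun_linear:
  assumes "bounded_linear L" "\<And>c v. L (c *s v) = c * L v" shows "holo_fun L D"
  by (rule holo_funI[OF bounded_linear_imp_has_derivative[OF assms(1)] assms(2)])

lemma holo_fun_component: "holo_fun (\<lambda>z. z $ i) D"
  by (rule holo_fun_linear[OF bounded_linear_vec_nth]) simp

lemma vec_holomorphic_on_cong: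
  assumes "\<And>z. z \<in> D \<Longrightarrow> f z = g z" "vec_holomorphic_on f D" shows "vec_holomorphic_on g D"
proof (rule vec_holomorphic_onI)
  show o: "open D" using assms(2) by (simp add: vec_holomorphic_on_def)
  show "holo_fun (\<lambda>z. g z $ i) D" for i
    by (rule holo_fun_cong[OF o _ vec_holomorphic_on_components(2)[OF assms(2)]]) (simp add: assms(1))
qed

lemma vec_holomorphic_on_subset:
  "vec_holomorphic_on f D \<Longrightarrow> open D' \<Longrightarrow> D' \<subseteq> D \<Longrightarrow> vec_holomorphic_on f D'"
  unfolding vec_holomorphic_on_def by blast

lemma vec_holomorphic_on_compose:
  assumes "vec_holomorphic_on f D" "vec_holomorphic_on g D'" "g ` D' \<subseteq> D"
  shows "vec_holomorphic_on (\<lambda>z. f (g z)) D'"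
  by (rule vec_holomorphic_onI[OF vec_holomorphic_on_components(1)[OF assms(2)]
      holo_fun_compose[OF vec_holomorphic_on_components(2)[OF assms(1)] assms(2,3)]])

lemma holo_fun_const: "holo_fun (\<lambda>z. c) D"
  by (rule holo_funI[of _ _ "\<lambda>_ _. 0"]) auto

lemma holo_fun_field_compose:
  assumes "holo_fun F D" "\<And>z. z \<in> D \<Longrightarrow> (g has_field_derivative g' z) (at (F z))"
  shows "holo_fun (\<lambda>z. g (F z)) D"
proof (rule holo_funI)
  fix z assume z: "z \<in> D"
  show "((\<lambda>z. g (F z)) has_derivative (\<lambda>v. g' z * dd v F z)) (at z)"
    by (rule has_derivative_compose[OF holo_fun_has_derivative[OF assms(1) z] assms(2)[OF z, unfolded has_field_derivative_def]])
  show "g' z * dd (c *s v) F z = c * (g' z * dd v F z)" for c v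
    using assms(1) z by (simp add: holo_fun_def)
qed

lemma scaleR_cmult_vec: "r *\<^sub>R (c *s b) = (of_real r * c) *s (b :: complex^'k)"
  by (simp add: vec_eq_iff complex_eq_iff algebra_simps)

lemma cis_has_vector_derivative: "(cis has_vector_derivative \<i> * cis t) (at t)"
proof -
  have "((\<lambda>z. exp (\<i> * z)) has_field_derivative \<i> * exp (\<i> * of_real t)) (at (of_real t))"
    by (auto intro!: derivative_eq_intros)
  from has_vector_derivative_real_field[OF this] show ?thesis
    by (simp add: cis_conv_exp[abs_def])
qed

text \<open>In polar coordinates \<open>(r\<partial>\<^sub>r)\<^sup>2 + \<partial>\<^sub>t\<^sup>2\<close> is \<open>r\<^sup>2\<close> times the Laplacian, and \<open>\<partial>\<^sub>t\<^sup>2\<close> integrates to \<open>0\<close>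
  over a circle. So \<open>J = r I'\<close>, where \<open>I(r)\<close> is the integral over the circle of radius \<open>r\<close>, increases from \<open>J(0) = 0\<close>.\<close>

lemma disc_submean_onI:
  assumes D: "open D" and u: "smooth_on D u" and nn: "\<And>p v. p \<in> D \<Longrightarrow> lap u p v \<ge> 0"
  shows "disc_submean_on D u"
  unfolding disc_submean_on_def
proof (intro allI impI)
  fix a b :: "complex^'a"
  assume disc: "\<forall>c. cmod c \<le> 1 \<longrightarrow> a + c *s b \<in> D"
  define W where "W = (\<lambda>t. cis t *s b)"
  \<comment> \<open>Polar coordinates on the disc: \<open>W t\<close> is the radial direction at
    angle \<open>t\<close>, and \<open>X r t\<close> the point at radius \<open>r\<close>.\<close>
  define X where "X = (\<lambda>r t. a + r *\<^sub>R W t)"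
  have XD: "X r t \<in> D" if "0 \<le> r" "r \<le> 1" for r t
  proof -
    have "X r t = a + (of_real r * cis t) *s b" by (simp add: X_def W_def scaleR_cmult_vec)
    then show ?thesis using disc that by (simp add: norm_mult)
  qed
  \<comment> \<open>\<open>g\<close> and \<open>g2\<close> are the first and second radial
    derivatives of \<open>u\<close>, and \<open>G\<close>, \<open>G2\<close> their integrals over
    the circle. In terms of I, G = I' and G2 = I''.\<close>
  define g where "g = (\<lambda>r t. dd (W t) u (X r t))"
  define g2 where "g2 = (\<lambda>r t. dd (W t) (dd (W t) u) (X r t))"
  define I where "I = (\<lambda>r. integral (cbox 0 (2*pi)) (\<lambda>t. u (X r t)))"
  define G where "G = (\<lambda>r. integral (cbox 0 (2*pi)) (\<lambda>t. g r t))"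
  define G2 where "G2 = (\<lambda>r. integral (cbox 0 (2*pi)) (\<lambda>t. g2 r t))"
  have cW: "continuous_on A (\<lambda>s. W (f s))" if "continuous_on A f" for A :: "'z::topological_space set" and f
    unfolding W_def cis_conv_exp by (intro continuous_intros that)
  have cX: "continuous_on A (\<lambda>s. X (h s) (f s))" if "continuous_on A f" "continuous_on A h"
    for A :: "'z::topological_space set" and f h
    unfolding X_def by (intro continuous_intros cW that)
  have XA: "(\<lambda>s. X (fst s) (snd s)) ` ({0..1} \<times> cbox 0 (2*pi)) \<subseteq> D" using XD by auto
  have cont_g: "continuous_on ({0..1} \<times> cbox 0 (2*pi)) (\<lambda>(r, t). g r t)"
    unfolding g_def split_beta by (intro continuous_on_dd[OF u _ _ XA] cW cX continuous_intros)
  have cont_g2: "continuous_on ({0..1} \<times> cbox 0 (2*pi)) (\<lambda>(r, t). g2 r t)"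
    unfolding g2_def split_beta by (intro continuous_on_dd_dd[OF D u _ _ _ XA] cW cX continuous_intros)
  have X_r: "((\<lambda>r. X r t) has_derivative (\<lambda>h. h *\<^sub>R W t)) (at r)" for r t
    unfolding X_def by (auto intro!: derivative_eq_intros)
  have d1: "((\<lambda>r. u (X r t)) has_field_derivative g r t) (at r)" if "0 \<le> r" "r \<le> 1" for r t
    using has_derivative_compose[OF X_r dd_has_derivative[OF u XD[OF that]]]
    unfolding has_field_derivative_def g_def dd_scaleR[OF u XD[OF that]] by (simp add: mult_commute_abs)
  have d2: "((\<lambda>r. g r t) has_field_derivative g2 r t) (at r)" if "0 \<le> r" "r \<le> 1" for r t
    using has_derivative_compose[OF X_r dd_has_derivative[OF smooth_on_dd[OF u] XD[OF that]]]
    unfolding has_field_derivative_def g_def g2_def dd_scaleR[OF smooth_on_dd[OF u] XD[OF that]] by (simp add: mult_commute_abs)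
  have int_g: "g r integrable_on cbox 0 (2*pi)" if "0 \<le> r" "r \<le> 1" for r
    unfolding g_def by (rule integrable_continuous)
      (use XD[OF that] in \<open>intro continuous_on_dd[OF u] cW cX continuous_intros; auto\<close>)
  have int_g2: "g2 r integrable_on cbox 0 (2*pi)" if "0 \<le> r" "r \<le> 1" for r
    unfolding g2_def by (rule integrable_continuous)
      (use XD[OF that] in \<open>intro continuous_on_dd_dd[OF D u] cW cX continuous_intros; auto\<close>)
  have int_u: "(\<lambda>t. u (X r t)) integrable_on cbox 0 (2*pi)" if "0 \<le> r" "r \<le> 1" for r
    by (rule integrable_continuous)
      (use XD[OF that] in \<open>intro continuous_on_compose2[OF smooth_on_imp_continuous_on[OF u]] cX continuous_intros; auto\<close>)
  have dI: "(I has_field_derivative G r) (at r within {0..1})" if "0 \<le> r" "r \<le> 1" for r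
    unfolding I_def G_def
    by (rule leibniz_rule_field_derivative[OF _ int_u cont_g])
      (use that in \<open>auto intro: has_field_derivative_at_within[OF d1]\<close>)
  have dG: "(G has_field_derivative G2 r) (at r within {0..1})" if "0 \<le> r" "r \<le> 1" for r
    unfolding G_def G2_def
    by (rule leibniz_rule_field_derivative[OF _ int_g cont_g2])
      (use that in \<open>auto intro: has_field_derivative_at_within[OF d2]\<close>)
  have at: "at r within {0..1} = at r" if "0 < r" "r < 1" for r :: real
    using that by (rule at_within_Icc_at)
  have J': "G r + r * G2 r \<ge> 0" if r: "0 < r" "r < 1" for r
  proof -
    have rX: "X r t \<in> D" for t using XD r by simp
    \<comment> \<open>\<open>k\<close> and \<open>k'\<close> are the first and second angular
      derivatives of \<open>u\<close> on the circle. The term - r * g in \<open>k'\<close> is the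
      derivative of \<open>u\<close> along the acceleration of the circle, which points to the
      centre.\<close>
    define k where "k = (\<lambda>t. dd (r *\<^sub>R (\<i> *s W t)) u (X r t))"
    define k' where "k' = (\<lambda>t. dd (r *\<^sub>R (\<i> *s W t)) (dd (r *\<^sub>R (\<i> *s W t)) u) (X r t) - r * g r t)"
    have dW: "(W has_derivative (\<lambda>h. h *\<^sub>R (\<i> *s W t))) (at t)" for t
    proof -
      have "(W has_derivative (\<lambda>h. (h *\<^sub>R (\<i> * cis t)) *s b)) (at t)"
        unfolding W_def
        by (rule bounded_linear.has_derivative[OF bounded_linear_cmult_vec
              cis_has_vector_derivative[unfolded has_vector_derivative_def]])
      moreover have "(h *\<^sub>R (\<i> * cis t)) *s b = h *\<^sub>R (\<i> *s W t)" for h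
        unfolding W_def vector_smult_assoc scaleR_cmult_vec by (simp add: scaleR_conv_of_real)
      ultimately show ?thesis by simp
    qed
    have dW2: "((\<lambda>t. r *\<^sub>R (\<i> *s W t)) has_derivative (\<lambda>h. h *\<^sub>R (- (r *\<^sub>R W t)))) (at t)" for t
    proof -
      have bl: "bounded_linear (\<lambda>w. r *\<^sub>R (\<i> *s w) :: complex^'a)"
        by (intro linear_conv_bounded_linear[THEN iffD1] linearI) (auto simp: vec_eq_iff algebra_simps)
      have "r *\<^sub>R (\<i> *s (h *\<^sub>R (\<i> *s W t))) = h *\<^sub>R (- (r *\<^sub>R W t))" for h
        by (simp add: vec_eq_iff complex_eq_iff)
      then show ?thesis using bounded_linear.has_derivative[OF bl dW, of t] by simp
    qed
    have dX: "((\<lambda>t. X r t) has_derivative (\<lambda>h. h *\<^sub>R (r *\<^sub>R (\<i> *s W t)))) (at t)" for t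
      unfolding X_def by (auto intro!: derivative_eq_intros dW simp: scaleR_left_commute)
    have dk: "(k has_vector_derivative k' t) (at t)" for t
      using has_derivative_dd[OF D u rX dW2 dX, of t]
      unfolding has_vector_derivative_def k_def k'_def g_def dd_scaleR[OF smooth_on_dd[OF u] rX]
        dd_scaleR[OF u rX] dd_minus[OF u rX] by (simp add: algebra_simps)
    have "(k' has_integral (k (2*pi) - k 0)) {0..2*pi}"
      by (rule fundamental_theorem_of_calculus) (auto intro: has_vector_derivative_at_within[OF dk])
    moreover have "k (2*pi) = k 0" by (simp add: k_def X_def W_def)
    ultimately have "(k' has_integral 0) (cbox 0 (2*pi))" by simp
    moreover have "((\<lambda>t. r * g r t + r\<^sup>2 * g2 r t) has_integral (r * G r + r\<^sup>2 * G2 r)) (cbox 0 (2*pi))"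
      unfolding G_def G2_def
      by (intro has_integral_add has_integral_mult_right integrable_integral int_g int_g2) (use r in auto)
    ultimately have "((\<lambda>t. (r * g r t + r\<^sup>2 * g2 r t) + k' t) has_integral (r * G r + r\<^sup>2 * G2 r + 0)) (cbox 0 (2*pi))"
      by (rule has_integral_add[rotated])
    moreover have "(r * g r t + r\<^sup>2 * g2 r t) + k' t \<ge> 0" for t
    proof -
      have "dd (r *\<^sub>R W t) (dd (r *\<^sub>R W t) u) (X r t) = r\<^sup>2 * g2 r t"
        unfolding g2_def dd_scaleR[OF smooth_on_dd[OF u] rX]
        using linear_cmul[OF linear_dd_dd[OF D u rX]] by (simp add: power2_eq_square)
      moreover have "\<i> *s (r *\<^sub>R W t) = r *\<^sub>R (\<i> *s W t)" by (simp add: vec_eq_iff)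
      \<comment> \<open>The first order radial term cancels against the acceleration term, and the
        two pure second derivatives form the Laplacian in the direction r W.\<close>
      ultimately have "(r * g r t + r\<^sup>2 * g2 r t) + k' t = lap u (X r t) (r *\<^sub>R W t)"
        unfolding lap_def k'_def by simp
      then show ?thesis using nn[OF rX] by simp
    qed
    ultimately have "0 \<le> r * G r + r\<^sup>2 * G2 r + 0" by (rule has_integral_nonneg)
    then have "0 \<le> r * (G r + r * G2 r)" by (simp add: power2_eq_square algebra_simps)
    then show ?thesis using r by (simp add: zero_le_mult_iff)
  qed
  have cI: "continuous_on {0..1} I" and cG: "continuous_on {0..1} G"
    by (rule DERIV_continuous_on[of _ _ G], rule dI; simp) (rule DERIV_continuous_on[of _ _ G2], rule dG; simp)
  have Gnn: "G r \<ge> 0" if r: "0 < r" "r < 1" for r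
  proof -
    have "(\<lambda>s. s * G s) 0 \<le> (\<lambda>s. s * G s) r"
    proof (rule DERIV_nonneg_imp_increasing_open[where f = "\<lambda>s. s * G s"])
      fix s assume s: "0 < s" "s < r"
      have "(G has_field_derivative G2 s) (at s)" using dG[of s] at[of s] s r by simp
      then have "((\<lambda>s. s * G s) has_field_derivative (G s + s * G2 s)) (at s)"
        by (auto intro!: derivative_eq_intros)
      then show "\<exists>y. ((\<lambda>s. s * G s) has_real_derivative y) (at s) \<and> 0 \<le> y" using J'[of s] s r by auto
    next
      show "continuous_on {0..r} (\<lambda>s. s * G s)"
        by (intro continuous_intros continuous_on_subset[OF cG]) (use r in auto)
    qed (use r in simp)
    then show ?thesis using r by (simp add: zero_le_mult_iff)
  qed
  have "I 0 \<le> I 1"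
  proof (rule DERIV_nonneg_imp_increasing_open[OF _ _ cI])
    fix r :: real assume "0 < r" "r < 1"
    then show "\<exists>y. (I has_real_derivative y) (at r) \<and> 0 \<le> y"
      using dI[of r] at[of r] Gnn[of r] by auto
  qed simp
  moreover have "I 0 = 2 * pi * u a" by (simp add: I_def X_def)
  moreover have cu: "continuous_on {0..2*pi} (\<lambda>t. u (a + cis t *s b))"
    using disc by (intro continuous_on_compose2[OF smooth_on_imp_continuous_on[OF u]] continuous_intros cW[unfolded W_def]) auto
  have si: "set_integrable lborel {0..2*pi} (\<lambda>t. u (a + cis t *s b))"
    using borel_integrable_atLeastAtMost'[OF cu] .
  moreover have "I 1 = (LINT t:{0..2*pi}|lborel. u (a + cis t *s b))"
    using set_borel_integral_eq_integral(2)[OF si] by (simp add: I_def X_def W_def)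
  ultimately show "set_integrable lborel {0..2*pi} (\<lambda>t. u (a + cis t *s b)) \<and>
        u a \<le> (LINT t:{0..2*pi}|lborel. u (a + cis t *s b)) / (2 * pi)"
    by (simp add: field_simps)
qed

section \<open>Product coordinates on a total space and the weighted fibre norm\<close>

definition base_part :: "complex^('m::finite + 'r::finite) \<Rightarrow> complex^'m" where
  "base_part y = (\<chi> j. y $ Inl j)"

definition fibre_part :: "complex^('m::finite + 'r::finite) \<Rightarrow> complex^'r" where
  "fibre_part y = (\<chi> k. y $ Inr k)"

definition join :: "complex^'m \<Rightarrow> complex^'r \<Rightarrow> complex^('m::finite + 'r::finite)" where
  "join z b = (\<chi> i. case i of Inl j \<Rightarrow> z $ j | Inr k \<Rightarrow> b $ k)"

lemma join_simps [simp]: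
  "base_part (join z b) = z" "fibre_part (join z b) = b" "join (base_part y) (fibre_part y) = y"
  "join z b $ Inl j = z $ j" "join z b $ Inr k = b $ k"
  by (auto simp: base_part_def fibre_part_def join_def vec_eq_iff split: sum.splits)

lemma bounded_linear_base_part: "bounded_linear (base_part :: complex^('m::finite + 'r::finite) \<Rightarrow> _)"
  and bounded_linear_join_left: "bounded_linear (\<lambda>z. join z 0 :: complex^('m::finite + 'r::finite))"
  by (auto intro!: linear_conv_bounded_linear[THEN iffD1] linearI
      simp: base_part_def join_def vec_eq_iff split: sum.splits)

lemma base_part_cmult: "base_part (c *s y) = c *s base_part y"
  by (simp add: base_part_def vec_eq_iff)

lemma vec_holomorphic_on_base_part:
  "open D \<Longrightarrow> vec_holomorphic_on (base_part :: complex^('m::finite + 'r::finite) \<Rightarrow> _) D"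
  by (rule vec_holomorphic_onI) (simp_all add: base_part_def holo_fun_component)

lemma open_base_vimage: "open \<Omega> \<Longrightarrow> open {y. base_part y \<in> \<Omega>}"
  by (drule open_vimage[OF _ linear_continuous_on[OF bounded_linear_base_part]]) (simp add: vimage_def)

text \<open>The coordinate form of a line bundle metric with weight \<Phi>. With \<open>p\<close>
  the potential \<open>metric_pot\<close>, the weight is - p for the metric and p for its
  dual.\<close>

definition fibre_quad :: "(complex^'m \<Rightarrow> real) \<Rightarrow> complex^('m::finite + 1) \<Rightarrow> real" where
  "fibre_quad \<Phi> y = (cmod (y $ Inr 1))\<^sup>2 * exp (\<Phi> (base_part y))"

lemma smooth_on_cmod_sq:
  assumes "open D" "bounded_linear (L :: 'v::euclidean_space \<Rightarrow> complex)" shows "smooth_on D (\<lambda>y. (cmod (L y))\<^sup>2)"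
  unfolding power2_norm_eq_inner
  by (intro smooth_on_bilinear[OF assms(1) bounded_bilinear_inner] smooth_on_bounded_linear assms(2))

lemma smooth_on_fibre_quad:
  assumes "open \<Omega>" "smooth_on \<Omega> \<Phi>" shows "smooth_on {y. base_part y \<in> \<Omega>} (fibre_quad \<Phi>)"
  unfolding fibre_quad_def[abs_def]
  by (intro smooth_on_mult smooth_on_cmod_sq open_base_vimage assms(1) bounded_linear_vec_nth
      smooth_on_compose[OF _ open_UNIV _ smooth_on_exp]
      smooth_on_compose[OF _ assms(1) _ assms(2)] smooth_on_bounded_linear bounded_linear_base_part) auto

text \<open>Completing the square. With b the fibre coordinate of \<open>y\<close>, and since dd v
  \<Phi> - \<i> dd (\<i> v) \<Phi> is 2 \<partial>\<Phi>(v), the first summand is 4 |w + b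
  \<partial>\<Phi>(v)|^2, where w stands for the fibre component. It measures the part of the
  direction that is vertical for the Chern connection.\<close>

lemma lap_fibre_quad:
  fixes y w :: "complex^('m::finite + 1)"
  assumes "open \<Omega>" "smooth_on \<Omega> \<Phi>" "base_part y \<in> \<Omega>"
  defines "v \<equiv> base_part w" and "z \<equiv> base_part y"
  shows "lap (fibre_quad \<Phi>) y w = exp (\<Phi> z) *
    ((cmod (2 * w $ Inr 1 + y $ Inr 1 * (of_real (dd v \<Phi> z) - \<i> * of_real (dd (\<i> *s v) \<Phi> z))))\<^sup>2
      + (cmod (y $ Inr 1))\<^sup>2 * lap \<Phi> z v)"
proof -
  define D where "D = {y :: complex^('m + 1). base_part y \<in> \<Omega>}"
  have oD: "open D" and yD: "y \<in> D" unfolding D_def using open_base_vimage assms by auto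
  have eq: "fibre_quad \<Phi> = (\<lambda>y. (y $ Inr 1 \<bullet> y $ Inr 1) * exp (\<Phi> (base_part y)))"
    by (simp add: fibre_quad_def[abs_def] power2_norm_eq_inner)
  have base: "((\<lambda>y. f (base_part y)) has_derivative (\<lambda>h. dd (base_part h) f (base_part x))) (at x)"
    if "smooth_on \<Omega> f" "x \<in> D" for f :: "complex^'m \<Rightarrow> real" and x
    by (rule has_derivative_compose[OF bounded_linear_imp_has_derivative[OF bounded_linear_base_part]
         dd_has_derivative[OF that(1)]]) (use that(2) in \<open>simp add: D_def\<close>)
  have fib: "((\<lambda>y. y $ Inr 1) has_derivative (\<lambda>h. h $ Inr 1)) (at x)" for x :: "complex^('m + 1)"
    by (rule bounded_linear_imp_has_derivative[OF bounded_linear_vec_nth])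
  have one: "dd w (fibre_quad \<Phi>) x = exp (\<Phi> (base_part x)) *
      (2 * (x $ Inr 1 \<bullet> w $ Inr 1) + (x $ Inr 1 \<bullet> x $ Inr 1) * dd (base_part w) \<Phi> (base_part x))"
    if "x \<in> D" for x w
    unfolding eq
    by (rule dd_eqI[THEN trans]) (rule derivative_intros fib base[OF assms(2) that] refl | simp add: algebra_simps inner_commute)+
  have two: "dd w (dd w (fibre_quad \<Phi>)) y = exp (\<Phi> z) *
      (2 * (w $ Inr 1 \<bullet> w $ Inr 1) + 4 * (y $ Inr 1 \<bullet> w $ Inr 1) * dd (base_part w) \<Phi> z
       + (y $ Inr 1 \<bullet> y $ Inr 1) * ((dd (base_part w) \<Phi> z)\<^sup>2 + dd (base_part w) (dd (base_part w) \<Phi>) z))" for w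
  proof -
    have "dd w (dd w (fibre_quad \<Phi>)) y = dd w (\<lambda>x. exp (\<Phi> (base_part x)) *
      (2 * (x $ Inr 1 \<bullet> w $ Inr 1) + (x $ Inr 1 \<bullet> x $ Inr 1) * dd (base_part w) \<Phi> (base_part x))) y"
      by (rule dd_cong[OF oD yD one])
    also have "\<dots> = exp (\<Phi> z) *
      (2 * (w $ Inr 1 \<bullet> w $ Inr 1) + 4 * (y $ Inr 1 \<bullet> w $ Inr 1) * dd (base_part w) \<Phi> z
       + (y $ Inr 1 \<bullet> y $ Inr 1) * ((dd (base_part w) \<Phi> z)\<^sup>2 + dd (base_part w) (dd (base_part w) \<Phi>) z))"
      unfolding z_def
      by (rule dd_eqI[THEN trans]) (rule derivative_intros fib base[OF assms(2) yD] base[OF smooth_on_dd[OF assms(2)] yD] refl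
         | simp add: algebra_simps inner_commute power2_eq_square)+
    finally show ?thesis .
  qed
  show ?thesis
    unfolding lap_def two base_part_cmult v_def
    unfolding cmod_power2 inner_complex_def
    by (simp add: algebra_simps power2_eq_square)
qed

section \<open>Flattening a strictly plurisubharmonic function near a point\<close>

lemma complex_homogeneous:
  fixes L :: "complex^'k \<Rightarrow> complex"
  assumes "linear L" "\<And>v. L (\<i> *s v) = \<i> * L v" shows "L (c *s v) = c * L v"
proof -
  have "c *s v = Re c *\<^sub>R v + Im c *\<^sub>R (\<i> *s v)" by (simp add: vec_eq_iff complex_eq_iff algebra_simps)
  then have "L (c *s v) = Re c *\<^sub>R L v + Im c *\<^sub>R (\<i> * L v)"
    by (simp add: linear_add[OF assms(1)] linear_cmul[OF assms(1)] assms(2))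
  then show ?thesis by (simp add: complex_eq_iff algebra_simps)
qed

text \<open>\<open>Re G\<close> is the pluriharmonic part of the second order Taylor polynomial of \<open>\<phi>\<close> at \<open>z0\<close>; its complement is the Levi form.\<close>

lemma remove_pluriharmonic_jet:
  fixes \<phi> :: "complex^'m \<Rightarrow> real"
  assumes \<Omega>: "open \<Omega>" "z0 \<in> \<Omega>" "smooth_on \<Omega> \<phi>"
  obtains G where "holo_fun G UNIV" "\<phi> z0 = Re (G z0)" "\<And>w. dd w (\<lambda>z. \<phi> z - Re (G z)) z0 = 0"
    "\<And>w. dd w (dd w (\<lambda>z. \<phi> z - Re (G z))) z0 = lap \<phi> z0 w / 2"
proof -
  define H where "H = (\<lambda>a b. dd a (dd b \<phi>) z0)"
  have H1: "linear (\<lambda>a. H a b)" and H2: "linear (\<lambda>b. H a b)" for a b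
    unfolding H_def using dd_linear[OF smooth_on_dd[OF \<Omega>(3)] \<Omega>(2)] linear_dd_dd[OF \<Omega>(1,3,2)] by auto
  note lin1 = dd_linear[OF \<Omega>(3,2)]
  have ii: "\<i> *s (\<i> *s v) = - (v :: complex^'m)" and iadd: "\<i> *s (u + v) = \<i> *s u + \<i> *s (v :: complex^'m)"
    and iscale: "\<i> *s (r *\<^sub>R v) = r *\<^sub>R (\<i> *s (v :: complex^'m))" for u v r
    by (simp_all add: vec_eq_iff algebra_simps)
  note lins = linear_add[OF H1] linear_add[OF H2] linear_neg[OF H1] linear_neg[OF H2]
    linear_cmul[OF H1] linear_cmul[OF H2] linear_add[OF lin1] linear_neg[OF lin1] linear_cmul[OF lin1]
  \<comment> \<open>\<open>A\<close> is the complex linear form whose real part is the differential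
    of \<phi>; \<open>B\<close> is the complex bilinear form whose real part on (w, w) is H w w - H
    (\<i> w) (\<i> w).\<close>
  define A where "A = (\<lambda>w. complex_of_real (dd w \<phi> z0) - \<i> * complex_of_real (dd (\<i> *s w) \<phi> z0))"
  define B where "B = (\<lambda>a b. complex_of_real (H a b - H (\<i> *s a) (\<i> *s b)) -
      \<i> * complex_of_real (H a (\<i> *s b) + H (\<i> *s a) b))"
  have A: "linear A" unfolding A_def
    by (rule linearI) (simp_all add: iadd iscale lins complex_eq_iff algebra_simps)
  have A_i: "A (\<i> *s v) = \<i> * A v" for v
    unfolding A_def by (simp add: ii lins complex_eq_iff)
  have B: "bilinear B" unfolding bilinear_def B_def
    by (auto intro!: linearI simp: iadd iscale lins complex_eq_iff algebra_simps)
  have B1: "B (\<i> *s a) b = \<i> * B a b" and B2: "B a (\<i> *s b) = \<i> * B a b" for a b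
    unfolding B_def by (simp_all add: ii lins complex_eq_iff)
  have bB: "bounded_bilinear B" using B by (simp add: bilinear_conv_bounded_bilinear)
  have bA: "bounded_linear A" using A by (simp add: linear_conv_bounded_linear)
  \<comment> \<open>The factor 1/4 makes the second derivative of Re \<open>G\<close> along w equal
    to (H w w - H (\<i> w) (\<i> w)) / 2. Subtracting it from H w w leaves half of the
    Laplacian.\<close>
  define G where "G = (\<lambda>z. complex_of_real (\<phi> z0) + A (z - z0) + B (z - z0) (z - z0) / 4)"
  define L where "L = (\<lambda>z v. A v + (B (z - z0) v + B v (z - z0)) / 4)"
  have sub: "((\<lambda>z. z - z0) has_derivative (\<lambda>h. h)) (at z)" for z
    by (auto intro!: derivative_eq_intros)
  have dG: "(G has_derivative L z) (at z)" for z
  proof -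
    have "(G has_derivative (\<lambda>h. 0 + A h + (B (z - z0) h + B h (z - z0)) / 4)) (at z)"
      unfolding G_def
      by (intro has_derivative_add has_derivative_const bounded_linear.has_derivative[OF bA sub]
          bounded_linear.has_derivative[OF bounded_linear_divide bounded_bilinear.FDERIV[OF bB sub sub]])
    then show ?thesis by (simp add: L_def[abs_def])
  qed
  have linB1: "linear (\<lambda>a. B a b)" and linB2: "linear (\<lambda>b. B a b)" for a b
    using B by (auto simp: bilinear_def)
  have L_lin: "L z (c *s v) = c * L z v" for z c v
    unfolding L_def using complex_homogeneous[OF A A_i] complex_homogeneous[OF linB1 B1] complex_homogeneous[OF linB2 B2]
    by (simp add: algebra_simps)
  have hG: "holo_fun G UNIV" by (rule holo_funI[OF dG L_lin])
  have ddG: "dd w G = (\<lambda>z. L z w)" for w using dd_eqI[OF dG] by auto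
  have "((\<lambda>z. L z w) has_derivative (\<lambda>h. 0 + (B h w + B w h) / 4)) (at z0)" for w
    unfolding L_def
    by (intro has_derivative_add has_derivative_const bounded_linear.has_derivative[OF bounded_linear_divide]
        bounded_linear.has_derivative[OF bounded_bilinear.bounded_linear_left[OF bB] sub]
        bounded_linear.has_derivative[OF bounded_bilinear.bounded_linear_right[OF bB] sub])
  then have ddG2: "dd w (dd w G) z0 = B w w / 2" for w
    unfolding ddG by (subst dd_eqI) auto
  have sG: "smooth_on \<Omega> G" by (rule smooth_on_subset[OF holo_fun_smooth[OF open_UNIV hG]]) simp
  define N where "N = (\<lambda>z. - Re (G z))"
  have bN: "bounded_linear (\<lambda>z. - Re z)" by (intro bounded_linear_minus bounded_linear_Re)
  have sN: "smooth_on \<Omega> N" unfolding N_def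
    by (rule smooth_on_compose[OF \<Omega>(1) open_UNIV _ smooth_on_bounded_linear[OF bN] sG]) simp
  have eq: "(\<lambda>z. \<phi> z - Re (G z)) = (\<lambda>z. \<phi> z + N z)" by (simp add: N_def)
  have linz: "A 0 = 0" "B 0 w = 0" "B w 0 = 0" for w
    using linear_0[OF A] linear_0[OF linB1] linear_0[OF linB2] by auto
  show ?thesis
  proof (rule that[OF hG])
    show "\<phi> z0 = Re (G z0)" by (simp add: G_def linz)
    fix w
    have "dd w N z0 = - Re (L z0 w)"
      unfolding N_def using dd_comp_linear[OF bN sG \<Omega>(2)] by (simp add: ddG)
    also have "\<dots> = - dd w \<phi> z0" by (simp add: L_def linz A_def)
    finally show "dd w (\<lambda>z. \<phi> z - Re (G z)) z0 = 0"
      unfolding eq by (subst dd_eqI[OF has_derivative_add[OF dd_has_derivative[OF \<Omega>(3,2)] dd_has_derivative[OF sN \<Omega>(2)]]]) simp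
    have "dd w (dd w N) z0 = - Re (B w w / 2)"
      unfolding N_def using dd_dd_comp_linear[OF bN sG \<Omega>(2,1)] by (simp add: ddG2)
    then show "dd w (dd w (\<lambda>z. \<phi> z - Re (G z))) z0 = lap \<phi> z0 w / 2"
      unfolding eq dd_dd_add[OF \<Omega>(1,3) sN \<Omega>(2)] by (simp add: B_def H_def lap_def field_simps)
  qed
qed

text \<open>Compactness of the unit sphere turns positivity of the second derivatives at
  \<open>z0\<close> into positivity on one ball for all directions. Along each ray from
  \<open>z0\<close> the first derivative then becomes positive, and after it the function.\<close>

lemma positive_near_critical_point:
  fixes \<psi> :: "complex^'m \<Rightarrow> real"
  assumes \<Omega>: "open \<Omega>" "z0 \<in> \<Omega>" "smooth_on \<Omega> \<psi>"
    and z: "\<psi> z0 = 0" "\<And>w. dd w \<psi> z0 = 0" "\<And>w. w \<noteq> 0 \<Longrightarrow> dd w (dd w \<psi>) z0 > 0"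
  obtains R where "R > 0" "cball z0 R \<subseteq> \<Omega>" "\<And>z. z \<in> cball z0 R \<Longrightarrow> z \<noteq> z0 \<Longrightarrow> \<psi> z > 0"
proof -
  obtain R1 where R1: "R1 > 0" "cball z0 R1 \<subseteq> \<Omega>" using \<Omega>(1,2) open_contains_cball by blast
  define q where "q = (\<lambda>(z, w). dd w (dd w \<psi>) z)"
  define K where "K = cball z0 R1 \<times> sphere (0 :: complex^'m) 1"
  have cq: "continuous_on K q"
    unfolding q_def split_beta K_def
    by (intro continuous_on_dd_dd[OF \<Omega>(1,3)] continuous_intros) (use R1(2) in auto)
  have "compact K" unfolding K_def by (intro compact_Times compact_cball compact_sphere)
  then have uq: "uniformly_continuous_on K q" using cq by (rule compact_uniformly_continuous[rotated])
  have ne: "sphere (0 :: complex^'m) 1 \<noteq> {}" using nonempty_Basis norm_Basis by (metis all_not_in_conv mem_sphere_0)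
  have "continuous_on (sphere 0 1) (\<lambda>w. q (z0, w))"
    by (rule continuous_on_compose2[OF cq]) (use R1 in \<open>auto simp: K_def intro!: continuous_intros\<close>)
  then obtain w0 where w0: "w0 \<in> sphere (0 :: complex^'m) 1" "\<And>w. w \<in> sphere 0 1 \<Longrightarrow> q (z0, w0) \<le> q (z0, w)"
    using continuous_attains_inf[OF compact_sphere ne] by blast
  define m0 where "m0 = q (z0, w0)"
  have "w0 \<noteq> 0" using w0(1) by auto
  then have m0: "m0 > 0" using z(3)[of w0] by (simp add: m0_def q_def)
  \<comment> \<open>The tolerance is the minimum \<open>m0\<close> of the second derivatives over
    unit directions at \<open>z0\<close>, so they stay positive at distance less than
    \<open>d\<close>.\<close>
  obtain d where d: "d > 0" "\<And>x y. x \<in> K \<Longrightarrow> y \<in> K \<Longrightarrow> dist y x < d \<Longrightarrow> dist (q y) (q x) < m0"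
    using uq m0 unfolding uniformly_continuous_on_def by meson
  define R where "R = min R1 (d / 2)"
  have R: "R > 0" "R \<le> R1" "R < d" using R1 d(1) by (auto simp: R_def)
  have qpos: "q (z, w) > 0" if "z \<in> cball z0 R" "norm w = 1" for z w
  proof -
    have "dist (q (z, w)) (q (z0, w)) < m0"
      by (rule d(2)) (use that R R1 in \<open>auto simp: K_def dist_Pair_Pair dist_commute\<close>)
    moreover have "m0 \<le> q (z0, w)" using w0(2)[of w] that by (simp add: m0_def)
    ultimately show ?thesis by (simp add: dist_real_def)
  qed
  show ?thesis
  proof (rule that[OF R(1)])
    show "cball z0 R \<subseteq> \<Omega>" using R1(2) R(2) by auto
    fix x assume x: "x \<in> cball z0 R" "x \<noteq> z0"
    define t where "t = norm (x - z0)"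
    define w where "w = (1 / t) *\<^sub>R (x - z0)"
    have t: "t > 0" "t \<le> R" using x by (auto simp: t_def dist_norm norm_minus_commute)
    have w: "norm w = 1" "x = z0 + t *\<^sub>R w" using t by (auto simp: w_def t_def)
    have inb: "z0 + s *\<^sub>R w \<in> cball z0 R" if "0 \<le> s" "s \<le> t" for s
      using that t w(1) by (simp add: dist_norm)
    have in\<Omega>: "z0 + s *\<^sub>R w \<in> \<Omega>" if "0 \<le> s" "s \<le> t" for s using inb[OF that] R1(2) R(2) by auto
    have line: "((\<lambda>s. z0 + s *\<^sub>R w) has_derivative (\<lambda>h. h *\<^sub>R w)) (at s)" for s
      by (auto intro!: derivative_eq_intros)
    have d: "((\<lambda>s. f (z0 + s *\<^sub>R w)) has_real_derivative dd w f (z0 + s *\<^sub>R w)) (at s)"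
      if "smooth_on \<Omega> f" "0 \<le> s" "s \<le> t" for f :: "complex^'m \<Rightarrow> real" and s
      using has_derivative_compose[OF line dd_has_derivative[OF that(1) in\<Omega>[OF that(2,3)]]]
      unfolding has_field_derivative_def dd_scaleR[OF that(1) in\<Omega>[OF that(2,3)]] by (simp add: mult_commute_abs)
    have pos1: "dd w \<psi> (z0 + s *\<^sub>R w) > 0" if s: "0 < s" "s \<le> t" for s
    proof -
      have "(\<lambda>s. dd w \<psi> (z0 + s *\<^sub>R w)) 0 < (\<lambda>s. dd w \<psi> (z0 + s *\<^sub>R w)) s"
      proof (rule DERIV_pos_imp_increasing[where f = "\<lambda>s. dd w \<psi> (z0 + s *\<^sub>R w)", OF s(1)])
        fix u assume "0 \<le> u" "u \<le> s"
        then have u: "0 \<le> u" "u \<le> t" using s by auto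
        show "\<exists>y. ((\<lambda>s. dd w \<psi> (z0 + s *\<^sub>R w)) has_real_derivative y) (at u) \<and> 0 < y"
          using d[OF smooth_on_dd[OF \<Omega>(3)] u, of w] qpos[OF inb[OF u] w(1)] by (auto simp: q_def)
      qed
      then show ?thesis using z(2) by simp
    qed
    have "(\<lambda>s. \<psi> (z0 + s *\<^sub>R w)) 0 < (\<lambda>s. \<psi> (z0 + s *\<^sub>R w)) t"
    proof (rule DERIV_pos_imp_increasing_open[where f = "\<lambda>s. \<psi> (z0 + s *\<^sub>R w)", OF t(1)])
      fix u assume u: "0 < u" "u < t"
      then show "\<exists>y. ((\<lambda>s. \<psi> (z0 + s *\<^sub>R w)) has_real_derivative y) (at u) \<and> 0 < y"
        using d[OF \<Omega>(3), of u] pos1[of u] by auto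
    next
      show "continuous_on {0..t} (\<lambda>s. \<psi> (z0 + s *\<^sub>R w))"
        by (intro continuous_on_compose2[OF smooth_on_imp_continuous_on[OF \<Omega>(3)]] continuous_intros)
          (use in\<Omega> in auto)
    qed
    then show "\<psi> x > 0" using z(1) w(2) by simp
  qed
qed

lemma lap_compose_real:
  assumes \<theta>: "smooth_on UNIV \<theta>" "\<And>t. (\<theta> has_real_derivative \<theta>' t) (at t)" "\<And>t. (\<theta>' has_real_derivative \<theta>'' t) (at t)"
    and g: "open D" "smooth_on D g" "z \<in> D"
  shows "lap (\<lambda>z. \<theta> (g z)) z v = \<theta>' (g z) * lap g z v + \<theta>'' (g z) * ((dd v g z)\<^sup>2 + (dd (\<i> *s v) g z)\<^sup>2)"
proof -
  have 1: "dd h \<theta> = (\<lambda>t. \<theta>' t * h)" for h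
    using dd_eqI[OF \<theta>(2)[unfolded has_field_derivative_def]] by auto
  have "((\<lambda>t. \<theta>' t * h) has_derivative (\<lambda>k. \<theta>'' t * k * h)) (at t)" for h t
    by (rule has_derivative_mult_left[OF \<theta>(3)[unfolded has_field_derivative_def]])
  then have 2: "dd h (dd h \<theta>) t = \<theta>'' t * h\<^sup>2" for h t
    unfolding 1 using dd_eqI[of "\<lambda>t. \<theta>' t * h" "\<lambda>k. \<theta>'' t * k * h" t h] by (simp add: power2_eq_square)
  show ?thesis
    unfolding lap_def dd_dd_compose[OF open_UNIV \<theta>(1) subset_UNIV g] 2 unfolding 1
    by (simp add: algebra_simps)
qed

lemma lap_norm_sq:
  "lap (\<lambda>z. a * (norm (z - z0))\<^sup>2 + b) z v = 4 * a * (norm (v :: complex^'m))\<^sup>2"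
proof -
  have s: "((\<lambda>z. z - z0) has_derivative (\<lambda>h. h)) (at z)" for z :: "complex^'m"
    by (auto intro!: derivative_eq_intros)
  have 1: "dd w (\<lambda>z. a * (norm (z - z0))\<^sup>2 + b) = (\<lambda>z. 2 * a * ((z - z0) \<bullet> w))" for w
    unfolding power2_norm_eq_inner
    by (rule ext, rule dd_eqI[THEN trans]) (rule derivative_intros s refl | simp add: inner_commute)+
  have 2: "dd w (\<lambda>z. 2 * a * ((z - z0) \<bullet> w)) z = 2 * a * (w \<bullet> w)" for w
    by (rule dd_eqI[THEN trans]) (rule derivative_intros s refl | simp add: inner_commute)+
  show ?thesis
    unfolding lap_def 1 2 power2_norm_eq_inner[symmetric] norm_cmult_vec by simp
qed

text \<open>A regularised maximum of the potential and of a potential \<open>f1\<close> that is constant near \<open>z0\<close>.\<close>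

lemma local_modification:
  fixes \<phi> :: "complex^'m \<Rightarrow> real"
  assumes \<Omega>: "open \<Omega>" "z0 \<in> \<Omega>" "smooth_on \<Omega> \<phi>"
    and pos: "\<And>z v. z \<in> \<Omega> \<Longrightarrow> v \<noteq> 0 \<Longrightarrow> lap \<phi> z v > 0"
    and \<sigma>: "0 < \<sigma>" "\<sigma> < \<sigma>'" "\<sigma>' < 1"
  obtains r R G \<rho> where "0 < r" "r < R" "cball z0 (2 * R) \<subseteq> \<Omega>" "holo_fun G UNIV" "smooth_on \<Omega> \<rho>"
    "\<And>z. z \<in> cball z0 (2 * R) \<Longrightarrow> z \<notin> cball z0 R \<Longrightarrow> \<rho> z = 0"
    "\<And>z. z \<in> cball z0 (\<sigma> * r) \<Longrightarrow> \<phi> z + \<rho> z = Re (G z)"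
    "\<And>z v. z \<in> \<Omega> \<Longrightarrow> lap (\<lambda>z. \<phi> z + \<rho> z) z v \<ge> 0"
    "\<And>z v. z \<in> \<Omega> \<Longrightarrow> z \<notin> ball z0 (\<sigma>' * r) \<Longrightarrow> v \<noteq> 0 \<Longrightarrow> lap (\<lambda>z. \<phi> z + \<rho> z) z v > 0"
proof -
  obtain G0 where G0: "holo_fun G0 UNIV" "\<phi> z0 = Re (G0 z0)" "\<And>w. dd w (\<lambda>z. \<phi> z - Re (G0 z)) z0 = 0"
    "\<And>w. dd w (dd w (\<lambda>z. \<phi> z - Re (G0 z))) z0 = lap \<phi> z0 w / 2"
    using remove_pluriharmonic_jet[OF \<Omega>] by blast
  define \<psi> where "\<psi> = (\<lambda>z. \<phi> z - Re (G0 z))"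
  have sG: "smooth_on \<Omega> (\<lambda>z. Re (G0 z))"
    by (rule smooth_on_compose[OF \<Omega>(1) open_UNIV _ smooth_on_bounded_linear[OF bounded_linear_Re]
          smooth_on_subset[OF holo_fun_smooth[OF open_UNIV G0(1)]]]) auto
  have s\<psi>: "smooth_on \<Omega> \<psi>" unfolding \<psi>_def by (rule smooth_on_diff[OF \<Omega>(1,3) sG])
  have lap\<psi>: "lap \<psi> z v = lap \<phi> z v" if "z \<in> \<Omega>" for z v
    unfolding \<psi>_def lap_diff[OF \<Omega>(1,3) sG that]
    using lap_Re_holo_fun[OF \<Omega>(1) holo_fun_subset[OF G0(1)] that] by simp
  obtain R0 where R0: "R0 > 0" "cball z0 R0 \<subseteq> \<Omega>" "\<And>z. z \<in> cball z0 R0 \<Longrightarrow> z \<noteq> z0 \<Longrightarrow> \<psi> z > 0"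
  proof (rule positive_near_critical_point[OF \<Omega>(1,2) s\<psi>])
    show "\<psi> z0 = 0" "dd w \<psi> z0 = 0" for w using G0(2,3) by (simp_all add: \<psi>_def)
    show "dd w (dd w \<psi>) z0 > 0" if "w \<noteq> 0" for w
      using G0(4)[of w] pos[OF \<Omega>(2) that] unfolding \<psi>_def by linarith
  qed (rule that)
  \<comment> \<open>A third leaves the ball of radius 2 R well inside the ball on which \<psi> is
    positive off \<open>z0\<close>.\<close>
  define R where "R = R0 / 3"
  have R: "R > 0" "2 * R < R0" using R0(1) by (auto simp: R_def)
  have sub\<Omega>: "cball z0 (2 * R) \<subseteq> \<Omega>" using R0(2) R(2) by auto
  \<comment> \<open>The transition annulus: \<psi> has a positive lower bound \<open>m\<close> on
    it, and the modification has to vanish there.\<close>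
  define K where "K = cball z0 (2 * R) - ball z0 R"
  have "\<exists>m>0. \<forall>z\<in>K. m \<le> \<psi> z"
  proof (cases "K = {}")
    case False
    have "compact K" unfolding K_def by (intro compact_diff compact_cball open_ball)
    moreover have "continuous_on K \<psi>"
      by (rule continuous_on_subset[OF smooth_on_imp_continuous_on[OF s\<psi>]]) (use sub\<Omega> in \<open>auto simp: K_def\<close>)
    ultimately obtain y where "y \<in> K" "\<And>z. z \<in> K \<Longrightarrow> \<psi> y \<le> \<psi> z"
      using continuous_attains_inf[OF _ False] by blast
    moreover have "\<psi> y > 0" if "y \<in> K" for y
      by (rule R0(3)) (use that R in \<open>auto simp: K_def\<close>)
    ultimately show ?thesis by blast
  qed (auto intro: exI[of _ 1])
  then obtain m where m: "m > 0" "\<And>z. z \<in> K \<Longrightarrow> m \<le> \<psi> z" by blast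
  have "isCont \<psi> z0"
    using smooth_on_imp_continuous_on[OF s\<psi>] \<Omega>(1,2) continuous_on_eq_continuous_at by blast
  moreover have "\<psi> z0 = 0" using G0(2) by (simp add: \<psi>_def)
  \<comment> \<open>Near \<open>z0\<close> the potential \<psi> is below m/4, hence by more than m/4
    below the level m/2 at which \<open>f1\<close> is constant.\<close>
  ultimately obtain d where d: "d > 0" "\<And>z. dist z z0 < d \<Longrightarrow> \<psi> z < m / 4"
    unfolding continuous_at_eps_delta using m(1)
    by (metis abs_less_iff diff_zero dist_real_def zero_less_divide_iff zero_less_numeral)
  \<comment> \<open>The radius of the embedded ball: smaller than \<open>R\<close>, to stay off the
    annulus, and smaller than \<open>d\<close>, to keep \<psi> < m/4.\<close>
  define r where "r = min (R / 2) (d / 2)"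
  have r: "r > 0" "r < R" "r < d" using R d(1) by (auto simp: r_def)
  obtain \<theta> \<theta>' \<theta>'' :: "real \<Rightarrow> real" and c where \<theta>: "smooth_on UNIV \<theta>"
    "\<And>t. (\<theta> has_real_derivative \<theta>' t) (at t)" "\<And>t. (\<theta>' has_real_derivative \<theta>'' t) (at t)"
    and \<theta>': "\<And>t. 0 \<le> \<theta>' t" "\<And>t. \<theta>' t \<le> 1" and \<theta>'': "\<And>t. 0 \<le> \<theta>'' t" and \<theta>'_pos: "\<And>t. 0 < t \<Longrightarrow> 0 < \<theta>' t"
    and \<theta>_vals: "\<And>t. t \<le> 0 \<Longrightarrow> \<theta> t = 0" "\<And>t. 1 \<le> t \<Longrightarrow> \<theta> t = t - c" "\<And>t. 0 \<le> t \<Longrightarrow> \<theta> t \<le> t"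
    using exists_smooth_convex_ramp by blast
  \<comment> \<open>On the ball of radius 2 R the argument \<open>s\<close> is at most (2 R)^2 /
    r^2. As \<theta> t \<le> t there, this choice keeps \<kappa> \<theta>(s) below m/4, so that
    \<open>f1\<close> \<le> 3 m/4 < m \<le> \<psi> on the annulus.\<close>
  define \<kappa> where "\<kappa> = (m / 4) / ((2 * R)\<^sup>2 / r\<^sup>2)"
  have \<kappa>: "\<kappa> > 0" using m(1) R(1) r(1) by (simp add: \<kappa>_def)
  define s where "s = (\<lambda>z. (1 / r\<^sup>2) * (norm (z - z0))\<^sup>2 + (- \<sigma>\<^sup>2))"
  define f1 where "f1 = (\<lambda>z. m / 2 + \<kappa> * \<theta> (s z))"
  \<comment> \<open>The width of the regularisation. Near \<open>z0\<close> the gap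
    \<open>f1\<close> - \<psi> exceeds m/4, so there \<open>g\<close> > 1 and \<theta> is in its
    affine range.\<close>
  define \<delta> where "\<delta> = m / 4"
  have \<delta>: "\<delta> > 0" using m(1) by (simp add: \<delta>_def)
  define g where "g = (\<lambda>z. (1 / \<delta>) * (f1 z - \<psi> z))"
  \<comment> \<open>\<psi> + \<rho> is the regularised maximum: it equals \<psi> where
    \<open>f1\<close> \<le> \<psi>, and \<open>f1\<close> - \<delta> c where \<open>f1\<close> \<ge>
    \<psi> + \<delta>.\<close>
  define \<rho> where "\<rho> = (\<lambda>z. \<delta> * \<theta> (g z))"
  have smooth_norm: "smooth_on \<Omega> (\<lambda>z. (norm (z - z0))\<^sup>2)"
    unfolding power2_norm_eq_inner
    by (intro smooth_on_bilinear[OF \<Omega>(1) bounded_bilinear_inner] smooth_on_diff \<Omega>(1) smooth_on_const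
        smooth_on_bounded_linear bounded_linear_ident)
  have ss: "smooth_on \<Omega> s" unfolding s_def
    by (intro smooth_on_add smooth_on_mult smooth_on_const \<Omega>(1) smooth_norm)
  have s\<theta>s: "smooth_on \<Omega> (\<lambda>z. \<theta> (s z))" by (rule smooth_on_compose[OF \<Omega>(1) open_UNIV _ \<theta>(1) ss]) simp
  have sf1: "smooth_on \<Omega> f1" unfolding f1_def
    by (intro smooth_on_add smooth_on_mult smooth_on_const \<Omega>(1) s\<theta>s)
  have sg: "smooth_on \<Omega> g" unfolding g_def
    by (intro smooth_on_mult smooth_on_diff smooth_on_const \<Omega>(1) sf1 s\<psi>)
  have s\<theta>g: "smooth_on \<Omega> (\<lambda>z. \<theta> (g z))" by (rule smooth_on_compose[OF \<Omega>(1) open_UNIV _ \<theta>(1) sg]) simp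
  have s\<rho>: "smooth_on \<Omega> \<rho>" unfolding \<rho>_def by (intro smooth_on_mult smooth_on_const \<Omega>(1) s\<theta>g)
  \<comment> \<open>The \<theta>'' term is dropped. The bound that remains is strictly positive for
    v \<noteq> 0 as soon as s > 0, that is, outside the closed ball of radius \<sigma> r.\<close>
  have lapf1: "lap f1 z v \<ge> \<kappa> * \<theta>' (s z) * (4 * (1 / r\<^sup>2) * (norm v)\<^sup>2)" if "z \<in> \<Omega>" for z v
  proof -
    have "lap f1 z v = lap (\<lambda>z. m / 2) z v + \<kappa> * lap (\<lambda>z. \<theta> (s z)) z v"
      unfolding f1_def lap_add[OF \<Omega>(1) smooth_on_const smooth_on_mult[OF \<Omega>(1) smooth_on_const s\<theta>s] that]
        lap_cmult[OF \<Omega>(1) s\<theta>s that] ..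
    moreover have "lap (\<lambda>z. m / 2) z v = 0"
      by (simp add: lap_def dd_def[abs_def])
    moreover have le: "lap (\<lambda>z. \<theta> (s z)) z v \<ge> \<theta>' (s z) * (4 * (1 / r\<^sup>2) * (norm v)\<^sup>2)"
      unfolding lap_compose_real[OF \<theta> \<Omega>(1) ss that] unfolding s_def lap_norm_sq using \<theta>''
      by simp
    ultimately show ?thesis using mult_left_mono[OF le less_imp_le[OF \<kappa>]] by (simp only: mult.assoc add_0)
  qed
  \<comment> \<open>The convex combination with weights 1 - \<theta>'(g) and \<theta>'(g). It
    contains \<phi> instead of \<psi> because the two differ by a pluriharmonic function.\<close>
  have main: "lap (\<lambda>z. \<phi> z + \<rho> z) z v \<ge> (1 - \<theta>' (g z)) * lap \<phi> z v + \<theta>' (g z) * lap f1 z v" if "z \<in> \<Omega>" for z v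
  proof -
    have "lap \<rho> z v = \<delta> * lap (\<lambda>z. \<theta> (g z)) z v"
      unfolding \<rho>_def by (rule lap_cmult[OF \<Omega>(1) s\<theta>g that])
    also have "\<dots> \<ge> \<delta> * (\<theta>' (g z) * lap g z v)"
      unfolding lap_compose_real[OF \<theta> \<Omega>(1) sg that] using \<delta> \<theta>'' by simp
    also have "\<delta> * (\<theta>' (g z) * lap g z v) = \<theta>' (g z) * (lap f1 z v - lap \<phi> z v)"
      unfolding g_def lap_cmult[OF \<Omega>(1) smooth_on_diff[OF \<Omega>(1) sf1 s\<psi>] that] lap_diff[OF \<Omega>(1) sf1 s\<psi> that] lap\<psi>[OF that]
      using \<delta> by simp
    finally show ?thesis unfolding lap_add[OF \<Omega>(1,3) s\<rho> that] by (simp add: algebra_simps)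
  qed
  have lapf1_nn: "lap f1 z v \<ge> 0" if "z \<in> \<Omega>" for z v
  proof -
    have "0 \<le> \<kappa> * \<theta>' (s z) * (4 * (1 / r\<^sup>2) * (norm v)\<^sup>2)" using \<kappa> \<theta>' by simp
    then show ?thesis using lapf1[OF that, of v] by linarith
  qed
  have lap\<phi>_nn: "lap \<phi> z v \<ge> 0" if "z \<in> \<Omega>" for z v
  proof (cases "v = 0")
    case True then show ?thesis using dd_zero[OF smooth_on_dd[OF \<Omega>(3)] that] by (simp add: lap_def)
  qed (use pos[OF that] in \<open>auto intro: less_imp_le\<close>)
  show ?thesis
  proof (rule that[OF r(1,2) sub\<Omega> _ s\<rho>])
    \<comment> \<open>The constant is the value of the regularised maximum where \<open>f1\<close>
      wins and is still flat: \<open>f1\<close> - \<delta> c with \<open>f1\<close> = m/2.\<close>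
    show "holo_fun (\<lambda>z. G0 z + of_real (m / 2 - \<delta> * c)) UNIV"
    proof (rule holo_funI)
      show "((\<lambda>z. G0 z + of_real (m / 2 - \<delta> * c)) has_derivative (\<lambda>v. dd v G0 z)) (at z)" for z
        using has_derivative_add[OF holo_fun_has_derivative[OF G0(1) UNIV_I] has_derivative_const] by simp
      show "dd (c *s v) G0 z = c * dd v G0 z" for z c v
        using G0(1) by (simp add: holo_fun_def)
    qed
  next
    fix z assume z: "z \<in> cball z0 (2 * R)" "z \<notin> cball z0 R"
    have "(norm (z - z0))\<^sup>2 \<le> (2 * R)\<^sup>2" using z(1) by (intro power_mono) (auto simp: dist_norm norm_minus_commute)
    then have "(1 / r\<^sup>2) * (norm (z - z0))\<^sup>2 \<le> (2 * R)\<^sup>2 / r\<^sup>2" by (simp add: divide_right_mono)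
    then have s_le: "s z \<le> (2 * R)\<^sup>2 / r\<^sup>2" unfolding s_def by (smt (verit) zero_le_power2)
    have "\<theta> (s z) \<le> (2 * R)\<^sup>2 / r\<^sup>2"
    proof (cases "s z \<ge> 0")
      case True then show ?thesis using \<theta>_vals(3)[OF True] s_le by linarith
    next
      case False then show ?thesis using \<theta>_vals(1)[of "s z"] by simp
    qed
    then have "\<kappa> * \<theta> (s z) \<le> \<kappa> * ((2 * R)\<^sup>2 / r\<^sup>2)"
      by (rule mult_left_mono[OF _ less_imp_le[OF \<kappa>]])
    also have "\<dots> = m / 4" unfolding \<kappa>_def using R(1) r(1) by simp
    finally have "f1 z \<le> 3 * m / 4" unfolding f1_def by linarith
    moreover have "m \<le> \<psi> z" by (rule m(2)) (use z in \<open>auto simp: K_def\<close>)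
    ultimately have "g z \<le> 0" unfolding g_def using m(1) \<delta> by (simp add: field_simps)
    then show "\<rho> z = 0" unfolding \<rho>_def by (simp add: \<theta>_vals(1))
  next
    fix z assume z: "z \<in> cball z0 (\<sigma> * r)"
    have "norm (z - z0) \<le> \<sigma> * r" using z by (simp add: dist_norm norm_minus_commute)
    then have "(norm (z - z0))\<^sup>2 \<le> (\<sigma> * r)\<^sup>2" by (intro power_mono) auto
    then have "s z \<le> 0" unfolding s_def using r(1) by (simp add: field_simps power_mult_distrib)
    then have f1z: "f1 z = m / 2" by (simp add: f1_def \<theta>_vals(1))
    have "\<sigma> * r \<le> 1 * r" using \<sigma> r by (intro mult_right_mono) auto
    moreover have "dist z z0 \<le> \<sigma> * r" using z by (simp add: dist_commute)
    ultimately have "dist z z0 < d" using r(3) by linarith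
    then have "\<psi> z < m / 4" by (rule d(2))
    then have "g z \<ge> 1" unfolding g_def f1z \<delta>_def using m(1) by (simp add: field_simps)
    then have "\<rho> z = \<delta> * (g z - c)" unfolding \<rho>_def by (simp add: \<theta>_vals(2))
    also have "\<dots> = f1 z - \<psi> z - \<delta> * c" unfolding g_def using \<delta> by (simp add: algebra_simps)
    finally show "\<phi> z + \<rho> z = Re (G0 z + of_real (m / 2 - \<delta> * c))"
      unfolding f1z by (simp add: \<psi>_def)
  next
    fix z v assume z: "z \<in> \<Omega>"
    have "0 \<le> (1 - \<theta>' (g z)) * lap \<phi> z v + \<theta>' (g z) * lap f1 z v"
      using lap\<phi>_nn[OF z] lapf1_nn[OF z] \<theta>' by (intro add_nonneg_nonneg mult_nonneg_nonneg) auto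
    then show "lap (\<lambda>z. \<phi> z + \<rho> z) z v \<ge> 0" using main[OF z, of v] by linarith
  next
    fix z v assume z: "z \<in> \<Omega>" "z \<notin> ball z0 (\<sigma>' * r)" and v: "v \<noteq> (0 :: complex^'m)"
    have "\<sigma>' * r \<le> norm (z - z0)" using z(2) by (simp add: dist_norm norm_minus_commute)
    moreover have "\<sigma> * r < \<sigma>' * r" using \<sigma> r by simp
    ultimately have "\<sigma> * r < norm (z - z0)" by linarith
    then have "(\<sigma> * r)\<^sup>2 < (norm (z - z0))\<^sup>2" using \<sigma>(1) r(1) by (intro power_strict_mono) auto
    then have "s z > 0" unfolding s_def using r(1) by (simp add: field_simps power_mult_distrib)
    then have "0 < \<kappa> * \<theta>' (s z) * (4 * (1 / r\<^sup>2) * (norm v)\<^sup>2)" using \<kappa> \<theta>'_pos v r(1) by simp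
    then have f: "lap f1 z v > 0" using lapf1[OF z(1), of v] by linarith
    have p: "lap \<phi> z v > 0" by (rule pos[OF z(1) v])
    \<comment> \<open>The weights are nonnegative with sum 1 and both Laplacians are positive, so
      whichever weight is nonzero gives strictness.\<close>
    have "0 < (1 - \<theta>' (g z)) * lap \<phi> z v + \<theta>' (g z) * lap f1 z v"
    proof (cases "\<theta>' (g z) = 0")
      case False
      then have "\<theta>' (g z) * lap f1 z v > 0" using \<theta>'(1)[of "g z"] f by simp
      moreover have "(1 - \<theta>' (g z)) * lap \<phi> z v \<ge> 0" using \<theta>'(2)[of "g z"] p by simp
      ultimately show ?thesis by linarith
    qed (use p in simp)
    then show "lap (\<lambda>z. \<phi> z + \<rho> z) z v > 0" using main[OF z(1), of v] by linarith
  qed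
qed

section \<open>Charts of manifolds and line bundles\<close>

lemma atlas_chart:
  assumes "holomorphic_atlas A" "(U, \<phi>) \<in> A"
  shows "inj_on \<phi> U" "open (\<phi> ` U)"
  using assms unfolding holomorphic_atlas_def by auto

lemma atlas_transition:
  assumes "holomorphic_atlas A" "(U, \<phi>) \<in> A" "(V, \<psi>) \<in> A"
  shows "vec_holomorphic_on (\<lambda>z. \<psi> (inv_into U \<phi> z)) (\<phi> ` (U \<inter> V))"
proof -
  have "\<forall>(V, \<psi>)\<in>A. vec_holomorphic_on (\<psi> \<circ> inv_into U \<phi>) (\<phi> ` (U \<inter> V))"
    using assms(1,2) unfolding holomorphic_atlas_def by auto
  then have "vec_holomorphic_on (\<psi> \<circ> inv_into U \<phi>) (\<phi> ` (U \<inter> V))" using assms(3) by auto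
  then show ?thesis by (simp add: comp_def)
qed

lemma openin_atlas_image:
  assumes "holomorphic_atlas A" "(U, \<phi>) \<in> A" "openin (manifold_topology A) W"
  shows "open (\<phi> ` (U \<inter> W))"
  using assms(2,3) unfolding openin_manifold_topology[OF assms(1)] by auto

lemma chart_image_eq:
  assumes "inj_on \<phi> U" shows "\<phi> ` (U \<inter> W) = {z \<in> \<phi> ` U. inv_into U \<phi> z \<in> W}"
  using assms by (auto simp: inv_into_f_f)

lemma inv_into_inter:
  assumes "inj_on \<phi> U" "z \<in> \<phi> ` (U \<inter> W)" shows "inv_into (U \<inter> W) \<phi> z = inv_into U \<phi> z"
proof -
  obtain x where x: "x \<in> U \<inter> W" "z = \<phi> x" using assms(2) by blast
  have i: "inj_on \<phi> (U \<inter> W)" using assms(1) inj_on_subset by blast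
  show ?thesis unfolding x(2) using inv_into_f_f[OF i x(1)] inv_into_f_f[OF assms(1), of x] x(1) by simp
qed

lemma inv_chart_in:
  assumes "inj_on \<phi> U" "z \<in> \<phi> ` (U \<inter> W)"
  shows "inv_into U \<phi> z \<in> U \<inter> W" "\<phi> (inv_into U \<phi> z) = z"
  using assms by (auto simp: inv_into_f_f)

text \<open>Openness of the domains of the transition maps is part of
  \<open>vec_holomorphic_on\<close>.\<close>

lemma openin_chart_domain:
  assumes "holomorphic_atlas A" "(U, \<phi>) \<in> A" shows "openin (manifold_topology A) U"
proof -
  have "open (\<psi> ` (V \<inter> U))" if "(V, \<psi>) \<in> A" for V \<psi>
    using atlas_transition[OF assms(1) that assms(2)] by (simp add: vec_holomorphic_on_def)
  then show ?thesis
    unfolding openin_manifold_topology[OF assms(1)] using assms(2) by (auto simp: points_def)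
qed

lemma topspace_manifold: "holomorphic_atlas A \<Longrightarrow> topspace (manifold_topology A) = points A"
proof (rule antisym)
  assume A: "holomorphic_atlas A"
  show "topspace (manifold_topology A) \<subseteq> points A"
    using openin_topspace[of "manifold_topology A"] unfolding openin_manifold_topology[OF A] by blast
  show "points A \<subseteq> topspace (manifold_topology A)"
  proof
    fix x assume "x \<in> points A"
    then obtain U \<phi> where U: "(U, \<phi>) \<in> A" "x \<in> U" by (auto simp: points_def)
    show "x \<in> topspace (manifold_topology A)"
      by (rule subsetD[OF openin_subset[OF openin_chart_domain[OF A U(1)]] U(2)])
  qed
qed

text \<open>This supplies the semicontinuity clause of \<open>plurisubharmonic\<close>.\<close>

lemma openin_sublevel_smooth:
  assumes A: "holomorphic_atlas A" "smooth_function A u"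
  shows "openin (manifold_topology A) {p \<in> points A. u p < r}"
  unfolding openin_manifold_topology[OF A(1)]
proof (intro conjI ballI, safe)
  fix U \<phi> assume U: "(U, \<phi>) \<in> A"
  have "smooth_on (\<phi> ` U) (u \<circ> inv_into U \<phi>)" using A(2) U unfolding smooth_function_def by auto
  then have "continuous_on (\<phi> ` U) (u \<circ> inv_into U \<phi>)" by (rule smooth_on_imp_continuous_on)
  then have "open (\<phi> ` U \<inter> (u \<circ> inv_into U \<phi>) -` {..<r})"
    by (rule continuous_open_preimage[OF _ atlas_chart(2)[OF A(1) U] open_lessThan])
  moreover have "\<phi> ` U \<inter> (u \<circ> inv_into U \<phi>) -` {..<r} = \<phi> ` (U \<inter> {p \<in> points A. u p < r})"
    unfolding chart_image_eq[OF atlas_chart(1)[OF A(1) U]] using U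
    by (auto simp: points_def inv_into_f_f[OF atlas_chart(1)[OF A(1) U]] intro!: bexI[of _ "(U, \<phi>)"])
  ultimately show "open (\<phi> ` (U \<inter> {p \<in> points A. u p < r}))" by simp
qed

definition e1 :: "complex^1" where "e1 = axis 1 1"

lemma e1_simps [simp]: "e1 $ i = 1" "axis i 1 = e1"
  by (simp_all add: e1_def axis_def vec_eq_iff num1_eq1)

lemma vec1_scale: "b = b $ 1 *s e1" for b :: "complex^1"
  by (simp add: vec_eq_iff num1_eq1)

text \<open>The inverse of a trivialization on one fibre. As x varies,
  \<open>frame E \<tau> x e1\<close> is the holomorphic frame belonging to \<tau>.\<close>

definition frame :: "('a, 'e, 1) vbundle \<Rightarrow> ('e \<Rightarrow> complex^1) \<Rightarrow> 'a \<Rightarrow> complex^1 \<Rightarrow> 'e" where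
  "frame E \<tau> x b = inv_into (fibre E x) \<tau> b"

lemma triv_props:
  assumes "holomorphic_line_bundle S E" "(U, \<tau>) \<in> trivs E"
  shows "openin (manifold_topology S) U" "U \<subseteq> points S"
    "\<And>x. x \<in> U \<Longrightarrow> bij_betw \<tau> (fibre E x) UNIV"
    "\<And>x v w. x \<in> U \<Longrightarrow> v \<in> fibre E x \<Longrightarrow> w \<in> fibre E x \<Longrightarrow> \<tau> (fadd E v w) = \<tau> v + \<tau> w"
    "\<And>x v c. x \<in> U \<Longrightarrow> v \<in> fibre E x \<Longrightarrow> \<tau> (fscale E c v) = c *s \<tau> v"
proof -
  have 1: "\<forall>(U, \<tau>)\<in>trivs E. openin (manifold_topology S) U \<and>
        (\<forall>x\<in>U. bij_betw \<tau> (fibre E x) UNIV \<and>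
           (\<forall>v\<in>fibre E x. (\<forall>w\<in>fibre E x. \<tau> (fadd E v w) = \<tau> v + \<tau> w) \<and>
              (\<forall>c. \<tau> (fscale E c v) = c *s \<tau> v)))"
    using assms(1) unfolding holomorphic_vector_bundle_def by (elim conjE)
  have 2: "points S = (\<Union>(U, \<tau>)\<in>trivs E. U)"
    using assms(1) unfolding holomorphic_vector_bundle_def by (elim conjE)
  have 3: "openin (manifold_topology S) U \<and>
        (\<forall>x\<in>U. bij_betw \<tau> (fibre E x) UNIV \<and>
           (\<forall>v\<in>fibre E x. (\<forall>w\<in>fibre E x. \<tau> (fadd E v w) = \<tau> v + \<tau> w) \<and>
              (\<forall>c. \<tau> (fscale E c v) = c *s \<tau> v)))"
    using 1 assms(2) by fast
  show "openin (manifold_topology S) U" using 3 by simp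
  show "U \<subseteq> points S" using 2 assms(2) by blast
  show "\<And>x. x \<in> U \<Longrightarrow> bij_betw \<tau> (fibre E x) UNIV" using 3 by simp
  show "\<And>x v w. x \<in> U \<Longrightarrow> v \<in> fibre E x \<Longrightarrow> w \<in> fibre E x \<Longrightarrow> \<tau> (fadd E v w) = \<tau> v + \<tau> w" using 3 by simp
  show "\<And>x v c. x \<in> U \<Longrightarrow> v \<in> fibre E x \<Longrightarrow> \<tau> (fscale E c v) = c *s \<tau> v" using 3 by simp
qed

lemma fibre_closed:
  assumes "holomorphic_line_bundle S E" "x \<in> points S" "v \<in> fibre E x"
  shows "fscale E c v \<in> fibre E x" "w \<in> fibre E x \<Longrightarrow> fadd E v w \<in> fibre E x"
proof -
  have "\<forall>x\<in>points S. \<forall>v\<in>fibre E x. (\<forall>w\<in>fibre E x. fadd E v w \<in> fibre E x) \<and>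
        (\<forall>c. fscale E c v \<in> fibre E x)"
    using assms(1) unfolding holomorphic_vector_bundle_def by (elim conjE)
  then show "fscale E c v \<in> fibre E x" "w \<in> fibre E x \<Longrightarrow> fadd E v w \<in> fibre E x"
    using assms(2,3) by simp_all
qed

lemma frame_props:
  assumes "holomorphic_line_bundle S E" "(U, \<tau>) \<in> trivs E" "x \<in> U"
  shows "frame E \<tau> x b \<in> fibre E x" "\<tau> (frame E \<tau> x b) = b"
    "v \<in> fibre E x \<Longrightarrow> frame E \<tau> x (\<tau> v) = v"
    "frame E \<tau> x (c *s b) = fscale E c (frame E \<tau> x b)"
    "frame E \<tau> x b \<in> total E" "proj E (frame E \<tau> x b) = x"
proof -
  note bij = triv_props(3)[OF assms]
  show fr: "frame E \<tau> x b \<in> fibre E x" for b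
    unfolding frame_def using bij by (metis UNIV_I bij_betw_def inv_into_into)
  show tf: "\<tau> (frame E \<tau> x b) = b" for b
    unfolding frame_def using bij by (metis UNIV_I bij_betw_inv_into_right)
  show ft: "v \<in> fibre E x \<Longrightarrow> frame E \<tau> x (\<tau> v) = v" for v
    unfolding frame_def using bij by (metis bij_betw_inv_into_left)
  have x: "x \<in> points S" using triv_props(2)[OF assms(1,2)] assms(3) by blast
  show "frame E \<tau> x (c *s b) = fscale E c (frame E \<tau> x b)"
    using ft[OF fibre_closed(1)[OF assms(1) x fr[of b], of c]] triv_props(5)[OF assms fr[of b], of c] tf[of b] by simp
  show "frame E \<tau> x b \<in> total E" "proj E (frame E \<tau> x b) = x" using fr[of b] by (auto simp: fibre_def)
qed

text \<open>In rank one a change of trivialization is multiplication by one holomorphic function,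
  the new coordinate of the old frame.\<close>

lemma triv_transition:
  assumes "holomorphic_line_bundle S E" "(U, \<tau>) \<in> trivs E" "(U', \<tau>') \<in> trivs E"
  shows "x \<in> U \<Longrightarrow> x \<in> U' \<Longrightarrow> \<tau>' (frame E \<tau> x b) = b $ 1 *s \<tau>' (frame E \<tau> x e1)"
    "(W, \<phi>) \<in> S \<Longrightarrow> holo_fun (\<lambda>z. \<tau>' (frame E \<tau> (inv_into W \<phi> z) b) $ i) (\<phi> ` (W \<inter> U \<inter> U'))"
proof -
  assume x: "x \<in> U" "x \<in> U'"
  have "\<tau>' (frame E \<tau> x b) = \<tau>' (fscale E (b $ 1) (frame E \<tau> x e1))"
    by (metis vec1_scale frame_props(4)[OF assms(1,2) x(1)])
  then show "\<tau>' (frame E \<tau> x b) = b $ 1 *s \<tau>' (frame E \<tau> x e1)"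
    using triv_props(5)[OF assms(1,3) x(2) frame_props(1)[OF assms(1,2) x(1)]] by simp
next
  assume W: "(W, \<phi>) \<in> S"
  have "\<forall>(U, \<tau>)\<in>trivs E. \<forall>(V, \<tau>')\<in>trivs E. \<forall>(W, \<phi>)\<in>S. \<forall>b.
        vec_holomorphic_on (\<lambda>z. \<tau>' (inv_into (fibre E (inv_into W \<phi> z)) \<tau> b)) (\<phi> ` (W \<inter> U \<inter> V))"
    using assms(1) unfolding holomorphic_vector_bundle_def by (elim conjE)
  from bspec[OF this assms(2), simplified, THEN bspec, OF assms(3), simplified, THEN bspec, OF W, simplified]
  have "vec_holomorphic_on (\<lambda>z. \<tau>' (inv_into (fibre E (inv_into W \<phi> z)) \<tau> b)) (\<phi> ` (W \<inter> U \<inter> U'))" by blast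
  then show "holo_fun (\<lambda>z. \<tau>' (frame E \<tau> (inv_into W \<phi> z) b) $ i) (\<phi> ` (W \<inter> U \<inter> U'))"
    unfolding frame_def by (rule vec_holomorphic_on_components(2))
qed

lemma open_triv_image:
  assumes "holomorphic_atlas S" "holomorphic_line_bundle S E" "(U, \<tau>) \<in> trivs E" "(W, \<phi>) \<in> S"
  shows "open (\<phi> ` (W \<inter> U))"
  by (rule openin_atlas_image[OF assms(1,4) triv_props(1)[OF assms(2,3)]])

section \<open>Charts of the total space of a line bundle\<close>

definition total_dom :: "('a, 'e, 1) vbundle \<Rightarrow> 'a set \<Rightarrow> 'e set" where
  "total_dom E N = {v \<in> total E. proj E v \<in> N}"

definition total_chart ::
  "('a, 'e, 1) vbundle \<Rightarrow> ('a \<Rightarrow> complex^'m) \<Rightarrow> ('e \<Rightarrow> complex^1) \<Rightarrow> 'e \<Rightarrow> complex^('m::finite + 1)" where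
  "total_chart E \<phi> \<tau> v = join (\<phi> (proj E v)) (\<tau> v)"

lemma total_atlas_iff:
  fixes S :: "('a, 'm::finite) atlas" and E :: "('a, 'e, 1) vbundle"
  shows "(X, \<kappa>) \<in> total_atlas S E \<longleftrightarrow>
    (\<exists>W \<phi> U \<tau>. (W, \<phi>) \<in> S \<and> (U, \<tau>) \<in> trivs E \<and> X = total_dom E (W \<inter> U) \<and> \<kappa> = total_chart E \<phi> \<tau>)"
  unfolding total_atlas_def total_dom_def total_chart_def[abs_def] join_def
  by (auto simp: image_iff Bex_def)

context
  fixes S :: "('a, 'm::finite) atlas" and E :: "('a, 'e, 1) vbundle"
    and W :: "'a set" and \<phi> :: "'a \<Rightarrow> complex^'m" and U :: "'a set" and \<tau> :: "'e \<Rightarrow> complex^1"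
  assumes S: "holomorphic_atlas S" and E: "holomorphic_line_bundle S E"
    and W: "(W, \<phi>) \<in> S" and U: "(U, \<tau>) \<in> trivs E"
begin

lemma total_chart_inj: "inj_on (total_chart E \<phi> \<tau>) (total_dom E (W \<inter> U))"
proof (rule inj_onI)
  fix v w assume v: "v \<in> total_dom E (W \<inter> U)" "w \<in> total_dom E (W \<inter> U)"
    and eq: "total_chart E \<phi> \<tau> v = total_chart E \<phi> \<tau> w"
  have "\<phi> (proj E v) = \<phi> (proj E w)" and t: "\<tau> v = \<tau> w"
    using arg_cong[OF eq, of base_part] arg_cong[OF eq, of fibre_part] by (simp_all add: total_chart_def)
  then have p: "proj E v = proj E w"
    using atlas_chart(1)[OF S W] v unfolding total_dom_def inj_on_def by auto
  have "v \<in> fibre E (proj E v)" "w \<in> fibre E (proj E v)" "proj E v \<in> U"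
    using v p by (auto simp: fibre_def total_dom_def)
  then show "v = w" using frame_props(3)[OF E U] t by metis
qed

lemma total_chart_frame:
  assumes "x \<in> W \<inter> U"
  shows "frame E \<tau> x b \<in> total_dom E (W \<inter> U)" "total_chart E \<phi> \<tau> (frame E \<tau> x b) = join (\<phi> x) b"
  using frame_props(2,5,6)[OF E U, of x b] assms by (auto simp: total_dom_def total_chart_def)

lemma total_chart_inv:
  assumes "base_part y \<in> \<phi> ` (W \<inter> U)"
  shows "inv_into W \<phi> (base_part y) \<in> W \<inter> U"
    "inv_into (total_dom E (W \<inter> U)) (total_chart E \<phi> \<tau>) y = frame E \<tau> (inv_into W \<phi> (base_part y)) (fibre_part y)"
proof -
  obtain x where x: "x \<in> W \<inter> U" "base_part y = \<phi> x" using assms by blast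
  have inv: "inv_into W \<phi> (base_part y) = x" using x atlas_chart(1)[OF S W] by simp
  then show "inv_into W \<phi> (base_part y) \<in> W \<inter> U" using x by simp
  have "total_chart E \<phi> \<tau> (frame E \<tau> x (fibre_part y)) = y"
    unfolding total_chart_frame(2)[OF x(1)] using x(2) by (metis join_simps(3))
  then show "inv_into (total_dom E (W \<inter> U)) (total_chart E \<phi> \<tau>) y = frame E \<tau> (inv_into W \<phi> (base_part y)) (fibre_part y)"
    unfolding inv using inv_into_f_f[OF total_chart_inj total_chart_frame(1)[OF x(1)]] by metis
qed

lemma total_chart_image_inter:
  "total_chart E \<phi> \<tau> ` (total_dom E (W \<inter> U) \<inter> total_dom E N) = {y. base_part y \<in> \<phi> ` (W \<inter> U \<inter> N)}"
proof (intro equalityI subsetI)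
  fix y assume "y \<in> total_chart E \<phi> \<tau> ` (total_dom E (W \<inter> U) \<inter> total_dom E N)"
  then show "y \<in> {y. base_part y \<in> \<phi> ` (W \<inter> U \<inter> N)}" by (auto simp: total_chart_def total_dom_def)
next
  fix y :: "complex^('m + 1)" assume "y \<in> {y. base_part y \<in> \<phi> ` (W \<inter> U \<inter> N)}"
  then obtain x where x: "x \<in> W \<inter> U \<inter> N" "base_part y = \<phi> x" by blast
  have "frame E \<tau> x (fibre_part y) \<in> total_dom E (W \<inter> U) \<inter> total_dom E N"
    using frame_props[OF E U, of x] x by (auto simp: total_dom_def)
  moreover have "total_chart E \<phi> \<tau> (frame E \<tau> x (fibre_part y)) = y"
    using total_chart_frame(2)[of x "fibre_part y"] x by (metis IntD1 join_simps(3))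
  ultimately show "y \<in> total_chart E \<phi> \<tau> ` (total_dom E (W \<inter> U) \<inter> total_dom E N)" by (metis imageI)
qed

lemma total_chart_image: "total_chart E \<phi> \<tau> ` total_dom E (W \<inter> U) = {y. base_part y \<in> \<phi> ` (W \<inter> U)}"
proof -
  have "total_dom E (W \<inter> U) \<inter> total_dom E UNIV = total_dom E (W \<inter> U)" by (auto simp: total_dom_def)
  then show ?thesis using total_chart_image_inter[of UNIV] by simp
qed

lemma open_total_chart_image: "open (total_chart E \<phi> \<tau> ` total_dom E (W \<inter> U))"
  unfolding total_chart_image by (rule open_base_vimage[OF open_triv_image[OF S E U W]])

lemma total_transition:
  assumes W': "(W', \<phi>') \<in> S" and U': "(U', \<tau>') \<in> trivs E"
  shows "vec_holomorphic_on (\<lambda>y. total_chart E \<phi>' \<tau>' (inv_into (total_dom E (W \<inter> U)) (total_chart E \<phi> \<tau>) y))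
     {y. base_part y \<in> \<phi> ` (W \<inter> U \<inter> (W' \<inter> U'))}"
proof -
  have "openin (manifold_topology S) (U \<inter> (W' \<inter> U'))"
    by (intro openin_Int triv_props(1)[OF E U] triv_props(1)[OF E U'] openin_chart_domain[OF S W'])
  then have oN: "open (\<phi> ` (W \<inter> (U \<inter> (W' \<inter> U'))))" by (rule openin_atlas_image[OF S W])
  define D where "D = {y :: complex^('m + 1). base_part y \<in> \<phi> ` (W \<inter> U \<inter> (W' \<inter> U'))}"
  have oD: "open D" unfolding D_def using open_base_vimage[OF oN] by (simp add: Int_assoc)
  \<comment> \<open>The transition map in explicit form: a base transition, and multiplication of
    the fibre coordinate by the transition function.\<close>
  define T where "T = (\<lambda>y :: complex^('m + 1). join (\<phi>' (inv_into W \<phi> (base_part y)))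
     (y $ Inr 1 *s \<tau>' (frame E \<tau> (inv_into W \<phi> (base_part y)) e1)))"
  have eq: "T y = total_chart E \<phi>' \<tau>' (inv_into (total_dom E (W \<inter> U)) (total_chart E \<phi> \<tau>) y)" if "y \<in> D" for y
  proof -
    define x where "x = inv_into W \<phi> (base_part y)"
    have x: "x \<in> W \<inter> U \<inter> (W' \<inter> U')"
      using that chart_image_eq[OF atlas_chart(1)[OF S W], of "U \<inter> (W' \<inter> U')"]
      by (auto simp: D_def x_def Int_assoc inv_into_f_f[OF atlas_chart(1)[OF S W]])
    have y: "base_part y \<in> \<phi> ` (W \<inter> U)" using that by (auto simp: D_def)
    show ?thesis
      unfolding total_chart_inv(2)[OF y] T_def x_def[symmetric] total_chart_def
      using frame_props(6)[OF E U, of x "fibre_part y"] triv_transition(1)[OF E U U', of x "fibre_part y"] x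
      by (simp add: fibre_part_def)
  qed
  have bp: "vec_holomorphic_on (base_part :: complex^('m + 1) \<Rightarrow> _) D" by (rule vec_holomorphic_on_base_part[OF oD])
  have comp: "holo_fun (\<lambda>y. T y $ i) D" for i
  proof (cases i)
    case (Inl j)
    have "holo_fun (\<lambda>y. \<phi>' (inv_into W \<phi> (base_part y)) $ j) D"
      by (rule holo_fun_compose[OF vec_holomorphic_on_components(2)[OF atlas_transition[OF S W W']] bp])
        (auto simp: D_def)
    then show ?thesis by (simp add: Inl T_def)
  next
    case (Inr k)
    have "holo_fun (\<lambda>y. \<tau>' (frame E \<tau> (inv_into W \<phi> (base_part y)) e1) $ k) D"
      by (rule holo_fun_compose[OF triv_transition(2)[OF E U U' W] bp]) (auto simp: D_def)
    from holo_fun_mult[OF holo_fun_component this] show ?thesis by (simp add: Inr T_def)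
  qed
  show ?thesis unfolding D_def[symmetric]
    by (rule vec_holomorphic_on_cong[OF eq vec_holomorphic_onI[OF oD comp]])
qed

end

lemma holomorphic_atlas_total:
  fixes S :: "('a, 'm::finite) atlas" and E :: "('a, 'e, 1) vbundle"
  assumes S: "holomorphic_atlas S" and E: "holomorphic_line_bundle S E"
  shows "holomorphic_atlas (total_atlas S E)"
proof -
  have 1: "inj_on \<kappa> X \<and> open (\<kappa> ` X)" if "(X, \<kappa>) \<in> total_atlas S E" for X \<kappa>
    using that total_chart_inj[OF S E] open_total_chart_image[OF S E] unfolding total_atlas_iff by blast
  have 2: "vec_holomorphic_on (\<kappa>' \<circ> inv_into X \<kappa>) (\<kappa> ` (X \<inter> X'))"
    if "(X, \<kappa>) \<in> total_atlas S E" "(X', \<kappa>') \<in> total_atlas S E" for X \<kappa> X' \<kappa>'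
  proof -
    obtain W \<phi> U \<tau> where 1: "(W, \<phi>) \<in> S" "(U, \<tau>) \<in> trivs E" "X = total_dom E (W \<inter> U)" "\<kappa> = total_chart E \<phi> \<tau>"
      using \<open>(X, \<kappa>) \<in> total_atlas S E\<close> unfolding total_atlas_iff by blast
    obtain W' \<phi>' U' \<tau>' where 2: "(W', \<phi>') \<in> S" "(U', \<tau>') \<in> trivs E" "X' = total_dom E (W' \<inter> U')" "\<kappa>' = total_chart E \<phi>' \<tau>'"
      using \<open>(X', \<kappa>') \<in> total_atlas S E\<close> unfolding total_atlas_iff by blast
    show ?thesis
      unfolding 1 2 total_chart_image_inter[OF S E 1(1,2)] comp_def
      by (rule total_transition[OF S E 1(1,2) 2(1,2)])
  qed
  show ?thesis unfolding holomorphic_atlas_def using 1 2 by blast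
qed

section \<open>The dual bundle\<close>

definition dual_triv :: "('a, 'e, 1) vbundle \<Rightarrow> ('e \<Rightarrow> complex^1) \<Rightarrow> 'a \<times> ('e \<Rightarrow> complex) \<Rightarrow> complex^1" where
  "dual_triv E \<tau> = (\<lambda>(x, f). f (frame E \<tau> x e1) *s e1)"

lemma trivs_dual_iff: "(U, \<tau>') \<in> trivs (dual_bundle E) \<longleftrightarrow> (\<exists>\<tau>. (U, \<tau>) \<in> trivs E \<and> \<tau>' = dual_triv E \<tau>)"
proof -
  have "(\<lambda>(x, f). \<chi> j. f (inv_into (fibre E x) \<tau> (axis j 1))) = dual_triv E \<tau>" for \<tau> :: "'b \<Rightarrow> complex^1"
    by (auto simp: dual_triv_def frame_def vec_eq_iff)
  then show ?thesis by (auto simp: dual_bundle_def image_iff Bex_def)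
qed

lemma proj_total_eq:
  assumes "holomorphic_line_bundle S E" shows "proj E ` total E = points S"
proof
  show "proj E ` total E \<subseteq> points S" using assms unfolding holomorphic_vector_bundle_def by (elim conjE)
  show "points S \<subseteq> proj E ` total E"
  proof
    fix x assume "x \<in> points S"
    moreover have "points S = (\<Union>(U, \<tau>)\<in>trivs E. U)" using assms unfolding holomorphic_vector_bundle_def by (elim conjE)
    ultimately obtain U \<tau> where "(U, \<tau>) \<in> trivs E" "x \<in> U" by blast
    from frame_props(5,6)[OF assms this, of 0] show "x \<in> proj E ` total E" by force
  qed
qed

lemma fibre_dual:
  assumes "holomorphic_line_bundle S E" "x \<in> points S"
  shows "fibre (dual_bundle E) x = Pair x ` dual_fibre E x"
  using assms(2) proj_total_eq[OF assms(1)] by (auto simp: fibre_def dual_bundle_def)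

text \<open>A linear form on a one-dimensional fibre is determined by its value on the frame vector;
  off the fibre, both sides are \<open>undefined\<close> by extensionality.\<close>

lemma dual_fibre_iff:
  assumes E: "holomorphic_line_bundle S E" "(U, \<tau>) \<in> trivs E" "x \<in> U"
  shows "f \<in> dual_fibre E x \<longleftrightarrow> f = (\<lambda>v\<in>fibre E x. f (frame E \<tau> x e1) * \<tau> v $ 1)"
proof
  assume f: "f \<in> dual_fibre E x"
  show "f = (\<lambda>v\<in>fibre E x. f (frame E \<tau> x e1) * \<tau> v $ 1)"
  proof
    fix v show "f v = (\<lambda>v\<in>fibre E x. f (frame E \<tau> x e1) * \<tau> v $ 1) v"
    proof (cases "v \<in> fibre E x")
      case True
      have "v = fscale E (\<tau> v $ 1) (frame E \<tau> x e1)"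
        using frame_props(3)[OF E True] frame_props(4)[OF E, of "\<tau> v $ 1" e1] vec1_scale[of "\<tau> v"] by simp
      moreover have "f (fscale E c (frame E \<tau> x e1)) = c * f (frame E \<tau> x e1)" for c
        using f frame_props(1)[OF E, of e1] by (simp add: dual_fibre_def)
      ultimately have "f v = \<tau> v $ 1 * f (frame E \<tau> x e1)" by metis
      then show ?thesis using True by simp
    next
      case False
      then show ?thesis using f by (simp add: dual_fibre_def extensional_def)
    qed
  qed
next
  assume f: "f = (\<lambda>v\<in>fibre E x. f (frame E \<tau> x e1) * \<tau> v $ 1)"
  have x: "x \<in> points S" using triv_props(2)[OF E(1,2)] E(3) by blast
  \<comment> \<open>\<open>f\<close> occurs on both sides of its equation; naming its value on the
    frame turns the equation into a terminating rewrite rule.\<close>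
  define a where "a = f (frame E \<tau> x e1)"
  have f': "f = (\<lambda>v\<in>fibre E x. a * \<tau> v $ 1)" unfolding a_def by (rule f)
  show "f \<in> dual_fibre E x"
    unfolding dual_fibre_def f'
    by (auto simp: fibre_closed[OF E(1) x] triv_props(4,5)[OF E] algebra_simps)
qed

lemma dual_frame_in_fibre:
  assumes E: "holomorphic_line_bundle S E" "(U, \<tau>) \<in> trivs E" "x \<in> U"
  shows "(\<lambda>v\<in>fibre E x. a * \<tau> v $ 1) \<in> dual_fibre E x"
    "(\<lambda>v\<in>fibre E x. a * \<tau> v $ 1) (frame E \<tau> x e1) = a"
proof -
  show "(\<lambda>v\<in>fibre E x. a * \<tau> v $ 1) (frame E \<tau> x e1) = a"
    using frame_props(1,2)[OF E, of e1] by simp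
  then show "(\<lambda>v\<in>fibre E x. a * \<tau> v $ 1) \<in> dual_fibre E x" using dual_fibre_iff[OF E] by simp
qed

lemma bij_betw_dual_triv:
  assumes E: "holomorphic_line_bundle S E" "(U, \<tau>) \<in> trivs E" "x \<in> U"
  shows "bij_betw (dual_triv E \<tau>) (fibre (dual_bundle E) x) UNIV"
proof -
  have x: "x \<in> points S" using triv_props(2)[OF E(1,2)] E(3) by blast
  have inj: "f = g" if "f \<in> dual_fibre E x" "g \<in> dual_fibre E x" "f (frame E \<tau> x e1) = g (frame E \<tau> x e1)" for f g
    using dual_fibre_iff[OF E, of f] dual_fibre_iff[OF E, of g] that by metis
  show ?thesis
    unfolding fibre_dual[OF E(1) x] bij_betw_def
  proof (intro conjI inj_onI equalityI subsetI)
    fix p q assume "p \<in> Pair x ` dual_fibre E x" "q \<in> Pair x ` dual_fibre E x"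
      and eq: "dual_triv E \<tau> p = dual_triv E \<tau> q"
    then obtain f g where fg: "p = (x, f)" "f \<in> dual_fibre E x" "q = (x, g)" "g \<in> dual_fibre E x" by blast
    have "f (frame E \<tau> x e1) = g (frame E \<tau> x e1)"
      using arg_cong[OF eq, of "\<lambda>b. b $ 1"] fg by (simp add: dual_triv_def)
    then show "p = q" using inj fg by simp
  next
    fix b :: "complex^1"
    have "dual_triv E \<tau> (x, \<lambda>v\<in>fibre E x. b $ 1 * \<tau> v $ 1) = b"
      unfolding dual_triv_def case_prod_conv dual_frame_in_fibre(2)[OF E] by (rule vec1_scale[symmetric])
    then show "b \<in> dual_triv E \<tau> ` Pair x ` dual_fibre E x"
      using dual_frame_in_fibre(1)[OF E, of "b $ 1"] by (metis imageI)
  qed simp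
qed

lemma dual_bundle_simps:
  "proj (dual_bundle E) (x, f) = x"
  "fadd (dual_bundle E) (x, f) (y, g) = (x, \<lambda>v\<in>fibre E x. f v + g v)"
  "fscale (dual_bundle E) c (x, f) = (x, \<lambda>v\<in>fibre E x. c * f v)"
  by (simp_all add: dual_bundle_def)

lemma frame_dual:
  assumes E: "holomorphic_line_bundle S E" "(U, \<tau>) \<in> trivs E" "x \<in> U"
  shows "frame (dual_bundle E) (dual_triv E \<tau>) x b = (x, \<lambda>v\<in>fibre E x. b $ 1 * \<tau> v $ 1)"
proof -
  have x: "x \<in> points S" using triv_props(2)[OF E(1,2)] E(3) by blast
  have "(x, \<lambda>v\<in>fibre E x. b $ 1 * \<tau> v $ 1) \<in> fibre (dual_bundle E) x"
    unfolding fibre_dual[OF E(1) x] using dual_frame_in_fibre(1)[OF E] by blast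
  moreover have "dual_triv E \<tau> (x, \<lambda>v\<in>fibre E x. b $ 1 * \<tau> v $ 1) = b"
    unfolding dual_triv_def case_prod_conv dual_frame_in_fibre(2)[OF E] by (rule vec1_scale[symmetric])
  ultimately show ?thesis unfolding frame_def
    using bij_betw_inv_into_left[OF bij_betw_dual_triv[OF E]] by metis
qed

text \<open>The dual transition function from \<tau> to \<tau>' is the transition function of
  \<open>E\<close> in the opposite direction, from \<tau>' to \<tau>, so its holomorphy is an
  instance of that of \<open>E\<close>.\<close>

lemma holomorphic_line_bundle_dual:
  fixes S :: "('a, 'm::finite) atlas" and E :: "('a, 'e, 1) vbundle"
  assumes S: "holomorphic_atlas S" and E: "holomorphic_line_bundle S E"
  shows "holomorphic_line_bundle S (dual_bundle E)"
  unfolding holomorphic_vector_bundle_def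
proof (intro conjI)
  show "proj (dual_bundle E) ` total (dual_bundle E) \<subseteq> points S"
    using proj_total_eq[OF E] by (auto simp: dual_bundle_def)
next
  have add: "fadd (dual_bundle E) p q \<in> fibre (dual_bundle E) x"
    if x: "x \<in> points S" and p: "p \<in> fibre (dual_bundle E) x" and q: "q \<in> fibre (dual_bundle E) x" for x p q
  proof -
  obtain f g where fg: "p = (x, f)" "f \<in> dual_fibre E x" "q = (x, g)" "g \<in> dual_fibre E x"
    using p q unfolding fibre_dual[OF E x] by blast
  have "(\<lambda>v\<in>fibre E x. f v + g v) \<in> dual_fibre E x"
    using fg(2,4) by (auto simp: dual_fibre_def fibre_closed[OF E x] algebra_simps)
  then show ?thesis
    unfolding fibre_dual[OF E x] fg dual_bundle_simps by blast
  qed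
  have scale: "fscale (dual_bundle E) c p \<in> fibre (dual_bundle E) x"
    if x: "x \<in> points S" and p: "p \<in> fibre (dual_bundle E) x" for x p c
  proof -
  obtain f where f: "p = (x, f)" "f \<in> dual_fibre E x"
    using p unfolding fibre_dual[OF E x] by blast
  have "(\<lambda>v\<in>fibre E x. c * f v) \<in> dual_fibre E x"
    using f(2) by (auto simp: dual_fibre_def fibre_closed[OF E x] algebra_simps)
  then show ?thesis
    unfolding fibre_dual[OF E x] f dual_bundle_simps by blast
  qed
  show "\<forall>x\<in>points S. \<forall>v\<in>fibre (dual_bundle E) x. (\<forall>w\<in>fibre (dual_bundle E) x. fadd (dual_bundle E) v w \<in> fibre (dual_bundle E) x) \<and>
      (\<forall>c. fscale (dual_bundle E) c v \<in> fibre (dual_bundle E) x)"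
    using add scale by blast
next
  have "points S = (\<Union>(U, \<tau>)\<in>trivs E. U)"
    using E unfolding holomorphic_vector_bundle_def by (elim conjE)
  also have "\<dots> = (\<Union>(U, \<tau>)\<in>trivs (dual_bundle E). U)"
    by (auto simp: dual_bundle_def)
  finally show "points S = (\<Union>(U, \<tau>)\<in>trivs (dual_bundle E). U)" .
next
  show "\<forall>(U, \<tau>)\<in>trivs (dual_bundle E). openin (manifold_topology S) U \<and>
      (\<forall>x\<in>U. bij_betw \<tau> (fibre (dual_bundle E) x) UNIV \<and>
         (\<forall>v\<in>fibre (dual_bundle E) x. (\<forall>w\<in>fibre (dual_bundle E) x. \<tau> (fadd (dual_bundle E) v w) = \<tau> v + \<tau> w) \<and>
             (\<forall>c. \<tau> (fscale (dual_bundle E) c v) = c *s \<tau> v)))"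
  proof (clarify, unfold trivs_dual_iff, elim exE conjE, hypsubst)
    fix U \<tau> assume U: "(U, \<tau>) \<in> trivs E"
    have "dual_triv E \<tau> (fadd (dual_bundle E) p q) = dual_triv E \<tau> p + dual_triv E \<tau> q"
      "dual_triv E \<tau> (fscale (dual_bundle E) c p) = c *s dual_triv E \<tau> p"
      if xU: "x \<in> U" and p: "p \<in> fibre (dual_bundle E) x" and q: "q \<in> fibre (dual_bundle E) x" for x p q c
    proof -
      have x: "x \<in> points S" using triv_props(2)[OF E U] xU by blast
      obtain f g where fg: "p = (x, f)" "q = (x, g)" using p q unfolding fibre_dual[OF E x] by auto
      show "dual_triv E \<tau> (fadd (dual_bundle E) p q) = dual_triv E \<tau> p + dual_triv E \<tau> q"
        "dual_triv E \<tau> (fscale (dual_bundle E) c p) = c *s dual_triv E \<tau> p"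
        unfolding fg dual_bundle_simps dual_triv_def
        using frame_props(1)[OF E U xU, of e1] by (simp_all add: vec_eq_iff algebra_simps)
    qed
    then show "openin (manifold_topology S) U \<and>
        (\<forall>x\<in>U. bij_betw (dual_triv E \<tau>) (fibre (dual_bundle E) x) UNIV \<and>
           (\<forall>v\<in>fibre (dual_bundle E) x. (\<forall>w\<in>fibre (dual_bundle E) x. dual_triv E \<tau> (fadd (dual_bundle E) v w) = dual_triv E \<tau> v + dual_triv E \<tau> w) \<and>
               (\<forall>c. dual_triv E \<tau> (fscale (dual_bundle E) c v) = c *s dual_triv E \<tau> v)))"
      using triv_props(1)[OF E U] bij_betw_dual_triv[OF E U] by blast
  qed
next
  show "\<forall>(U, \<tau>)\<in>trivs (dual_bundle E). \<forall>(V, \<tau>')\<in>trivs (dual_bundle E). \<forall>(W, \<phi>)\<in>S. \<forall>b.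
      vec_holomorphic_on (\<lambda>z. \<tau>' (inv_into (fibre (dual_bundle E) (inv_into W \<phi> z)) \<tau> b)) (\<phi> ` (W \<inter> U \<inter> V))"
  proof (clarsimp simp: trivs_dual_iff)
    fix U V W :: "'a set" and \<tau> \<tau>' :: "'e \<Rightarrow> complex^1" and \<phi> :: "'a \<Rightarrow> complex^'m" and b :: "complex^1"
    assume U: "(U, \<tau>) \<in> trivs E" and V: "(V, \<tau>') \<in> trivs E" and W: "(W, \<phi>) \<in> S"
    have "openin (manifold_topology S) (U \<inter> V)"
      by (intro openin_Int triv_props(1)[OF E U] triv_props(1)[OF E V])
    from openin_atlas_image[OF S W this] have op: "open (\<phi> ` (W \<inter> U \<inter> V))" by (simp add: Int_assoc)
    have h: "holo_fun (\<lambda>z. b $ 1 * \<tau> (frame E \<tau>' (inv_into W \<phi> z) e1) $ 1) (\<phi> ` (W \<inter> U \<inter> V))" for b :: "complex^1"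
      using holo_fun_mult[OF holo_fun_const triv_transition(2)[OF E V U W, of e1 1]] by (simp add: Int_ac)
    have eq: "dual_triv E \<tau>' (inv_into (fibre (dual_bundle E) (inv_into W \<phi> z)) (dual_triv E \<tau>) b) $ i
        = b $ 1 * \<tau> (frame E \<tau>' (inv_into W \<phi> z) e1) $ 1" if "z \<in> \<phi> ` (W \<inter> U \<inter> V)" for z i b
    proof -
      have x: "inv_into W \<phi> z \<in> U" "inv_into W \<phi> z \<in> V"
        using that chart_image_eq[OF atlas_chart(1)[OF S W], of "U \<inter> V"] by (auto simp: Int_assoc)
      show ?thesis
        unfolding frame_def[symmetric, of "dual_bundle E"] frame_dual[OF E U x(1)]
        unfolding dual_triv_def using frame_props(1)[OF E V x(2), of e1] by simp
    qed
    show "vec_holomorphic_on (\<lambda>z. dual_triv E \<tau>' (inv_into (fibre (dual_bundle E) (inv_into W \<phi> z)) (dual_triv E \<tau>) b))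
        (\<phi> ` (W \<inter> U \<inter> V))"
      by (rule vec_holomorphic_onI[OF op holo_fun_cong[OF op eq[symmetric] h]])
  qed
qed

section \<open>Metrics on line bundles\<close>

lemma metric_scale:
  assumes E: "holomorphic_line_bundle S E" and h: "hermitian_metric S E h" and "x \<in> points S" "v \<in> fibre E x"
  shows "h (fscale E c v) = (cmod c)\<^sup>2 * h v" "v \<noteq> fscale E 0 v \<Longrightarrow> h v > 0"
proof -
  have "\<exists>H. positive_hermitian_form E x H \<and> (\<forall>v\<in>fibre E x. of_real (h v) = H v v)"
    using h assms(3) by (simp add: hermitian_metric_def)
  then obtain H where H: "positive_hermitian_form E x H" "\<forall>v\<in>fibre E x. of_real (h v) = H v v" by blast
  note cv = fibre_closed(1)[OF E assms(3,4), of c]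
  have H1: "H (fscale E c u) w = c * H u w" "H w u = cnj (H u w)" if "u \<in> fibre E x" "w \<in> fibre E x" for u w c
    using H(1) that unfolding positive_hermitian_form_def by blast+
  have "complex_of_real (h (fscale E c v)) = H (fscale E c v) (fscale E c v)" using H(2) cv by blast
  \<comment> \<open>The form is linear in its first argument; the scalar is taken out of the second
    one through hermitian symmetry.\<close>
  also have "\<dots> = c * cnj (c * H v v)"
    using H1(1)[OF assms(4) cv] H1(2)[OF cv assms(4)] H1(1)[OF assms(4,4)] by simp
  also have "H v v = of_real (h v)" using H(2) assms(4) by simp
  also have "c * cnj (c * of_real (h v)) = of_real ((cmod c)\<^sup>2 * h v)"
    by (simp add: complex_norm_square flip: of_real_power mult.assoc)
  finally show "h (fscale E c v) = (cmod c)\<^sup>2 * h v" using of_real_eq_iff by blast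
  assume "v \<noteq> fscale E 0 v"
  then have "Re (H v v) > 0" using H(1) assms(4) unfolding positive_hermitian_form_def by blast
  moreover have "H v v = of_real (h v)" using H(2) assms(4) by simp
  ultimately show "h v > 0" by simp
qed

text \<open>The zero vector of a fibre has no name in the record; the equation v = 0 v singles it
  out.\<close>

lemma zero_vector_iff:
  assumes E: "holomorphic_line_bundle S E" "(U, \<tau>) \<in> trivs E" "x \<in> U" "v \<in> fibre E x"
  shows "v = fscale E 0 v \<longleftrightarrow> \<tau> v = 0"
proof -
  have x: "x \<in> points S" using triv_props(2)[OF E(1,2)] E(3) by blast
  have "\<tau> (fscale E 0 v) = 0" using triv_props(5)[OF E, of 0] by simp
  then show ?thesis
    using frame_props(3)[OF E(1-3)] E(4) fibre_closed(1)[OF E(1) x E(4)] by metis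
qed

lemma e1_nonzero: "e1 \<noteq> 0"
  by (metis e1_simps(1) zero_index zero_neq_one)

lemma metric_frame:
  assumes E: "holomorphic_line_bundle S E" "(U, \<tau>) \<in> trivs E" "x \<in> U" and h: "hermitian_metric S E h"
  shows "h (frame E \<tau> x e1) > 0" "h (frame E \<tau> x b) = (cmod (b $ 1))\<^sup>2 * h (frame E \<tau> x e1)"
proof -
  have x: "x \<in> points S" using triv_props(2)[OF E(1,2)] E(3) by blast
  note fr = frame_props(1)[OF E, of e1]
  show "h (frame E \<tau> x e1) > 0"
    using metric_scale(2)[OF E(1) h x fr] zero_vector_iff[OF E fr] frame_props(2)[OF E] e1_nonzero by metis
  show "h (frame E \<tau> x b) = (cmod (b $ 1))\<^sup>2 * h (frame E \<tau> x e1)"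
    using metric_scale(1)[OF E(1) h x fr, of "b $ 1"] frame_props(4)[OF E, of "b $ 1" e1] vec1_scale[of b] by simp
qed

text \<open>On a line, |f|^2 is a constant multiple of \<open>h\<close>, so the supremum over the
  unit ball is attained at any vector of length 1.\<close>

lemma dual_metric_eq:
  assumes E: "holomorphic_line_bundle S E" "(U, \<tau>) \<in> trivs E" "x \<in> U" and h: "hermitian_metric S E h"
    and f: "f \<in> dual_fibre E x"
  shows "dual_metric E h (x, f) = (cmod (f (frame E \<tau> x e1)))\<^sup>2 / h (frame E \<tau> x e1)"
proof -
  define a where "a = h (frame E \<tau> x e1)"
  have a: "a > 0" unfolding a_def by (rule metric_frame(1)[OF E h])
  have hv: "h v = (cmod (\<tau> v $ 1))\<^sup>2 * a" and fv: "f v = f (frame E \<tau> x e1) * \<tau> v $ 1" if "v \<in> fibre E x" for v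
  proof -
    show "h v = (cmod (\<tau> v $ 1))\<^sup>2 * a"
      using metric_frame(2)[OF E h, of "\<tau> v"] frame_props(3)[OF E that] by (simp add: a_def)
    show "f v = f (frame E \<tau> x e1) * \<tau> v $ 1"
      using fun_cong[OF dual_fibre_iff[OF E, THEN iffD1, OF f], of v] that by simp
  qed
  have "(SUP v\<in>{v \<in> fibre E x. h v \<le> 1}. (cmod (f v))\<^sup>2) = (cmod (f (frame E \<tau> x e1)))\<^sup>2 / a"
  proof (rule cSup_eq_maximum)
    \<comment> \<open>The frame vector has squared length \<open>a\<close>; dividing it by the
      square root of \<open>a\<close> gives length 1.\<close>
    define w where "w = frame E \<tau> x (of_real (1 / sqrt a) *s e1)"
    have w: "w \<in> fibre E x" "\<tau> w = of_real (1 / sqrt a) *s e1"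
      unfolding w_def by (rule frame_props[OF E])+
    have n: "(cmod (\<tau> w $ 1))\<^sup>2 = 1 / a" unfolding w(2) using a by (simp add: norm_divide power_divide)
    have "h w \<le> 1" unfolding hv[OF w(1)] n using a by simp
    moreover have "(cmod (f w))\<^sup>2 = (cmod (f (frame E \<tau> x e1)))\<^sup>2 / a"
      unfolding fv[OF w(1)] norm_mult power_mult_distrib n by simp
    ultimately show "(cmod (f (frame E \<tau> x e1)))\<^sup>2 / a \<in> (\<lambda>v. (cmod (f v))\<^sup>2) ` {v \<in> fibre E x. h v \<le> 1}"
      using w(1) by (intro image_eqI[of _ _ w]) auto
  next
    fix y assume "y \<in> (\<lambda>v. (cmod (f v))\<^sup>2) ` {v \<in> fibre E x. h v \<le> 1}"
    then obtain v where v: "v \<in> fibre E x" "h v \<le> 1" "y = (cmod (f v))\<^sup>2" by blast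
    have "(cmod (\<tau> v $ 1))\<^sup>2 \<le> 1 / a" using v(2) a unfolding hv[OF v(1)] by (simp add: field_simps)
    then have "(cmod (f (frame E \<tau> x e1)))\<^sup>2 * (cmod (\<tau> v $ 1))\<^sup>2 \<le> (cmod (f (frame E \<tau> x e1)))\<^sup>2 * (1 / a)"
      by (rule mult_left_mono) simp
    then show "y \<le> (cmod (f (frame E \<tau> x e1)))\<^sup>2 / a"
      unfolding v(3) fv[OF v(1)] norm_mult power_mult_distrib by simp
  qed
  then show ?thesis by (simp add: dual_metric_def a_def)
qed

text \<open>The sign is chosen so that positive curvature means that the potential \<open>p\<close> is plurisubharmonic: in a
  trivialization \<open>h\<close> is \<open>|b|\<^sup>2 e\<^sup>-\<^sup>p\<close> and the dual metric is \<open>|b|\<^sup>2 e\<^sup>p\<close>.\<close>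

definition metric_pot :: "('a, 'e, 1) vbundle \<Rightarrow> ('e \<Rightarrow> real) \<Rightarrow> ('e \<Rightarrow> complex^1) \<Rightarrow> 'a \<Rightarrow> real" where
  "metric_pot E h \<tau> x = - ln (h (frame E \<tau> x e1))"

lemma metric_frame_pot:
  assumes E: "holomorphic_line_bundle S E" "(U, \<tau>) \<in> trivs E" "x \<in> U" and h: "hermitian_metric S E h"
  shows "h (frame E \<tau> x b) = (cmod (b $ 1))\<^sup>2 * exp (- metric_pot E h \<tau> x)"
    "dual_metric E h (frame (dual_bundle E) (dual_triv E \<tau>) x b) = (cmod (b $ 1))\<^sup>2 * exp (metric_pot E h \<tau> x)"
proof -
  note pos = metric_frame(1)[OF E h]
  show "h (frame E \<tau> x b) = (cmod (b $ 1))\<^sup>2 * exp (- metric_pot E h \<tau> x)"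
    using metric_frame(2)[OF E h, of b] pos by (simp add: metric_pot_def)
  show "dual_metric E h (frame (dual_bundle E) (dual_triv E \<tau>) x b) = (cmod (b $ 1))\<^sup>2 * exp (metric_pot E h \<tau> x)"
    unfolding frame_dual[OF E] dual_metric_eq[OF E h dual_frame_in_fibre(1)[OF E]] dual_frame_in_fibre(2)[OF E]
    using pos by (simp add: metric_pot_def exp_minus divide_inverse)
qed

lemma metric_in_chart:
  assumes S: "holomorphic_atlas S" and E: "holomorphic_line_bundle S E" and h: "hermitian_metric S E h"
    and W: "(W, \<phi>) \<in> S" and U: "(U, \<tau>) \<in> trivs E" and y: "base_part y \<in> \<phi> ` (W \<inter> U)"
  shows "h (inv_into (total_dom E (W \<inter> U)) (total_chart E \<phi> \<tau>) y) =
      fibre_quad (\<lambda>z. - metric_pot E h \<tau> (inv_into W \<phi> z)) y"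
    "dual_metric E h (inv_into (total_dom (dual_bundle E) (W \<inter> U)) (total_chart (dual_bundle E) \<phi> (dual_triv E \<tau>)) y) =
      fibre_quad (\<lambda>z. metric_pot E h \<tau> (inv_into W \<phi> z)) y"
proof -
  have x: "inv_into W \<phi> (base_part y) \<in> U" using total_chart_inv(1)[OF S E W U y] by blast
  have U': "(U, dual_triv E \<tau>) \<in> trivs (dual_bundle E)" using U trivs_dual_iff by blast
  note pot = metric_frame_pot[OF E U x h]
  show "h (inv_into (total_dom E (W \<inter> U)) (total_chart E \<phi> \<tau>) y) =
      fibre_quad (\<lambda>z. - metric_pot E h \<tau> (inv_into W \<phi> z)) y"
    unfolding total_chart_inv(2)[OF S E W U y] pot fibre_quad_def by (simp add: fibre_part_def)
  show "dual_metric E h (inv_into (total_dom (dual_bundle E) (W \<inter> U)) (total_chart (dual_bundle E) \<phi> (dual_triv E \<tau>)) y) =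
      fibre_quad (\<lambda>z. metric_pot E h \<tau> (inv_into W \<phi> z)) y"
    unfolding total_chart_inv(2)[OF S holomorphic_line_bundle_dual[OF S E] W U' y] pot fibre_quad_def
    by (simp add: fibre_part_def)
qed

text \<open>Smoothness expressed on the base. It follows from positive curvature and implies
  smoothness of the metric and of its dual at the same time.\<close>

definition smooth_pot :: "('a, 'm::finite) atlas \<Rightarrow> ('a, 'e, 1) vbundle \<Rightarrow> ('e \<Rightarrow> real) \<Rightarrow> bool" where
  "smooth_pot S E h \<longleftrightarrow> (\<forall>W \<phi> U \<tau>. (W, \<phi>) \<in> S \<longrightarrow> (U, \<tau>) \<in> trivs E \<longrightarrow>
     smooth_on (\<phi> ` (W \<inter> U)) (\<lambda>z. metric_pot E h \<tau> (inv_into W \<phi> z)))"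

context
  fixes S :: "('a, 'm::finite) atlas" and E :: "('a, 'e, 1) vbundle" and h :: "'e \<Rightarrow> real"
  assumes S: "holomorphic_atlas S" and E: "holomorphic_line_bundle S E" and h: "hermitian_metric S E h"
begin

lemma dual_total_atlas_iff:
  "(X, \<kappa>) \<in> total_atlas S (dual_bundle E) \<longleftrightarrow> (\<exists>W \<phi> U \<tau>. (W, \<phi>) \<in> S \<and> (U, \<tau>) \<in> trivs E \<and>
     X = total_dom (dual_bundle E) (W \<inter> U) \<and> \<kappa> = total_chart (dual_bundle E) \<phi> (dual_triv E \<tau>))"
  unfolding total_atlas_iff trivs_dual_iff by metis

lemma dual_total_image:
  assumes W: "(W, \<phi>) \<in> S" and U: "(U, \<tau>) \<in> trivs E"
  shows "total_chart (dual_bundle E) \<phi> (dual_triv E \<tau>) ` total_dom (dual_bundle E) (W \<inter> U) =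
    {y. base_part y \<in> \<phi> ` (W \<inter> U)}"
  by (rule total_chart_image[OF S holomorphic_line_bundle_dual[OF S E] W])
    (use U trivs_dual_iff in blast)

lemma smooth_pot_imp_smooth_metric:
  assumes "smooth_pot S E h"
  shows "smooth_metric S E h" "smooth_metric S (dual_bundle E) (dual_metric E h)"
proof -
  show "smooth_metric S E h"
    unfolding smooth_metric_def smooth_function_def
  proof clarify
    fix X \<kappa> assume "(X, \<kappa>) \<in> total_atlas S E"
    then obtain W \<phi> U \<tau> where 1: "(W, \<phi>) \<in> S" "(U, \<tau>) \<in> trivs E" "X = total_dom E (W \<inter> U)" "\<kappa> = total_chart E \<phi> \<tau>"
      unfolding total_atlas_iff by blast
    note op = open_triv_image[OF S E 1(2,1)]
    have sm: "smooth_on (\<phi> ` (W \<inter> U)) (\<lambda>z. - metric_pot E h \<tau> (inv_into W \<phi> z))"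
      by (rule smooth_on_uminus[OF op]) (use assms 1 in \<open>simp add: smooth_pot_def\<close>)
    show "smooth_on (\<kappa> ` X) (h \<circ> inv_into X \<kappa>)"
      unfolding 1 total_chart_image[OF S E 1(1,2)]
      by (rule smooth_on_cong[OF open_base_vimage[OF op] _ smooth_on_fibre_quad[OF op sm]])
        (simp add: metric_in_chart(1)[OF S E h 1(1,2)])
  qed
  show "smooth_metric S (dual_bundle E) (dual_metric E h)"
    unfolding smooth_metric_def smooth_function_def
  proof clarify
    fix X \<kappa> assume "(X, \<kappa>) \<in> total_atlas S (dual_bundle E)"
    then obtain W \<phi> U \<tau> where 1: "(W, \<phi>) \<in> S" "(U, \<tau>) \<in> trivs E" "X = total_dom (dual_bundle E) (W \<inter> U)"
      "\<kappa> = total_chart (dual_bundle E) \<phi> (dual_triv E \<tau>)"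
      unfolding dual_total_atlas_iff by blast
    note op = open_triv_image[OF S E 1(2,1)]
    have sm: "smooth_on (\<phi> ` (W \<inter> U)) (\<lambda>z. metric_pot E h \<tau> (inv_into W \<phi> z))"
      using assms 1 by (simp add: smooth_pot_def)
    show "smooth_on (\<kappa> ` X) (dual_metric E h \<circ> inv_into X \<kappa>)"
      unfolding 1 dual_total_image[OF 1(1,2)]
      by (rule smooth_on_cong[OF open_base_vimage[OF op] _ smooth_on_fibre_quad[OF op sm]])
        (simp add: metric_in_chart(2)[OF S E h 1(1,2)])
  qed
qed

lemma lap_dual_metric_chart:
  assumes "smooth_on (\<phi> ` (W \<inter> U)) (\<lambda>z. metric_pot E h \<tau> (inv_into W \<phi> z))"
    and W: "(W, \<phi>) \<in> S" and U: "(U, \<tau>) \<in> trivs E"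
    and X: "X = total_dom (dual_bundle E) (W \<inter> U)" "\<kappa> = total_chart (dual_bundle E) \<phi> (dual_triv E \<tau>)"
    and p: "p \<in> \<kappa> ` X"
  shows "open (\<kappa> ` X)" "base_part p \<in> \<phi> ` (W \<inter> U)"
    "lap (dual_metric E h \<circ> inv_into X \<kappa>) p v = lap (fibre_quad (\<lambda>z. metric_pot E h \<tau> (inv_into W \<phi> z))) p v"
proof -
  note op = open_triv_image[OF S E U W]
  have im: "\<kappa> ` X = {y. base_part y \<in> \<phi> ` (W \<inter> U)}" unfolding X by (rule dual_total_image[OF W U])
  show opX: "open (\<kappa> ` X)" unfolding im by (rule open_base_vimage[OF op])
  show "base_part p \<in> \<phi> ` (W \<inter> U)" using p im by blast
  show "lap (dual_metric E h \<circ> inv_into X \<kappa>) p v = lap (fibre_quad (\<lambda>z. metric_pot E h \<tau> (inv_into W \<phi> z))) p v"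
  proof (rule lap_cong[OF opX p])
    fix y assume "y \<in> \<kappa> ` X"
    then have "base_part y \<in> \<phi> ` (W \<inter> U)" using im by blast
    then show "(dual_metric E h \<circ> inv_into X \<kappa>) y = fibre_quad (\<lambda>z. metric_pot E h \<tau> (inv_into W \<phi> z)) y"
      unfolding X comp_def by (rule metric_in_chart(2)[OF S E h W U])
  qed
qed

text \<open>By \<open>lap_fibre_quad\<close> the Laplacian of the dual metric is a positive factor
  times a square plus |b|^2 times the Laplacian of the potential. Nonnegativity thus holds on the
  whole total space, including the zero section.\<close>

lemma semipositively_curvedI:
  assumes sm: "smooth_pot S E h"
    and nn: "\<And>W \<phi> U \<tau> z v. (W, \<phi>) \<in> S \<Longrightarrow> (U, \<tau>) \<in> trivs E \<Longrightarrow> z \<in> \<phi> ` (W \<inter> U) \<Longrightarrow>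
       lap (\<lambda>z. metric_pot E h \<tau> (inv_into W \<phi> z)) z v \<ge> 0"
  shows "semipositively_curved S E h"
  unfolding semipositively_curved_def seminegatively_curved_def plurisubharmonic_def
proof (intro conjI allI)
  note dual = holomorphic_line_bundle_dual[OF S E]
  show "openin (manifold_topology (total_atlas S (dual_bundle E))) {p \<in> points (total_atlas S (dual_bundle E)). dual_metric E h p < r}" for r
    by (rule openin_sublevel_smooth[OF holomorphic_atlas_total[OF S dual]
          smooth_pot_imp_smooth_metric(2)[OF sm, unfolded smooth_metric_def]])
  show "\<forall>(X, \<kappa>)\<in>total_atlas S (dual_bundle E). disc_submean_on (\<kappa> ` X) (dual_metric E h \<circ> inv_into X \<kappa>)"
  proof clarify
    fix X \<kappa> assume X: "(X, \<kappa>) \<in> total_atlas S (dual_bundle E)"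
    then obtain W \<phi> U \<tau> where 1: "(W, \<phi>) \<in> S" "(U, \<tau>) \<in> trivs E" "X = total_dom (dual_bundle E) (W \<inter> U)"
      "\<kappa> = total_chart (dual_bundle E) \<phi> (dual_triv E \<tau>)"
      unfolding dual_total_atlas_iff by blast
    note op = open_triv_image[OF S E 1(2,1)]
    have sp: "smooth_on (\<phi> ` (W \<inter> U)) (\<lambda>z. metric_pot E h \<tau> (inv_into W \<phi> z))"
      using sm 1 by (simp add: smooth_pot_def)
    have opX: "open (\<kappa> ` X)" unfolding 1 dual_total_image[OF 1(1,2)] by (rule open_base_vimage[OF op])
    show "disc_submean_on (\<kappa> ` X) (dual_metric E h \<circ> inv_into X \<kappa>)"
    proof (rule disc_submean_onI[OF opX])
      show "smooth_on (\<kappa> ` X) (dual_metric E h \<circ> inv_into X \<kappa>)"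
        using smooth_pot_imp_smooth_metric(2)[OF sm] X unfolding smooth_metric_def smooth_function_def by auto
      fix p v assume p: "p \<in> \<kappa> ` X"
      note l = lap_dual_metric_chart[OF sp 1 p]
      show "lap (dual_metric E h \<circ> inv_into X \<kappa>) p v \<ge> 0"
        unfolding l(3) lap_fibre_quad[OF op sp l(2)]
        by (intro mult_nonneg_nonneg add_nonneg_nonneg nn[OF 1(1,2) l(2)]) auto
    qed
  qed
qed

lemma positively_curved_overI:
  assumes sm: "smooth_pot S E h"
    and pos: "\<And>W \<phi> U \<tau> z v. (W, \<phi>) \<in> S \<Longrightarrow> (U, \<tau>) \<in> trivs E \<Longrightarrow> z \<in> \<phi> ` (W \<inter> U) \<Longrightarrow> inv_into W \<phi> z \<in> Y \<Longrightarrow>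
       v \<noteq> 0 \<Longrightarrow> lap (\<lambda>z. metric_pot E h \<tau> (inv_into W \<phi> z)) z v > 0"
  shows "positively_curved_over S E h Y"
  unfolding positively_curved_over_def negatively_curved_over_def strongly_psh_at_def
proof (intro conjI smooth_pot_imp_smooth_metric(2)[OF sm], clarify)
  fix X \<kappa> q w assume X: "(X, \<kappa>) \<in> total_atlas S (dual_bundle E)" and q: "q \<in> X"
    "q \<in> total (dual_bundle E)" "proj (dual_bundle E) q \<in> Y" "q \<noteq> fscale (dual_bundle E) 0 q"
    and w: "w \<noteq> (0 :: complex^('m + 1))"
  note dual = holomorphic_line_bundle_dual[OF S E]
  obtain W \<phi> U \<tau> where 1: "(W, \<phi>) \<in> S" "(U, \<tau>) \<in> trivs E" "X = total_dom (dual_bundle E) (W \<inter> U)"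
    "\<kappa> = total_chart (dual_bundle E) \<phi> (dual_triv E \<tau>)"
    using X unfolding dual_total_atlas_iff by blast
  have U': "(U, dual_triv E \<tau>) \<in> trivs (dual_bundle E)" using 1(2) trivs_dual_iff by blast
  note op = open_triv_image[OF S E 1(2,1)]
  define \<Phi> where "\<Phi> = (\<lambda>z. metric_pot E h \<tau> (inv_into W \<phi> z))"
  have sp: "smooth_on (\<phi> ` (W \<inter> U)) \<Phi>"
    using sm 1 by (simp add: smooth_pot_def \<Phi>_def)
  define p where "p = \<kappa> q"
  have p: "p \<in> \<kappa> ` X" using q(1) by (simp add: p_def)
  note l = lap_dual_metric_chart[OF sp[unfolded \<Phi>_def] 1 p, folded \<Phi>_def]
  define x where "x = proj (dual_bundle E) q"
  have x: "x \<in> W \<inter> U" "base_part p = \<phi> x"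
    using q(1) by (auto simp: p_def x_def 1 total_chart_def total_dom_def)
  have ix: "inv_into W \<phi> (base_part p) = x"
    unfolding x(2) by (rule inv_into_f_f[OF atlas_chart(1)[OF S 1(1)]]) (use x(1) in blast)
  have "q \<in> fibre (dual_bundle E) x" using q(2) by (simp add: fibre_def x_def)
  then have "dual_triv E \<tau> q \<noteq> 0" using zero_vector_iff[OF dual U', of x q] x(1) q(4) by blast
  then have b: "p $ Inr 1 \<noteq> 0"
    unfolding p_def 1 total_chart_def by (simp add: vec_eq_iff num1_eq1)
  have smX: "smooth_on (\<kappa> ` X) (dual_metric E h \<circ> inv_into X \<kappa>)"
    using smooth_pot_imp_smooth_metric(2)[OF sm] X unfolding smooth_metric_def smooth_function_def by auto
  have "lap (dual_metric E h \<circ> inv_into X \<kappa>) p w > 0"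
  \<comment> \<open>A direction that moves the base point gets strictness from the potential,
    because b \<noteq> 0; a vertical direction gets it from the square, which reduces to 4
    |w|^2.\<close>
  proof (cases "base_part w = 0")
    case False
    have "lap \<Phi> (base_part p) (base_part w) > 0"
      unfolding \<Phi>_def by (rule pos[OF 1(1,2) l(2) _ False]) (use q(3) ix in \<open>simp add: x_def\<close>)
    then show ?thesis
      unfolding l(3) lap_fibre_quad[OF op sp l(2)] using b by (simp add: add_nonneg_pos)
  next
    case True
    have "w $ Inr 1 \<noteq> 0"
    proof
      assume "w $ Inr 1 = 0"
      then have "fibre_part w = 0" by (simp add: fibre_part_def vec_eq_iff num1_eq1)
      then have "w = join 0 0" using True join_simps(3)[of w] by simp
      also have "\<dots> = 0" by (simp add: join_def vec_eq_iff split: sum.splits)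
      finally show False using w by simp
    qed
    moreover have "dd 0 \<Phi> (base_part p) = 0" "lap \<Phi> (base_part p) 0 = 0"
      using dd_zero[OF sp l(2)] dd_zero[OF smooth_on_dd[OF sp] l(2)] by (simp_all add: lap_def)
    ultimately show ?thesis
      unfolding l(3) lap_fibre_quad[OF op sp l(2)] True by simp
  qed
  then show "0 < Re (levi_form (dual_metric E h \<circ> inv_into X \<kappa>) (\<kappa> q) w)"
    unfolding p_def[symmetric] levi_form_lap[OF l(1) smX p] by simp
qed

text \<open>On the slice b = 1 of the total space the dual metric is e^p, so \<open>p\<close> is the
  logarithm of a smooth positive function.\<close>

lemma positively_curved_imp_smooth_pot:
  assumes pc: "positively_curved S E h"
  shows "smooth_pot S E h"
  unfolding smooth_pot_def
proof (intro allI impI)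
  fix W \<phi> U \<tau> assume W: "(W, \<phi>) \<in> S" and U: "(U, \<tau>) \<in> trivs E"
  have smd: "smooth_metric S (dual_bundle E) (dual_metric E h)"
    using pc unfolding positively_curved_over_def negatively_curved_over_def by (elim conjE)
  define X where "X = total_dom (dual_bundle E) (W \<inter> U)"
  define \<kappa> where "\<kappa> = total_chart (dual_bundle E) \<phi> (dual_triv E \<tau>)"
  note op = open_triv_image[OF S E U W]
  define u where "u = dual_metric E h \<circ> inv_into X \<kappa>"
  have "(X, \<kappa>) \<in> total_atlas S (dual_bundle E)"
    unfolding dual_total_atlas_iff X_def \<kappa>_def using W U by blast
  then have "smooth_on (\<kappa> ` X) u"
    using smd unfolding smooth_metric_def smooth_function_def u_def by auto
  then have smX: "smooth_on {y. base_part y \<in> \<phi> ` (W \<inter> U)} u"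
    using dual_total_image[OF W U] by (simp add: X_def \<kappa>_def)
  \<comment> \<open>The slice is affine: a linear embedding plus a constant vector.\<close>
  have ju: "join z e1 = join z 0 + join 0 e1" for z :: "complex^'m"
    by (simp add: vec_eq_iff join_def split: sum.splits)
  have "smooth_on (\<phi> ` (W \<inter> U)) (\<lambda>z. join z e1 :: complex^('m + 1))"
    by (subst ju) (intro smooth_on_add op smooth_on_const smooth_on_bounded_linear bounded_linear_join_left)
  then have 1: "smooth_on (\<phi> ` (W \<inter> U)) (\<lambda>z. u (join z e1))"
    by (rule smooth_on_compose[OF op open_base_vimage[OF op] _ smX, rotated]) auto
  have eq: "u (join z e1) = exp (metric_pot E h \<tau> (inv_into W \<phi> z))" if "z \<in> \<phi> ` (W \<inter> U)" for z
    unfolding u_def comp_def X_def \<kappa>_def using metric_in_chart(2)[OF S E h W U, of "join z e1"] that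
    by (simp add: fibre_quad_def)
  have "smooth_on (\<phi> ` (W \<inter> U)) (\<lambda>z. ln (u (join z e1)))"
    by (rule smooth_on_compose[OF op open_greaterThan _ smooth_on_ln 1]) (auto simp: eq)
  then show "smooth_on (\<phi> ` (W \<inter> U)) (\<lambda>z. metric_pot E h \<tau> (inv_into W \<phi> z))"
    by (rule smooth_on_cong[OF op, rotated]) (simp add: eq)
qed

text \<open>The converse of the preceding criterion for curvature: evaluated on the horizontal lift
  of \<open>v\<close>, the Levi form of the dual metric reduces to that of the potential.\<close>

lemma positively_curved_lap_pos:
  assumes pc: "positively_curved S E h" and W: "(W, \<phi>) \<in> S" and U: "(U, \<tau>) \<in> trivs E"
    and z: "z \<in> \<phi> ` (W \<inter> U)" and v: "v \<noteq> (0 :: complex^'m)"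
  shows "lap (\<lambda>z. metric_pot E h \<tau> (inv_into W \<phi> z)) z v > 0"
proof -
  note dual = holomorphic_line_bundle_dual[OF S E]
  have smd: "smooth_metric S (dual_bundle E) (dual_metric E h)"
    and str: "strongly_psh_at (total_atlas S (dual_bundle E))
      {v \<in> total (dual_bundle E). proj (dual_bundle E) v \<in> points S \<and> v \<noteq> fscale (dual_bundle E) 0 v} (dual_metric E h)"
    using pc[unfolded positively_curved_over_def negatively_curved_over_def] by (rule conjunct1, rule conjunct2)
  have U': "(U, dual_triv E \<tau>) \<in> trivs (dual_bundle E)" using U trivs_dual_iff by blast
  note op = open_triv_image[OF S E U W]
  define \<Phi> where "\<Phi> = (\<lambda>z. metric_pot E h \<tau> (inv_into W \<phi> z))"
  have sp: "smooth_on (\<phi> ` (W \<inter> U)) \<Phi>"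
    using positively_curved_imp_smooth_pot[OF pc] W U by (simp add: smooth_pot_def \<Phi>_def)
  define X where "X = total_dom (dual_bundle E) (W \<inter> U)"
  define \<kappa> where "\<kappa> = total_chart (dual_bundle E) \<phi> (dual_triv E \<tau>)"
  have XA: "(X, \<kappa>) \<in> total_atlas S (dual_bundle E)"
    unfolding dual_total_atlas_iff X_def \<kappa>_def using W U by blast
  have smX: "smooth_on (\<kappa> ` X) (dual_metric E h \<circ> inv_into X \<kappa>)"
    using smd XA unfolding smooth_metric_def smooth_function_def by auto
  define x where "x = inv_into W \<phi> z"
  obtain x' where x': "x' \<in> W \<inter> U" "z = \<phi> x'" using z by blast
  have "x = x'" unfolding x_def x'(2) by (rule inv_into_f_f[OF atlas_chart(1)[OF S W]]) (use x' in blast)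
  then have x: "x \<in> W \<inter> U" "\<phi> x = z" using x' by auto
  define q where "q = frame (dual_bundle E) (dual_triv E \<tau>) x e1"
  have xU: "x \<in> U" using x by blast
  have q: "q \<in> X" "\<kappa> q = join z e1"
    unfolding q_def X_def \<kappa>_def using total_chart_frame[OF S dual W U' x(1), of e1] x(2) by auto
  have "q \<noteq> fscale (dual_bundle E) 0 q"
    using zero_vector_iff[OF dual U' xU] frame_props(1,2)[OF dual U' xU, of e1] e1_nonzero unfolding q_def by metis
  moreover have "x \<in> points S" using triv_props(2)[OF E U] xU by blast
  ultimately have qY: "q \<in> X \<inter> {v \<in> total (dual_bundle E). proj (dual_bundle E) v \<in> points S \<and> v \<noteq> fscale (dual_bundle E) 0 v}"
    using frame_props(5,6)[OF dual U' xU, of e1] q(1) unfolding q_def by simp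
  \<comment> \<open>\<eta> is the fibre component for which the completed square vanishes at fibre
    coordinate 1.\<close>
  define \<eta> where "\<eta> = - (complex_of_real (dd v \<Phi> z) - \<i> * complex_of_real (dd (\<i> *s v) \<Phi> z)) / 2"
  have \<eta>: "2 * \<eta> + (complex_of_real (dd v \<Phi> z) - \<i> * complex_of_real (dd (\<i> *s v) \<Phi> z)) = 0"
    unfolding \<eta>_def by (simp add: field_simps)
  define w :: "complex^('m + 1)" where "w = join v (\<eta> *s e1)"
  have "w \<noteq> 0" using v by (metis join_simps(1) w_def base_part_cmult vector_smult_lzero)
  moreover have "\<forall>p\<in>X \<inter> {v \<in> total (dual_bundle E). proj (dual_bundle E) v \<in> points S \<and> v \<noteq> fscale (dual_bundle E) 0 v}.
      \<forall>v. v \<noteq> 0 \<longrightarrow> Re (levi_form (dual_metric E h \<circ> inv_into X \<kappa>) (\<kappa> p) v) > 0"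
    using bspec[OF str[unfolded strongly_psh_at_def] XA] by (simp only: case_prod_conv)
  ultimately have "0 < Re (levi_form (dual_metric E h \<circ> inv_into X \<kappa>) (\<kappa> q) w)"
    using qY by blast
  moreover have p: "\<kappa> q \<in> \<kappa> ` X" using q(1) by blast
  note l = lap_dual_metric_chart[OF sp[unfolded \<Phi>_def] W U X_def \<kappa>_def p, folded \<Phi>_def]
  have "Re (levi_form (dual_metric E h \<circ> inv_into X \<kappa>) (\<kappa> q) w) = lap (fibre_quad \<Phi>) (\<kappa> q) w / 4"
    unfolding levi_form_lap[OF l(1) smX p] l(3) ..
  also have "lap (fibre_quad \<Phi>) (\<kappa> q) w = exp (\<Phi> z) * lap \<Phi> z v"
    unfolding lap_fibre_quad[OF op sp l(2)] unfolding q(2) w_def by (simp add: \<eta>)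
  finally show ?thesis
    using \<open>0 < Re _\<close> unfolding \<Phi>_def by (simp add: zero_less_mult_iff)
qed

end

section \<open>Embedded balls and conformal changes of metric\<close>

text \<open>Locally log |F|^2 is the real part of twice a holomorphic logarithm of \<open>F\<close>,
  up to a constant.\<close>

lemma lap_ln_cmod_sq_holo_fun:
  assumes "open D" "holo_fun F D" "z \<in> D" "F z \<noteq> 0"
  shows "lap (\<lambda>z. ln ((cmod (F z))\<^sup>2)) z v = 0"
proof -
  \<comment> \<open>Dividing by F z brings the values near 1, into the right half-plane, where the
    principal branch \<open>Ln\<close> is holomorphic.\<close>
  define V where "V = D \<inter> (\<lambda>w. F w / F z) -` ball 1 1"
  have "continuous_on D (\<lambda>w. F w / F z)"
    by (intro continuous_intros holo_fun_continuous_on[OF assms(2)]) (use assms(4) in auto)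
  then have V: "open V" "z \<in> V" "V \<subseteq> D"
    unfolding V_def using continuous_open_preimage[OF _ assms(1) open_ball] assms(3,4) by auto
  have pos: "Re (F w / F z) > 0" if "w \<in> V" for w
  proof -
    have "cmod (1 - F w / F z) < 1" using that by (simp add: V_def dist_norm)
    then show ?thesis using abs_Re_le_cmod[of "1 - F w / F z"] by simp
  qed
  have div: "holo_fun (\<lambda>w. F w / F z) V"
    by (rule holo_fun_field_compose[OF holo_fun_subset[OF assms(2) V(3)], of "\<lambda>u. u / F z" "\<lambda>_. 1 / F z"])
      (auto intro!: derivative_eq_intros simp: assms(4))
  have "holo_fun (\<lambda>w. 2 * Ln (F w / F z) + of_real (ln ((cmod (F z))\<^sup>2))) V"
  proof (rule holo_fun_field_compose[OF div, of "\<lambda>u. 2 * Ln u + of_real (ln ((cmod (F z))\<^sup>2))" "\<lambda>w. 2 * inverse (F w / F z)"])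
    fix w assume "w \<in> V"
    then have "F w / F z \<notin> \<real>\<^sub>\<le>\<^sub>0" using pos by (metis complex_nonpos_Reals_iff not_less)
    then show "((\<lambda>u. 2 * Ln u + of_real (ln ((cmod (F z))\<^sup>2))) has_field_derivative 2 * inverse (F w / F z)) (at (F w / F z))"
      by (auto intro!: derivative_eq_intros)
  qed
  from lap_Re_holo_fun[OF V(1) this V(2), of v]
  have 0: "lap (\<lambda>w. Re (2 * Ln (F w / F z) + of_real (ln ((cmod (F z))\<^sup>2)))) z v = 0" .
  have "lap (\<lambda>z. ln ((cmod (F z))\<^sup>2)) z v = lap (\<lambda>w. Re (2 * Ln (F w / F z) + of_real (ln ((cmod (F z))\<^sup>2)))) z v"
  proof (rule lap_cong[OF V(1,2)])
    fix w assume "w \<in> V"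
    then have "F w / F z \<noteq> 0" using pos[of w] by force
    then show "ln ((cmod (F w))\<^sup>2) = Re (2 * Ln (F w / F z) + of_real (ln ((cmod (F z))\<^sup>2)))"
      using assms(4) by (simp add: norm_divide ln_div ln_realpow algebra_simps)
  qed
  then show ?thesis using 0 by simp
qed

lemma smooth_on_ln_cmod_sq_holo_fun:
  assumes "open D" "holo_fun F D" "\<And>z. z \<in> D \<Longrightarrow> F z \<noteq> 0"
  shows "smooth_on D (\<lambda>z. ln ((cmod (F z))\<^sup>2))"
proof -
  have "smooth_on D (\<lambda>z. (cmod (F z))\<^sup>2)"
    by (rule smooth_on_compose[OF assms(1) open_UNIV _ smooth_on_cmod_sq[OF open_UNIV bounded_linear_ident] holo_fun_smooth[OF assms(1,2)]]) simp
  then show ?thesis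
    by (rule smooth_on_compose[OF assms(1) open_greaterThan _ smooth_on_ln, rotated]) (use assms(3) in auto)
qed

section \<open>Inverse charts, holomorphic maps and sections, and embedded balls\<close>

lemma openin_inv_chart_image:
  assumes A: "holomorphic_atlas A" "(U, \<phi>) \<in> A" and B: "open B" "B \<subseteq> \<phi> ` U"
  shows "openin (manifold_topology A) (inv_into U \<phi> ` B)"
proof -
  have im: "inv_into U \<phi> ` B = {x \<in> U. \<phi> x \<in> B}"
    using B(2) inv_into_f_f[OF atlas_chart(1)[OF A]] by (force simp: image_iff)
  have "open (\<psi> ` (V \<inter> inv_into U \<phi> ` B))" if V: "(V, \<psi>) \<in> A" for V \<psi>
  proof -
    note T = atlas_transition[OF A(1) V A(2)]
    have "open (\<psi> ` (V \<inter> U) \<inter> (\<lambda>z. \<phi> (inv_into V \<psi> z)) -` B)"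
      by (rule continuous_open_preimage[OF smooth_on_imp_continuous_on[OF vec_holomorphic_on_smooth[OF T]]
          vec_holomorphic_on_components(1)[OF T] B(1)])
    moreover have "\<psi> ` (V \<inter> U) \<inter> (\<lambda>z. \<phi> (inv_into V \<psi> z)) -` B = \<psi> ` (V \<inter> inv_into U \<phi> ` B)"
      unfolding im using inv_into_f_f[OF atlas_chart(1)[OF A(1) V]] by auto
    ultimately show ?thesis by simp
  qed
  moreover have "inv_into U \<phi> ` B \<subseteq> points A" using im A(2) by (auto simp: points_def)
  ultimately show ?thesis unfolding openin_manifold_topology[OF A(1)] by auto
qed

lemma continuous_map_inv_chart:
  assumes A: "holomorphic_atlas A" "(U, \<phi>) \<in> A"
  shows "continuous_map (top_of_set (\<phi> ` U)) (manifold_topology A) (inv_into U \<phi>)"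
  unfolding continuous_map_def topspace_manifold[OF A(1)]
proof (intro conjI allI impI)
  show "inv_into U \<phi> \<in> topspace (top_of_set (\<phi> ` U)) \<rightarrow> points A"
  proof (rule Pi_I)
    fix z assume "z \<in> topspace (top_of_set (\<phi> ` U))"
    then have "inv_into U \<phi> z \<in> U" by (simp add: inv_into_into)
    then show "inv_into U \<phi> z \<in> points A" using A(2) by (auto simp: points_def)
  qed
  fix O' assume "openin (manifold_topology A) O'"
  then have "open (\<phi> ` (U \<inter> O'))" by (rule openin_atlas_image[OF A])
  moreover have "{z \<in> topspace (top_of_set (\<phi> ` U)). inv_into U \<phi> z \<in> O'} = \<phi> ` (U \<inter> O')"
    using chart_image_eq[OF atlas_chart(1)[OF A]] by simp
  ultimately show "openin (top_of_set (\<phi> ` U)) {z \<in> topspace (top_of_set (\<phi> ` U)). inv_into U \<phi> z \<in> O'}"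
    by (simp add: open_openin_trans) (metis Int_lower1 image_mono openin_open_eq atlas_chart(2)[OF A])
qed

text \<open>The transition in the other direction is an inverse, so by the chain rule the
  differential has trivial kernel.\<close>

lemma dd_transition_nonzero:
  assumes A: "holomorphic_atlas A" "(U, \<phi>) \<in> A" "(V, \<psi>) \<in> A" and z: "z \<in> \<phi> ` (U \<inter> V)" and v: "v \<noteq> 0"
  shows "dd v (\<lambda>z. \<psi> (inv_into U \<phi> z)) z \<noteq> 0"
proof
  define T where "T = (\<lambda>z. \<psi> (inv_into U \<phi> z))"
  define T' where "T' = (\<lambda>z. \<phi> (inv_into V \<psi> z))"
  have T: "vec_holomorphic_on T (\<phi> ` (U \<inter> V))" unfolding T_def by (rule atlas_transition[OF A])
  have T': "vec_holomorphic_on T' (\<psi> ` (V \<inter> U))" unfolding T'_def by (rule atlas_transition[OF A(1,3,2)])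
  have inv: "T' (T y) = y" "T y \<in> \<psi> ` (V \<inter> U)" if "y \<in> \<phi> ` (U \<inter> V)" for y
    using that inv_into_f_f[OF atlas_chart(1)[OF A(1,2)]] inv_into_f_f[OF atlas_chart(1)[OF A(1,3)]]
    by (auto simp: T_def T'_def)
  assume "dd v (\<lambda>z. \<psi> (inv_into U \<phi> z)) z = 0"
  then have "dd v T z = 0" by (simp add: T_def)
  then have "dd v (\<lambda>z. T' (T z)) z = 0"
    unfolding dd_compose[OF vec_holomorphic_on_components(1)[OF T'] vec_holomorphic_on_smooth[OF T'] inv(2)[OF z]
        vec_holomorphic_on_smooth[OF T] z]
    using dd_zero[OF vec_holomorphic_on_smooth[OF T'] inv(2)[OF z]] by simp
  moreover have "dd v (\<lambda>z. T' (T z)) z = dd v (\<lambda>z. z) z"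
    by (rule dd_cong[OF vec_holomorphic_on_components(1)[OF T] z inv(1)])
  moreover have "dd v (\<lambda>z. z) z = v" by (rule dd_eqI) (rule has_derivative_ident)
  ultimately show False using v by simp
qed

text \<open>Continuity is a consequence of the local condition: the coordinate expressions are
  continuous on open sets, and the target charts cover.\<close>

lemma holomorphic_mapI:
  assumes A: "holomorphic_atlas A" and B: "holomorphic_atlas B" and f: "f ` points A \<subseteq> points B"
    and hol: "\<And>U \<phi> V \<psi>. (U, \<phi>) \<in> A \<Longrightarrow> (V, \<psi>) \<in> B \<Longrightarrow>
      vec_holomorphic_on (\<lambda>z. \<psi> (f (inv_into U \<phi> z))) (\<phi> ` (U \<inter> f -` V))"
  shows "holomorphic_map A B f"
  unfolding holomorphic_map_def
proof (intro conjI)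
  show "\<forall>(U, \<phi>)\<in>A. \<forall>(V, \<psi>)\<in>B. vec_holomorphic_on (\<psi> \<circ> f \<circ> inv_into U \<phi>) (\<phi> ` (U \<inter> f -` V))"
    using hol by (auto simp: comp_def)
  show "continuous_map (manifold_topology A) (manifold_topology B) f"
    unfolding continuous_map_def topspace_manifold[OF A] topspace_manifold[OF B]
  proof (intro conjI allI impI)
    show "f \<in> points A \<rightarrow> points B" using f by blast
    fix O' assume O: "openin (manifold_topology B) O'"
    have OB: "O' \<subseteq> points B" using openin_subset[OF O] topspace_manifold[OF B] by simp
    have "open (\<phi> ` (U \<inter> {x \<in> points A. f x \<in> O'}))" if U: "(U, \<phi>) \<in> A" for U \<phi>
    proof -
      have "open (\<phi> ` (U \<inter> f -` (V \<inter> O')))" if V: "(V, \<psi>) \<in> B" for V \<psi>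
      proof -
        note h = hol[OF U V]
        have "open (\<phi> ` (U \<inter> f -` V) \<inter> (\<lambda>z. \<psi> (f (inv_into U \<phi> z))) -` (\<psi> ` (V \<inter> O')))"
          by (rule continuous_open_preimage[OF smooth_on_imp_continuous_on[OF vec_holomorphic_on_smooth[OF h]]
             vec_holomorphic_on_components(1)[OF h] openin_atlas_image[OF B V O]])
        moreover have "\<phi> ` (U \<inter> f -` V) \<inter> (\<lambda>z. \<psi> (f (inv_into U \<phi> z))) -` (\<psi> ` (V \<inter> O')) = \<phi> ` (U \<inter> f -` (V \<inter> O'))"
          using inv_into_f_f[OF atlas_chart(1)[OF A U]] inj_onD[OF atlas_chart(1)[OF B V]] by fastforce
        ultimately show ?thesis by simp
      qed
      moreover have "\<phi> ` (U \<inter> {x \<in> points A. f x \<in> O'}) = (\<Union>(V, \<psi>)\<in>B. \<phi> ` (U \<inter> f -` (V \<inter> O')))"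
        using U OB by (fastforce simp: points_def)
      ultimately show ?thesis by auto
    qed
    then show "openin (manifold_topology A) {x \<in> points A. f x \<in> O'}"
      unfolding openin_manifold_topology[OF A] by auto
  qed
qed

lemma holomorphic_atlas_restrict:
  assumes A: "holomorphic_atlas A" and W: "openin (manifold_topology A) W"
  shows "holomorphic_atlas (restrict_atlas A W)"
proof -
  have 1: "inj_on \<phi> (U \<inter> W) \<and> open (\<phi> ` (U \<inter> W))" if "(U, \<phi>) \<in> A" for U \<phi>
    using atlas_chart(1)[OF A that] openin_atlas_image[OF A that W] inj_on_subset by blast
  have 2: "vec_holomorphic_on (\<psi> \<circ> inv_into (U \<inter> W) \<phi>) (\<phi> ` (U \<inter> W \<inter> (V \<inter> W)))"
    if U: "(U, \<phi>) \<in> A" and V: "(V, \<psi>) \<in> A" for U \<phi> V \<psi>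
  proof -
    have "openin (manifold_topology A) (V \<inter> W)" by (intro openin_Int openin_chart_domain[OF A V] W)
    from openin_atlas_image[OF A U this] have op: "open (\<phi> ` (U \<inter> W \<inter> (V \<inter> W)))" by (simp add: Int_ac)
    show ?thesis
    proof (rule vec_holomorphic_on_cong[OF _ vec_holomorphic_on_subset[OF atlas_transition[OF A U V] op]])
      fix z assume "z \<in> \<phi> ` (U \<inter> W \<inter> (V \<inter> W))"
      then obtain x where x: "x \<in> U \<inter> W" "z = \<phi> x" by blast
      have i: "inj_on \<phi> (U \<inter> W)" using 1[OF U] by simp
      show "\<psi> (inv_into U \<phi> z) = (\<psi> \<circ> inv_into (U \<inter> W) \<phi>) z"
        unfolding x(2) comp_def using inv_into_f_f[OF i x(1)] inv_into_f_f[OF atlas_chart(1)[OF A U], of x] x(1) by simp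
    qed blast
  qed
  show ?thesis
    unfolding holomorphic_atlas_def restrict_atlas_def using 1 2 by (auto split: prod.splits)
qed

text \<open>In any chart of the total space the section has as base coordinates a transition map,
  and as fibre coordinate \<open>g\<close> times a transition function.\<close>

lemma holomorphic_section_frame:
  fixes S :: "('a, 'm::finite) atlas" and E :: "('a, 'e, 1) vbundle"
  assumes S: "holomorphic_atlas S" and E: "holomorphic_line_bundle S E" and U0: "(U0, \<tau>0) \<in> trivs E"
    and N: "openin (manifold_topology S) N" "N \<subseteq> U0"
    and g: "\<And>W \<phi>. (W, \<phi>) \<in> S \<Longrightarrow> holo_fun (\<lambda>z. g (inv_into W \<phi> z)) (\<phi> ` (W \<inter> N))"
  shows "holomorphic_section_on S E N (\<lambda>x. frame E \<tau>0 x (g x *s e1))"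
  unfolding holomorphic_section_on_def
proof (intro conjI ballI)
  define l where "l = (\<lambda>x. frame E \<tau>0 x (g x *s e1))"
  have fr: "l x \<in> fibre E x" "l x \<in> total E" "proj E (l x) = x" if "x \<in> N" for x
    unfolding l_def using frame_props(1,5,6)[OF E U0, of x] that N(2) by blast+
  then show "\<And>x. x \<in> N \<Longrightarrow> frame E \<tau>0 x (g x *s e1) \<in> fibre E x" by (simp add: l_def)
  have NS: "N \<subseteq> points S" using N(2) triv_props(2)[OF E U0] by blast
  have pts: "points (restrict_atlas S N) = N"
    using NS by (auto simp: points_def restrict_atlas_def)
  have "holomorphic_map (restrict_atlas S N) (total_atlas S E) l"
  proof (rule holomorphic_mapI[OF holomorphic_atlas_restrict[OF S N(1)] holomorphic_atlas_total[OF S E]])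
    show "l ` points (restrict_atlas S N) \<subseteq> points (total_atlas S E)"
    proof (clarsimp simp: pts)
      fix x assume x: "x \<in> N"
      then obtain W \<phi> where W: "(W, \<phi>) \<in> S" "x \<in> W" using NS by (auto simp: points_def)
      have "(total_dom E (W \<inter> U0), total_chart E \<phi> \<tau>0) \<in> total_atlas S E"
        unfolding total_atlas_iff using W(1) U0 by blast
      moreover have "l x \<in> total_dom E (W \<inter> U0)" using fr[OF x] x W N(2) by (auto simp: total_dom_def)
      ultimately show "l x \<in> points (total_atlas S E)" unfolding points_def by blast
    qed
  next
    fix Y \<phi> X \<kappa> assume "(Y, \<phi>) \<in> restrict_atlas S N" and X: "(X, \<kappa>) \<in> total_atlas S E"
    then obtain W where W: "(W, \<phi>) \<in> S" "Y = W \<inter> N" by (auto simp: restrict_atlas_def)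
    obtain W' \<phi>' U' \<tau>' where 1: "(W', \<phi>') \<in> S" "(U', \<tau>') \<in> trivs E" "X = total_dom E (W' \<inter> U')" "\<kappa> = total_chart E \<phi>' \<tau>'"
      using X unfolding total_atlas_iff by blast
    note inj = atlas_chart(1)[OF S W(1)]
    define D where "D = \<phi> ` (W \<inter> (N \<inter> (W' \<inter> U')))"
    have dom: "Y \<inter> l -` X = W \<inter> (N \<inter> (W' \<inter> U'))"
      using fr unfolding W(2) 1(3) total_dom_def by auto
    have "openin (manifold_topology S) (N \<inter> (W' \<inter> U'))"
      by (intro openin_Int N(1) openin_chart_domain[OF S 1(1)] triv_props(1)[OF E 1(2)])
    then have oD: "open D" unfolding D_def by (rule openin_atlas_image[OF S W(1)])
    have x: "inv_into W \<phi> z \<in> N" "inv_into W \<phi> z \<in> W'" "inv_into W \<phi> z \<in> U'" "inv_into Y \<phi> z = inv_into W \<phi> z"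
      if "z \<in> D" for z
      using inv_chart_in[OF inj that[unfolded D_def]] inv_into_inter[OF inj, of z N] that
      by (auto simp: D_def W(2))
    have comp: "holo_fun (\<lambda>z. \<kappa> (l (inv_into Y \<phi> z)) $ i) D" for i
    proof (cases i)
      case (Inl j)
      have "holo_fun (\<lambda>z. \<phi>' (inv_into W \<phi> z) $ j) D"
        by (rule holo_fun_subset[OF vec_holomorphic_on_components(2)[OF atlas_transition[OF S W(1) 1(1)]]]) (auto simp: D_def)
      then show ?thesis
        by (rule holo_fun_cong[OF oD, rotated]) (simp add: Inl 1(4) total_chart_def x fr)
    next
      case (Inr k)
      have "holo_fun (\<lambda>z. g (inv_into W \<phi> z) * \<tau>' (frame E \<tau>0 (inv_into W \<phi> z) e1) $ k) D"
        by (intro holo_fun_mult holo_fun_subset[OF g[OF W(1)]] holo_fun_subset[OF triv_transition(2)[OF E U0 1(2) W(1)]])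
          (use N(2) in \<open>auto simp: D_def\<close>)
      moreover have "g (inv_into W \<phi> z) * \<tau>' (frame E \<tau>0 (inv_into W \<phi> z) e1) $ k = \<kappa> (l (inv_into Y \<phi> z)) $ i"
        if "z \<in> D" for z
        unfolding x(4)[OF that] Inr 1(4) total_chart_def l_def
        using triv_transition(1)[OF E U0 1(2), of "inv_into W \<phi> z" "g (inv_into W \<phi> z) *s e1"] x[OF that] N(2) by auto
      ultimately show ?thesis by (rule holo_fun_cong[OF oD, rotated])
    qed
    show "vec_holomorphic_on (\<lambda>z. \<kappa> (l (inv_into Y \<phi> z))) (\<phi> ` (Y \<inter> l -` X))"
      unfolding dom D_def[symmetric] by (rule vec_holomorphic_onI[OF oD comp])
  qed
  then show "holomorphic_map (restrict_atlas S N) (total_atlas S E) (\<lambda>x. frame E \<tau>0 x (g x *s e1))"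
    by (simp add: l_def)
qed

lemma inv_into_id: "x \<in> A \<Longrightarrow> inv_into A id x = x"
  using inv_into_f_f[of id A x] by simp

lemma unit_ball_atlas:
  "holomorphic_atlas (unit_ball_atlas :: (complex^'m::finite, 'm) atlas)"
  "points (unit_ball_atlas :: (complex^'m, 'm) atlas) = ball 0 1"
  "manifold_topology (unit_ball_atlas :: (complex^'m, 'm) atlas) = top_of_set (ball 0 1)"
proof -
  have "vec_holomorphic_on (\<lambda>z. z) (ball (0 :: complex^'m) 1)"
    by (rule vec_holomorphic_onI) (simp_all add: holo_fun_component)
  then have "vec_holomorphic_on (id \<circ> inv_into (ball 0 1) id) (ball (0 :: complex^'m) 1)"
    by (rule vec_holomorphic_on_cong[rotated]) (simp add: inv_into_id)
  then show A: "holomorphic_atlas (unit_ball_atlas :: (complex^'m, 'm) atlas)"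
    unfolding holomorphic_atlas_def unit_ball_atlas_def by simp
  show p: "points (unit_ball_atlas :: (complex^'m, 'm) atlas) = ball 0 1"
    by (simp add: points_def unit_ball_atlas_def)
  show "manifold_topology (unit_ball_atlas :: (complex^'m, 'm) atlas) = top_of_set (ball 0 1)"
    unfolding topology_eq openin_manifold_topology[OF A] p unfolding unit_ball_atlas_def
    by (auto simp: openin_open_eq Int_absorb1)
qed

text \<open>The map is a dilation followed by an inverse chart. Its coordinate expressions are
  transition maps after the dilation, hence immersive, and it is a topological embedding because it
  is injective and open.\<close>

lemma holomorphic_embedding_inv_chart:
  fixes S :: "('a, 'm::finite) atlas"
  assumes S: "holomorphic_atlas S" and W0: "(W0, \<phi>0) \<in> S" and r: "r > 0" and sub: "ball z0 r \<subseteq> \<phi>0 ` W0"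
  shows "holomorphic_embedding unit_ball_atlas S (\<lambda>\<zeta>. inv_into W0 \<phi>0 (z0 + r *\<^sub>R \<zeta>))"
proof -
  define \<epsilon> where "\<epsilon> = (\<lambda>\<zeta>. inv_into W0 \<phi>0 (z0 + r *\<^sub>R \<zeta>))"
  define a where "a = (\<lambda>\<zeta> :: complex^'m. z0 + r *\<^sub>R \<zeta>)"
  note inj0 = atlas_chart(1)[OF S W0]
  have a_ball: "a \<zeta> \<in> \<phi>0 ` W0" if "\<zeta> \<in> ball 0 1" for \<zeta>
    using sub that r by (force simp: a_def dist_norm)
  have \<epsilon>_in: "\<epsilon> \<zeta> \<in> W0" "\<phi>0 (\<epsilon> \<zeta>) = a \<zeta>" if "\<zeta> \<in> ball 0 1" for \<zeta>
    using inv_into_into[OF a_ball[OF that]] f_inv_into_f[OF a_ball[OF that]] by (simp_all add: \<epsilon>_def a_def)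
  have c\<epsilon>: "continuous_map (top_of_set (ball 0 1)) (manifold_topology S) \<epsilon>"
  proof -
    have "continuous_map (top_of_set (ball 0 1)) (top_of_set (\<phi>0 ` W0)) a"
      using a_ball by (auto simp: continuous_map_in_subtopology a_def intro!: continuous_intros)
    from continuous_map_compose[OF this continuous_map_inv_chart[OF S W0]]
    show ?thesis by (simp add: \<epsilon>_def a_def comp_def)
  qed
  have da: "(a has_derivative (\<lambda>h. r *\<^sub>R h)) (at \<zeta>)" for \<zeta>
    unfolding a_def by (auto intro!: derivative_eq_intros)
  have va: "vec_holomorphic_on a D" if "open D" for D
    unfolding vec_holomorphic_on_def complex_linear_def
    using da that by (auto intro!: exI[of _ "\<lambda>h. r *\<^sub>R h"] simp: scaleR_add_right vec_eq_iff)
  have dom: "ball 0 1 \<inter> \<epsilon> -` V = ball 0 1 \<inter> a -` (\<phi>0 ` (W0 \<inter> V))" for V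
    unfolding chart_image_eq[OF inj0] using a_ball by (auto simp: \<epsilon>_def a_def)
  have oD: "open (ball 0 1 \<inter> \<epsilon> -` V)" if "(V, \<psi>) \<in> S" for V \<psi>
    unfolding dom
    by (rule continuous_open_preimage[OF _ open_ball openin_atlas_image[OF S W0 openin_chart_domain[OF S that]]])
      (auto simp: a_def intro!: continuous_intros)
  have comp: "\<psi> (inv_into W0 \<phi>0 (a \<zeta>)) = \<psi> (\<epsilon> (inv_into (ball 0 1) id \<zeta>))" if "\<zeta> \<in> ball 0 1" for \<psi> :: "'a \<Rightarrow> complex^'m" and \<zeta>
    unfolding inv_into_id[OF that] by (simp add: \<epsilon>_def a_def)
  have hol: "vec_holomorphic_on (\<lambda>\<zeta>. \<psi> (\<epsilon> (inv_into (ball 0 1) id \<zeta>))) (ball 0 1 \<inter> \<epsilon> -` V)"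
    if V: "(V, \<psi>) \<in> S" for V \<psi>
  proof (rule vec_holomorphic_on_cong)
    show "vec_holomorphic_on (\<lambda>\<zeta>. \<psi> (inv_into W0 \<phi>0 (a \<zeta>))) (ball 0 1 \<inter> \<epsilon> -` V)"
      by (rule vec_holomorphic_on_compose[OF atlas_transition[OF S W0 V] va[OF oD[OF V]]]) (use dom in auto)
  qed (use comp in blast)
  have map: "holomorphic_map unit_ball_atlas S \<epsilon>"
  proof (rule holomorphic_mapI[OF unit_ball_atlas(1) S])
    show "\<epsilon> ` points unit_ball_atlas \<subseteq> points S"
      using \<epsilon>_in(1) W0 unfolding unit_ball_atlas(2) by (auto simp: points_def)
    show "vec_holomorphic_on (\<lambda>z. \<psi> (\<epsilon> (inv_into U \<phi> z))) (\<phi> ` (U \<inter> \<epsilon> -` V))"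
      if "(U, \<phi>) \<in> unit_ball_atlas" "(V, \<psi>) \<in> S" for U \<phi> V \<psi>
      using hol[OF that(2)] that(1) by (simp add: unit_ball_atlas_def)
  qed
  have inj_d: "inj (frechet_derivative (\<psi> \<circ> \<epsilon> \<circ> inv_into (ball 0 1) id) (at p))"
    if V: "(V, \<psi>) \<in> S" and p: "p \<in> ball 0 1 \<inter> \<epsilon> -` V" for V \<psi> p
  proof -
    define f where "f = \<psi> \<circ> \<epsilon> \<circ> inv_into (ball 0 1) id"
    have sf: "smooth_on (ball 0 1 \<inter> \<epsilon> -` V) f"
      using vec_holomorphic_on_smooth[OF hol[OF V]] by (simp add: f_def comp_def)
    note T = atlas_transition[OF S W0 V]
    have ap: "a p \<in> \<phi>0 ` (W0 \<inter> V)" using p dom by blast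
    have "v = 0" if "dd v f p = 0" for v
    proof (rule ccontr)
      assume "v \<noteq> 0"
      then have nz: "dd (r *\<^sub>R v) (\<lambda>z. \<psi> (inv_into W0 \<phi>0 z)) (a p) \<noteq> 0"
        using r by (intro dd_transition_nonzero[OF S W0 V ap]) auto
      have "dd v f p = dd v (\<lambda>\<zeta>. \<psi> (inv_into W0 \<phi>0 (a \<zeta>))) p"
        by (rule dd_cong[OF oD[OF V] p]) (simp add: f_def comp)
      also have "\<dots> = dd (r *\<^sub>R v) (\<lambda>z. \<psi> (inv_into W0 \<phi>0 z)) (a p)"
        by (rule dd_eqI[OF has_derivative_compose[OF da dd_has_derivative[OF vec_holomorphic_on_smooth[OF T] ap]]])
      finally show False using nz that by simp
    qed
    then have "inj (\<lambda>v. dd v f p)" using linear_injective_0[OF dd_linear[OF sf p]] by blast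
    then show ?thesis by (simp add: dd_def f_def)
  qed
  have emb: "embedding_map (manifold_topology unit_ball_atlas) (manifold_topology S) \<epsilon>"
    unfolding unit_ball_atlas(3)
  proof (rule injective_open_imp_embedding_map[OF c\<epsilon>])
    show "open_map (top_of_set (ball 0 1)) (manifold_topology S) \<epsilon>"
      unfolding open_map_def
    proof (intro allI impI)
      fix O' assume "openin (top_of_set (ball (0 :: complex^'m) 1)) O'"
      then have O: "open O'" "O' \<subseteq> ball 0 1" by (simp_all add: openin_open_eq)
      have "a ` O' = (+) z0 ` ((*\<^sub>R) r ` O')" by (auto simp: a_def)
      then have "open (a ` O')" using open_translation[OF open_scaling[OF _ O(1), of r]] r by simp
      moreover have "a ` O' \<subseteq> \<phi>0 ` W0" using a_ball O(2) by blast
      ultimately have "openin (manifold_topology S) (inv_into W0 \<phi>0 ` (a ` O'))"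
        by (rule openin_inv_chart_image[OF S W0])
      then show "openin (manifold_topology S) (\<epsilon> ` O')" by (simp add: image_image \<epsilon>_def a_def)
    qed
    show "inj_on \<epsilon> (topspace (top_of_set (ball 0 1)))"
    proof (rule inj_onI)
      fix \<zeta> \<xi> assume "\<zeta> \<in> topspace (top_of_set (ball 0 1))" "\<xi> \<in> topspace (top_of_set (ball 0 1))" "\<epsilon> \<zeta> = \<epsilon> \<xi>"
      then have "a \<zeta> = a \<xi>" using \<epsilon>_in(2)[of \<zeta>] \<epsilon>_in(2)[of \<xi>] by simp
      then show "\<zeta> = \<xi>" using r by (simp add: a_def)
    qed
  qed
  show ?thesis
    unfolding \<epsilon>_def[symmetric] holomorphic_embedding_def
    using map emb inj_d unfolding unit_ball_atlas_def by auto
qed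

text \<open>The correction is log |c|^2 for the transition function c, hence pluriharmonic; the
  Laplacian of the potential therefore does not depend on the frame.\<close>

lemma metric_pot_change_frame:
  assumes E: "holomorphic_line_bundle S E" "(U, \<tau>) \<in> trivs E" "(U0, \<tau>0) \<in> trivs E" "x \<in> U" "x \<in> U0"
    and h: "hermitian_metric S E h"
  shows "\<tau> (frame E \<tau>0 x e1) $ 1 \<noteq> 0"
    "metric_pot E h \<tau> x = metric_pot E h \<tau>0 x + ln ((cmod (\<tau> (frame E \<tau>0 x e1) $ 1))\<^sup>2)"
proof -
  define b where "b = \<tau> (frame E \<tau>0 x e1)"
  have "frame E \<tau> x b = frame E \<tau>0 x e1"
    unfolding b_def by (rule frame_props(3)[OF E(1,2,4) frame_props(1)[OF E(1,3,5)]])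
  then have eq: "h (frame E \<tau>0 x e1) = (cmod (b $ 1))\<^sup>2 * h (frame E \<tau> x e1)"
    using metric_frame(2)[OF E(1,2,4) h, of b] by simp
  then show nz: "\<tau> (frame E \<tau>0 x e1) $ 1 \<noteq> 0"
    using metric_frame(1)[OF E(1,3,5) h] by (auto simp: b_def)
  show "metric_pot E h \<tau> x = metric_pot E h \<tau>0 x + ln ((cmod (\<tau> (frame E \<tau>0 x e1) $ 1))\<^sup>2)"
    unfolding metric_pot_def eq b_def[symmetric]
    using metric_frame(1)[OF E(1,2,4) h] nz by (simp add: ln_mult b_def)
qed

section \<open>Conformal change of a metric and its extension from a coordinate ball\<close>

lemma hermitian_metric_conformal:
  assumes "hermitian_metric S E h"
  shows "hermitian_metric S E (\<lambda>v. h v * exp (- \<rho> (proj E v)))"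
  unfolding hermitian_metric_def
proof
  fix x assume "x \<in> points S"
  then obtain H where H: "positive_hermitian_form E x H" "\<forall>v\<in>fibre E x. of_real (h v) = H v v"
    using assms unfolding hermitian_metric_def by meson
  define H' where "H' = (\<lambda>u v. of_real (exp (- \<rho> x)) * H u v)"
  have "positive_hermitian_form E x H'"
    unfolding positive_hermitian_form_def
  proof (intro conjI ballI allI impI)
    note P = H(1)[unfolded positive_hermitian_form_def]
    fix u v assume uv: "u \<in> fibre E x" "v \<in> fibre E x"
    note Q = bspec[OF bspec[OF conjunct1[OF P] uv(1)] uv(2)]
    show "H' (fadd E u v) w = H' u w + H' v w" if "w \<in> fibre E x" for w
      unfolding H'_def bspec[OF conjunct1[OF Q] that] by (rule distrib_left)
    show "H' (fscale E c u) v = c * H' u v" for c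
      unfolding H'_def spec[OF conjunct1[OF conjunct2[OF Q]]] by (rule mult.left_commute)
    show "H' v u = cnj (H' u v)"
      unfolding H'_def conjunct2[OF conjunct2[OF Q]] by simp
  next
    fix v assume "v \<in> fibre E x" "v \<noteq> fscale E 0 v"
    then have "Re (H v v) > 0" using H(1) unfolding positive_hermitian_form_def by blast
    then show "Re (H' v v) > 0" by (simp add: H'_def)
  qed
  moreover have "\<forall>v\<in>fibre E x. of_real (h v * exp (- \<rho> (proj E v))) = H' v v"
    using H(2) by (simp add: H'_def fibre_def mult.commute)
  ultimately show "\<exists>H. positive_hermitian_form E x H \<and> (\<forall>v\<in>fibre E x. of_real (h v * exp (- \<rho> (proj E v))) = H v v)"
    by blast
qed

text \<open>By the sign convention for potentials, the factor e^(-\<rho>) adds \<rho>.\<close>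

lemma metric_pot_conformal:
  assumes "holomorphic_line_bundle S E" "(U, \<tau>) \<in> trivs E" "x \<in> U" "hermitian_metric S E h"
  shows "metric_pot E (\<lambda>v. h v * exp (- \<rho> (proj E v))) \<tau> x = metric_pot E h \<tau> x + \<rho> x"
  using metric_frame(1)[OF assms] frame_props(6)[OF assms(1-3), of e1] by (simp add: metric_pot_def ln_mult)

text \<open>Two open sets cover the manifold: \<open>N\<close>, the image of the ball of radius 2 R,
  where the potential is known in the reference chart, and the complement of \<open>K\<close>, the
  image of the closed ball of radius \<open>R\<close>, where the metric is unchanged.
  \<open>P\<close> is the coordinate set on which strictness may fail.\<close>

lemma modified_metric:
  fixes S :: "('a, 'm::finite) atlas" and E :: "('a, 'e, 1) vbundle"
  assumes S: "holomorphic_atlas S" and Haus: "Hausdorff_space (manifold_topology S)"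
    and E: "holomorphic_line_bundle S E" and h0: "hermitian_metric S E h0" and pc: "positively_curved S E h0"
    and W0: "(W0, \<phi>0) \<in> S" and U0: "(U0, \<tau>0) \<in> trivs E" and \<Omega>: "\<Omega> = \<phi>0 ` (W0 \<inter> U0)"
    and sub: "cball z0 (2 * R) \<subseteq> \<Omega>" and R: "R > 0" and s\<rho>: "smooth_on \<Omega> \<rho>0"
    and zero: "\<And>z. z \<in> cball z0 (2 * R) \<Longrightarrow> z \<notin> cball z0 R \<Longrightarrow> \<rho>0 z = 0"
    and nn: "\<And>z v. z \<in> \<Omega> \<Longrightarrow> lap (\<lambda>z. metric_pot E h0 \<tau>0 (inv_into W0 \<phi>0 z) + \<rho>0 z) z v \<ge> 0"
    and pos: "\<And>z v. z \<in> \<Omega> \<Longrightarrow> z \<notin> P \<Longrightarrow> v \<noteq> 0 \<Longrightarrow> lap (\<lambda>z. metric_pot E h0 \<tau>0 (inv_into W0 \<phi>0 z) + \<rho>0 z) z v > 0"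
    and \<rho>: "\<rho> = (\<lambda>x. if x \<in> inv_into W0 \<phi>0 ` ball z0 (2 * R) then \<rho>0 (\<phi>0 x) else 0)"
    and h: "h = (\<lambda>v. h0 v * exp (- \<rho> (proj E v)))"
  shows "smooth_pot S E h" "semipositively_curved S E h"
    "positively_curved_over S E h (points S - inv_into W0 \<phi>0 ` P)"
proof -
  note inj0 = atlas_chart(1)[OF S W0]
  have hh: "hermitian_metric S E h" unfolding h by (rule hermitian_metric_conformal[OF h0])
  define N where "N = inv_into W0 \<phi>0 ` ball z0 (2 * R)"
  define K where "K = inv_into W0 \<phi>0 ` cball z0 R"
  have \<Omega>W: "\<Omega> \<subseteq> \<phi>0 ` W0" by (auto simp: \<Omega>)
  have o\<Omega>: "open \<Omega>" unfolding \<Omega> by (rule open_triv_image[OF S E U0 W0])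
  have inv\<Omega>: "inv_into W0 \<phi>0 z \<in> W0 \<inter> U0" "\<phi>0 (inv_into W0 \<phi>0 z) = z" if "z \<in> \<Omega>" for z
    using inv_chart_in[OF inj0 that[unfolded \<Omega>]] by auto
  have ball\<Omega>: "ball z0 (2 * R) \<subseteq> \<Omega>" using sub by auto
  have oN: "openin (manifold_topology S) N"
    unfolding N_def by (rule openin_inv_chart_image[OF S W0 open_ball]) (use ball\<Omega> \<Omega>W in blast)
  have N_in: "x \<in> W0 \<inter> U0" "\<phi>0 x \<in> ball z0 (2 * R)" if "x \<in> N" for x
    using that inv\<Omega> ball\<Omega> by (auto simp: N_def)
  have "cball z0 R \<subseteq> cball z0 (2 * R)" using R by auto
  then have "cball z0 R \<subseteq> \<phi>0 ` W0" using sub \<Omega>W by blast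
  \<comment> \<open>The Hausdorff property enters here: \<open>K\<close> is compact, hence closed in
    the whole manifold and not only in the chart. This makes the extension of \<rho> by 0
    smooth.\<close>
  then have "compactin (manifold_topology S) K" unfolding K_def
    by (intro image_compactin[OF _ continuous_map_inv_chart[OF S W0]]) (simp add: compactin_subtopology)
  then have "closedin (manifold_topology S) K" by (rule compactin_imp_closedin[OF Haus])
  then have oK: "openin (manifold_topology S) (points S - K)"
    using topspace_manifold[OF S] by (metis openin_diff openin_topspace)
  have KN: "K \<subseteq> N" unfolding K_def N_def using R by (intro image_mono) auto
  have \<rho>_out: "\<rho> x = 0" if "x \<notin> K" for x
  proof (cases "x \<in> N")
    case True
    have "\<phi>0 x \<notin> cball z0 R"
    proof
      assume "\<phi>0 x \<in> cball z0 R"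
      moreover have "inv_into W0 \<phi>0 (\<phi>0 x) = x" using N_in(1)[OF True] inj0 by simp
      ultimately show False using that unfolding K_def by (metis imageI)
    qed
    then show ?thesis using True N_in(2)[OF True] zero[of "\<phi>0 x"] by (simp add: \<rho> N_def)
  qed (simp add: \<rho> N_def)
  have sp0: "smooth_pot S E h0" by (rule positively_curved_imp_smooth_pot[OF S E h0 pc])
  define \<Phi>0 where "\<Phi>0 = (\<lambda>z. metric_pot E h0 \<tau>0 (inv_into W0 \<phi>0 z) + \<rho>0 z)"
  have s\<Phi>0: "smooth_on \<Omega> \<Phi>0" unfolding \<Phi>0_def
    by (rule smooth_on_add[OF o\<Omega> _ s\<rho>]) (use sp0 W0 U0 in \<open>simp add: smooth_pot_def \<Omega>\<close>)
  have main: "\<exists>V. open V \<and> z \<in> V \<and> smooth_on V (\<lambda>z. metric_pot E h \<tau> (inv_into W \<phi> z)) \<and>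
      (\<forall>v. lap (\<lambda>z. metric_pot E h \<tau> (inv_into W \<phi> z)) z v \<ge> 0 \<and>
        (v \<noteq> 0 \<longrightarrow> inv_into W \<phi> z \<notin> inv_into W0 \<phi>0 ` P \<longrightarrow> lap (\<lambda>z. metric_pot E h \<tau> (inv_into W \<phi> z)) z v > 0))"
    if W: "(W, \<phi>) \<in> S" and U: "(U, \<tau>) \<in> trivs E" and z: "z \<in> \<phi> ` (W \<inter> U)" for W \<phi> U \<tau> z
  proof -
    note inj = atlas_chart(1)[OF S W]
    have pot: "metric_pot E h \<tau> x = metric_pot E h0 \<tau> x + \<rho> x" if "x \<in> U" for x
      unfolding h by (rule metric_pot_conformal[OF E U that h0])
    have xz: "inv_into W \<phi> z \<in> W \<inter> U" by (rule inv_chart_in(1)[OF inj z])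
    define p0 where "p0 = (\<lambda>z. metric_pot E h0 \<tau> (inv_into W \<phi> z))"
    have sp: "smooth_on (\<phi> ` (W \<inter> U)) p0" using sp0 W U by (simp add: smooth_pot_def p0_def)
    show ?thesis
    proof (cases "inv_into W \<phi> z \<in> N")
      case False
      \<comment> \<open>A point outside \<open>N\<close> is outside \<open>K\<close>, and on this
        neighbourhood \<rho> vanishes, so the old metric supplies smoothness and strict
        positivity.\<close>
      define V where "V = \<phi> ` (W \<inter> (U \<inter> (points S - K)))"
      have oV: "open V" unfolding V_def
        by (intro openin_atlas_image[OF S W] openin_Int triv_props(1)[OF E U] oK)
      have zV: "z \<in> V" unfolding V_def chart_image_eq[OF inj]
        using xz z False KN triv_props(2)[OF E U] by auto
      have V_in: "y \<in> \<phi> ` (W \<inter> U)" "inv_into W \<phi> y \<in> U" "inv_into W \<phi> y \<notin> K" if "y \<in> V" for y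
        using inv_chart_in(1)[OF inj that[unfolded V_def]] that by (auto simp: V_def)
      have eq: "metric_pot E h \<tau> (inv_into W \<phi> y) = p0 y" if "y \<in> V" for y
        using pot[OF V_in(2)[OF that]] \<rho>_out[OF V_in(3)[OF that]] by (simp add: p0_def)
      have sV: "smooth_on V p0" by (rule smooth_on_subset[OF sp]) (use V_in in blast)
      have "lap (\<lambda>z. metric_pot E h \<tau> (inv_into W \<phi> z)) z v = lap p0 z v" for v
        by (rule lap_cong[OF oV zV eq])
      moreover have "lap p0 z v > 0" if "v \<noteq> 0" for v
        unfolding p0_def by (rule positively_curved_lap_pos[OF S E h0 pc W U z that])
      moreover have "lap p0 z 0 = 0"
        using dd_zero[OF smooth_on_dd[OF sp] z] by (simp add: lap_def)
      ultimately have "\<forall>v. lap (\<lambda>z. metric_pot E h \<tau> (inv_into W \<phi> z)) z v \<ge> 0 \<and>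
        (v \<noteq> 0 \<longrightarrow> lap (\<lambda>z. metric_pot E h \<tau> (inv_into W \<phi> z)) z v > 0)"
        by (metis less_eq_real_def)
      moreover have "smooth_on V (\<lambda>z. metric_pot E h \<tau> (inv_into W \<phi> z))"
        by (rule smooth_on_cong[OF oV eq[symmetric] sV])
      ultimately show ?thesis using oV zV by blast
    next
      case True
      define V where "V = \<phi> ` (W \<inter> (U \<inter> N))"
      have oV: "open V" unfolding V_def
        by (intro openin_atlas_image[OF S W] openin_Int triv_props(1)[OF E U] oN)
      have zV: "z \<in> V" unfolding V_def chart_image_eq[OF inj] using xz z True by auto
      have V_in: "inv_into W \<phi> y \<in> W" "inv_into W \<phi> y \<in> U" "inv_into W \<phi> y \<in> N" if "y \<in> V" for y
        using inv_chart_in(1)[OF inj that[unfolded V_def]] by auto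
      \<comment> \<open>\<open>T\<close> passes from the given chart to the reference chart. There
        the potential is \<open>\<Phi>0\<close> up to the pluriharmonic change of frame, and a
        nonzero \<open>v\<close> is sent to a nonzero vector.\<close>
      define T where "T = (\<lambda>y. \<phi>0 (inv_into W \<phi> y))"
      have VW0: "V \<subseteq> \<phi> ` (W \<inter> W0)" unfolding V_def using N_in(1) by auto
      have T: "vec_holomorphic_on T V" unfolding T_def
        by (rule vec_holomorphic_on_subset[OF atlas_transition[OF S W W0] oV VW0])
      have TV: "T ` V \<subseteq> \<Omega>" using N_in(2) V_in(3) ball\<Omega> by (auto simp: T_def)
      define c where "c = (\<lambda>y. \<tau> (frame E \<tau>0 (inv_into W \<phi> y) e1) $ 1)"
      have hc: "holo_fun c V" unfolding c_def
        by (rule holo_fun_subset[OF triv_transition(2)[OF E U0 U W]]) (use N_in(1) in \<open>auto simp: V_def\<close>)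
      have cnz: "c y \<noteq> 0" if "y \<in> V" for y
        unfolding c_def using metric_pot_change_frame(1)[OF E U U0 V_in(2)[OF that] _ h0] N_in(1)[OF V_in(3)[OF that]] by blast
      have eq: "metric_pot E h \<tau> (inv_into W \<phi> y) = \<Phi>0 (T y) + ln ((cmod (c y))\<^sup>2)" if "y \<in> V" for y
      proof -
        define x where "x = inv_into W \<phi> y"
        have x: "x \<in> U" "x \<in> N" "x \<in> W0" "x \<in> U0" using V_in[OF that] N_in(1) by (auto simp: x_def)
        have "\<rho> x = \<rho>0 (\<phi>0 x)" using x(2) by (simp add: \<rho> N_def)
        moreover have "inv_into W0 \<phi>0 (\<phi>0 x) = x" using x(3) inj0 by simp
        ultimately show ?thesis
          using pot[OF x(1)] metric_pot_change_frame(2)[OF E U U0 x(1,4) h0]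
          by (simp add: \<Phi>0_def T_def c_def x_def[symmetric])
      qed
      have s1: "smooth_on V (\<lambda>y. \<Phi>0 (T y))"
        by (rule smooth_on_compose[OF oV o\<Omega> TV s\<Phi>0 vec_holomorphic_on_smooth[OF T]])
      have s2: "smooth_on V (\<lambda>y. ln ((cmod (c y))\<^sup>2))"
        by (rule smooth_on_ln_cmod_sq_holo_fun[OF oV hc cnz])
      have sm: "smooth_on V (\<lambda>z. metric_pot E h \<tau> (inv_into W \<phi> z))"
        by (rule smooth_on_cong[OF oV eq[symmetric] smooth_on_add[OF oV s1 s2]])
      have l: "lap (\<lambda>z. metric_pot E h \<tau> (inv_into W \<phi> z)) z v = lap \<Phi>0 (T z) (dd v T z)" for v
      proof -
        have "lap (\<lambda>z. metric_pot E h \<tau> (inv_into W \<phi> z)) z v = lap (\<lambda>y. \<Phi>0 (T y) + ln ((cmod (c y))\<^sup>2)) z v"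
          by (rule lap_cong[OF oV zV eq])
        also have "\<dots> = lap (\<lambda>y. \<Phi>0 (T y)) z v + 0"
          unfolding lap_add[OF oV s1 s2 zV] lap_ln_cmod_sq_holo_fun[OF oV hc zV cnz[OF zV]] ..
        also have "lap (\<lambda>y. \<Phi>0 (T y)) z v = lap \<Phi>0 (T z) (dd v T z)"
          by (rule lap_compose_holomorphic[OF o\<Omega> s\<Phi>0 TV T zV])
        finally show ?thesis by simp
      qed
      have Tz: "T z \<in> \<Omega>" using TV zV by blast
      have "lap \<Phi>0 (T z) (dd v T z) > 0" if v: "v \<noteq> 0" and P: "inv_into W \<phi> z \<notin> inv_into W0 \<phi>0 ` P" for v
        unfolding \<Phi>0_def
      proof (rule pos[OF Tz])
        have "inv_into W0 \<phi>0 (T z) = inv_into W \<phi> z"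
          using N_in(1)[OF True] inj0 by (simp add: T_def)
        then show "T z \<notin> P" using P by (metis imageI)
        show "dd v T z \<noteq> 0" unfolding T_def
          by (rule dd_transition_nonzero[OF S W W0 _ v]) (use VW0 zV in blast)
      qed
      moreover have "lap \<Phi>0 (T z) (dd v T z) \<ge> 0" for v
        unfolding \<Phi>0_def by (rule nn[OF Tz])
      ultimately show ?thesis unfolding l using oV zV sm by blast
    qed
  qed
  show sm: "smooth_pot S E h"
    unfolding smooth_pot_def
  proof (intro allI impI smooth_on_local)
    fix W \<phi> U \<tau> z assume "(W, \<phi>) \<in> S" "(U, \<tau>) \<in> trivs E" "z \<in> \<phi> ` (W \<inter> U)"
    from main[OF this] show "\<exists>V. open V \<and> z \<in> V \<and> smooth_on V (\<lambda>z. metric_pot E h \<tau> (inv_into W \<phi> z))" by blast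
  qed
  show "semipositively_curved S E h"
  proof (rule semipositively_curvedI[OF S E hh sm])
    fix W \<phi> U \<tau> z v assume "(W, \<phi>) \<in> S" "(U, \<tau>) \<in> trivs E" "z \<in> \<phi> ` (W \<inter> U)"
    from main[OF this] show "lap (\<lambda>z. metric_pot E h \<tau> (inv_into W \<phi> z)) z v \<ge> 0" by blast
  qed
  show "positively_curved_over S E h (points S - inv_into W0 \<phi>0 ` P)"
  proof (rule positively_curved_overI[OF S E hh sm])
    fix W \<phi> U \<tau> z v assume 1: "(W, \<phi>) \<in> S" "(U, \<tau>) \<in> trivs E" "z \<in> \<phi> ` (W \<inter> U)"
      and 2: "inv_into W \<phi> z \<in> points S - inv_into W0 \<phi>0 ` P" "v \<noteq> (0 :: complex^'m)"
    from main[OF 1] 2 show "lap (\<lambda>z. metric_pot E h \<tau> (inv_into W \<phi> z)) z v > 0" by blast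
  qed
qed

theorem lemma5p1:
  fixes S :: "('a, 'm::finite) atlas"
    and \<iota> :: "'a \<Rightarrow> (complex^('n::finite option)) set"
    and \<Lambda> :: "('a, 'e, 1) vbundle"
    and \<sigma> \<sigma>' :: real
  assumes "projective_algebraic_manifold S \<iota>"
    and "points S \<noteq> {}"
    and "holomorphic_line_bundle S \<Lambda>"
    and "\<exists>h\<^sub>0. hermitian_metric S \<Lambda> h\<^sub>0 \<and> positively_curved S \<Lambda> h\<^sub>0"
    and "0 < \<sigma>" and "\<sigma> < \<sigma>'" and "\<sigma>' < 1"
  shows "\<exists>(h :: 'e \<Rightarrow> real) (\<epsilon> :: complex^'m \<Rightarrow> 'a) (l :: 'a \<Rightarrow> 'e).
     hermitian_metric S \<Lambda> h \<and> smooth_metric S \<Lambda> h \<and> semipositively_curved S \<Lambda> h \<and>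
     holomorphic_embedding unit_ball_atlas S \<epsilon> \<and>
     holomorphic_section_on S \<Lambda> (\<epsilon> ` ball 0 1) l \<and>
     (\<forall>x\<in>\<epsilon> ` ball 0 \<sigma>. h (l x) = 1) \<and>
     positively_curved_over S \<Lambda> h (points S - \<epsilon> ` ball 0 \<sigma>')"
proof -
  have S: "holomorphic_atlas S" and Haus: "Hausdorff_space (manifold_topology S)"
    using assms(1) by (auto simp: projective_algebraic_manifold_def complex_manifold_def)
  note E = assms(3)
  obtain h0 where h0: "hermitian_metric S \<Lambda> h0" and pc: "positively_curved S \<Lambda> h0"
    using assms(4) by blast
  obtain x0 where x0: "x0 \<in> points S" using assms(2) by blast
  then obtain W0 \<phi>0 where W0: "(W0, \<phi>0) \<in> S" "x0 \<in> W0" by (auto simp: points_def)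
  have "points S = (\<Union>(U, \<tau>)\<in>trivs \<Lambda>. U)"
    using E unfolding holomorphic_vector_bundle_def by (elim conjE)
  then obtain U0 \<tau>0 where U0: "(U0, \<tau>0) \<in> trivs \<Lambda>" "x0 \<in> U0" using x0 by auto
  note inj0 = atlas_chart(1)[OF S W0(1)]
  define \<Omega> where "\<Omega> = \<phi>0 ` (W0 \<inter> U0)"
  have o\<Omega>: "open \<Omega>" unfolding \<Omega>_def by (rule open_triv_image[OF S E U0(1) W0(1)])
  define z0 where "z0 = \<phi>0 x0"
  have z0: "z0 \<in> \<Omega>" using W0 U0 by (simp add: z0_def \<Omega>_def)
  define p where "p = (\<lambda>z. metric_pot \<Lambda> h0 \<tau>0 (inv_into W0 \<phi>0 z))"
  have sp: "smooth_on \<Omega> p"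
    using positively_curved_imp_smooth_pot[OF S E h0 pc] W0(1) U0(1) by (simp add: smooth_pot_def p_def \<Omega>_def)
  have lp: "lap p z v > 0" if "z \<in> \<Omega>" "v \<noteq> 0" for z v
    unfolding p_def by (rule positively_curved_lap_pos[OF S E h0 pc W0(1) U0(1) that(1)[unfolded \<Omega>_def] that(2)])
  obtain r R G \<rho>0 where r: "0 < r" "r < R" and sub: "cball z0 (2 * R) \<subseteq> \<Omega>" and G: "holo_fun G UNIV"
    and \<rho>0: "smooth_on \<Omega> \<rho>0" "\<And>z. z \<in> cball z0 (2 * R) \<Longrightarrow> z \<notin> cball z0 R \<Longrightarrow> \<rho>0 z = 0"
    and flat: "\<And>z. z \<in> cball z0 (\<sigma> * r) \<Longrightarrow> p z + \<rho>0 z = Re (G z)"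
    and nn: "\<And>z v. z \<in> \<Omega> \<Longrightarrow> lap (\<lambda>z. p z + \<rho>0 z) z v \<ge> 0"
    and pos: "\<And>z v. z \<in> \<Omega> \<Longrightarrow> z \<notin> ball z0 (\<sigma>' * r) \<Longrightarrow> v \<noteq> 0 \<Longrightarrow> lap (\<lambda>z. p z + \<rho>0 z) z v > 0"
    using local_modification[OF o\<Omega> z0 sp lp assms(5-7)] by blast
  have R: "R > 0" using r by simp
  define \<rho> where "\<rho> = (\<lambda>x. if x \<in> inv_into W0 \<phi>0 ` ball z0 (2 * R) then \<rho>0 (\<phi>0 x) else 0)"
  define h where "h = (\<lambda>v. h0 v * exp (- \<rho> (proj \<Lambda> v)))"
  note mm = modified_metric[OF S Haus E h0 pc W0(1) U0(1) \<Omega>_def sub R \<rho>0 nn[unfolded p_def] pos[unfolded p_def] \<rho>_def h_def]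
  have hh: "hermitian_metric S \<Lambda> h" unfolding h_def by (rule hermitian_metric_conformal[OF h0])
  define \<epsilon> where "\<epsilon> = (\<lambda>\<zeta>. inv_into W0 \<phi>0 (z0 + r *\<^sub>R \<zeta>))"
  \<comment> \<open>All three radii 1, \<sigma> and \<sigma>' are used: they turn into the
    coordinate radii r, \<sigma> r and \<sigma>' r of the local construction.\<close>
  have \<epsilon>_ball: "\<epsilon> ` ball 0 s = inv_into W0 \<phi>0 ` ball z0 (s * r)" for s
  proof -
    have "(\<lambda>\<zeta>. z0 + r *\<^sub>R \<zeta>) ` ball 0 s = ball z0 (s * r)"
    proof (intro equalityI subsetI)
      fix z assume z: "z \<in> ball z0 (s * r)"
      have "norm ((1 / r) *\<^sub>R (z - z0)) < s"
        using z r(1) by (simp add: dist_norm norm_minus_commute pos_divide_less_eq)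
      moreover have "z = z0 + r *\<^sub>R ((1 / r) *\<^sub>R (z - z0))" using r(1) by simp
      ultimately show "z \<in> (\<lambda>\<zeta>. z0 + r *\<^sub>R \<zeta>) ` ball 0 s"
        by (intro image_eqI[of _ _ "(1 / r) *\<^sub>R (z - z0)"]) (simp_all only: mem_ball_0)
    qed (use r(1) in \<open>auto simp: dist_norm mult.commute\<close>)
    then show ?thesis unfolding \<epsilon>_def by (metis image_image)
  qed
  have ball\<Omega>: "ball z0 r \<subseteq> \<Omega>" using sub r by auto
  then have ballW: "ball z0 r \<subseteq> \<phi>0 ` W0" by (auto simp: \<Omega>_def)
  have emb: "holomorphic_embedding unit_ball_atlas S \<epsilon>"
    unfolding \<epsilon>_def by (rule holomorphic_embedding_inv_chart[OF S W0(1) r(1) ballW])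
  define B where "B = \<epsilon> ` ball 0 1"
  have B: "B = inv_into W0 \<phi>0 ` ball z0 r" unfolding B_def \<epsilon>_ball by simp
  have oB: "openin (manifold_topology S) B"
    unfolding B by (rule openin_inv_chart_image[OF S W0(1) open_ball ballW])
  have B_in: "x \<in> W0 \<inter> U0" if "x \<in> B" for x
    using that ball\<Omega> inv_chart_in(1)[OF inj0] by (force simp: B \<Omega>_def)
  \<comment> \<open>Half of \<open>G\<close> is taken because the metric is quadratic: |g|^2 = e^(Re
    G), and this cancels the weight e^(-(p + \<rho>0)) wherever p + \<rho>0 = Re G.\<close>
  define g where "g = (\<lambda>x. exp (G (\<phi>0 x) / 2))"
  define l where "l = (\<lambda>x. frame \<Lambda> \<tau>0 x (g x *s e1))"
  have sec: "holomorphic_section_on S \<Lambda> B l"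
    unfolding l_def
  proof (rule holomorphic_section_frame[OF S E U0(1) oB])
    show "B \<subseteq> U0" using B_in by blast
    fix W \<phi> assume W: "(W, \<phi>) \<in> S"
    have "vec_holomorphic_on (\<lambda>z. \<phi>0 (inv_into W \<phi> z)) (\<phi> ` (W \<inter> B))"
      by (rule vec_holomorphic_on_subset[OF atlas_transition[OF S W W0(1)] openin_atlas_image[OF S W oB]])
        (use B_in in blast)
    from holo_fun_compose[OF G this] have "holo_fun (\<lambda>z. G (\<phi>0 (inv_into W \<phi> z))) (\<phi> ` (W \<inter> B))" by simp
    then show "holo_fun (\<lambda>z. g (inv_into W \<phi> z)) (\<phi> ` (W \<inter> B))"
      unfolding g_def
      by (rule holo_fun_field_compose[where g = "\<lambda>u. exp (u / 2)" and g' = "\<lambda>z. exp (G (\<phi>0 (inv_into W \<phi> z)) / 2) / 2"])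
        (auto intro!: derivative_eq_intros)
  qed
  have one: "h (l x) = 1" if x\<epsilon>: "x \<in> \<epsilon> ` ball 0 \<sigma>" for x
  proof -
    obtain z where z: "z \<in> ball z0 (\<sigma> * r)" "x = inv_into W0 \<phi>0 z"
      using x\<epsilon> unfolding \<epsilon>_ball by blast
    have "\<sigma> * r \<le> 1 * r" using assms(5-7) r(1) by (intro mult_right_mono) auto
    moreover have "dist z0 z < \<sigma> * r" using z(1) by simp
    ultimately have "dist z0 z < r" "dist z0 z < 2 * R" using r by linarith+
    then have zr: "z \<in> ball z0 r" "z \<in> ball z0 (2 * R)" by simp_all
    then have z\<Omega>: "z \<in> \<Omega>" using ball\<Omega> by blast
    have x: "x \<in> W0 \<inter> U0" "\<phi>0 x = z"
      unfolding z(2) using inv_chart_in[OF inj0 z\<Omega>[unfolded \<Omega>_def]] by auto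
    have "x \<in> inv_into W0 \<phi>0 ` ball z0 (2 * R)" unfolding z(2) using zr(2) by (rule imageI)
    then have \<rho>x: "\<rho> x = \<rho>0 z" by (simp add: \<rho>_def x(2))
    have xU: "x \<in> U0" using x(1) by blast
    have "h (l x) = (cmod (g x))\<^sup>2 * exp (- p z) * exp (- \<rho>0 z)"
      unfolding h_def l_def frame_props(6)[OF E U0(1) xU] metric_frame_pot(1)[OF E U0(1) xU h0] \<rho>x
      by (simp add: p_def z(2))
    also have "(cmod (g x))\<^sup>2 = exp (Re (G z))"
      unfolding g_def x(2) by (simp add: power2_eq_square flip: exp_add)
    also have "Re (G z) = p z + \<rho>0 z" using flat[of z] z(1) by simp
    finally show ?thesis by (simp add: flip: exp_add)
  qed
  show ?thesis
  proof (intro exI conjI ballI)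
    show "hermitian_metric S \<Lambda> h" by (rule hh)
    show "smooth_metric S \<Lambda> h" by (rule smooth_pot_imp_smooth_metric(1)[OF S E hh mm(1)])
    show "semipositively_curved S \<Lambda> h" by (rule mm(2))
    show "holomorphic_embedding unit_ball_atlas S \<epsilon>" by (rule emb)
    show "holomorphic_section_on S \<Lambda> (\<epsilon> ` ball 0 1) l" using sec by (simp add: B_def)
    show "h (l x) = 1" if "x \<in> \<epsilon> ` ball 0 \<sigma>" for x by (rule one[OF that])
    show "positively_curved_over S \<Lambda> h (points S - \<epsilon> ` ball 0 \<sigma>')"
      unfolding \<epsilon>_ball by (rule mm(3))
  qed
qed

end
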